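(* Let $k$ be a field, $c \ge 1$ an integer, and $A$ the exterior algebra $k\langle x_1, \dots, x_c \rangle / (x_i^2, \{x_i x_j + x_j x_i\}_{i \neq j})$. Then, given two finitely generated left $A$-modules $M$ and $N$, either $\operatorname{Ext}_A^n(M,N) = 0$ for all $n > 0$, or there exists a non-negative integer $m_0$ such that $\operatorname{Ext}_A^n(M,N) \neq 0$ for all even integers $n \ge m_0$, or $\operatorname{Ext}_A^n(M,N) \neq 0$ for all odd integers $n \ge m_0$.
   Context: $k\langle x_1, \dots, x_c\rangle$ denotes the free associative $k$-algebra on $x_1, \dots, x_c$; $A$ is its quotient by the two-sided ideal generated by $x_i^2$ for $1 \le i \le c$ and $x_i x_j + x_j x_i$ for $i \ne j$. *)

theory Defs
  imports "HOL-Algebra.QuotRing" "HOL-Algebra.Module" "HOL-Algebra.Elementary_Groups"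
begin

section \<open>The free associative algebra and the exterior algebra\<close>

text \<open>
  Elements of \<open>k\<langle>x\<^sub>1, \<dots>, x\<^sub>c\<rangle>\<close> are finitely supported functions on words in the letters
  \<open>1, \<dots>, c\<close>; the value at a word is the coefficient of the corresponding monomial. The product
  is convolution over all factorizations of a word into a prefix and a suffix.
\<close>

definition free_algebra :: "('k, 'x) ring_scheme \<Rightarrow> nat \<Rightarrow> (nat list \<Rightarrow> 'k) ring" where
  "free_algebra K c =
    \<lparr>carrier = {f. (\<forall>w. f w \<in> carrier K) \<and> finite {w. f w \<noteq> \<zero>\<^bsub>K\<^esub>} \<and>
                   (\<forall>w. \<not> set w \<subseteq> {1..c} \<longrightarrow> f w = \<zero>\<^bsub>K\<^esub>)},
     monoid.mult = (\<lambda>f g w. \<Oplus>\<^bsub>K\<^esub>i\<in>{..length w}. f (take i w) \<otimes>\<^bsub>K\<^esub> g (drop i w)),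
     one = (\<lambda>w. if w = [] then \<one>\<^bsub>K\<^esub> else \<zero>\<^bsub>K\<^esub>),
     ring.zero = (\<lambda>w. \<zero>\<^bsub>K\<^esub>),
     add = (\<lambda>f g w. f w \<oplus>\<^bsub>K\<^esub> g w)\<rparr>"

definition free_gen :: "('k, 'x) ring_scheme \<Rightarrow> nat \<Rightarrow> nat list \<Rightarrow> 'k" where
  "free_gen K i = (\<lambda>w. if w = [i] then \<one>\<^bsub>K\<^esub> else \<zero>\<^bsub>K\<^esub>)"

definition exterior_relations :: "('k, 'x) ring_scheme \<Rightarrow> nat \<Rightarrow> (nat list \<Rightarrow> 'k) set" where
  "exterior_relations K c =
    (let F = free_algebra K c; x = free_gen K in
      {x i \<otimes>\<^bsub>F\<^esub> x i | i. i \<in> {1..c}} \<union>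
      {(x i \<otimes>\<^bsub>F\<^esub> x j) \<oplus>\<^bsub>F\<^esub> (x j \<otimes>\<^bsub>F\<^esub> x i) | i j. i \<in> {1..c} \<and> j \<in> {1..c} \<and> i \<noteq> j})"

definition exterior_algebra :: "('k, 'x) ring_scheme \<Rightarrow> nat \<Rightarrow> (nat list \<Rightarrow> 'k) set ring" where
  "exterior_algebra K c =
    free_algebra K c Quot (Idl\<^bsub>free_algebra K c\<^esub> (exterior_relations K c))"


section \<open>Left modules over a ring that need not be commutative\<close>

text \<open>The locale \<open>module\<close> of the library insists on a commutative base ring.\<close>

locale left_module = R?: ring R + M?: abelian_group M for R (structure) and M (structure) +
  assumes smult_closed [simp, intro]:
      "\<lbrakk>a \<in> carrier R; x \<in> carrier M\<rbrakk> \<Longrightarrow> a \<odot>\<^bsub>M\<^esub> x \<in> carrier M"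
    and smult_l_distr:
      "\<lbrakk>a \<in> carrier R; b \<in> carrier R; x \<in> carrier M\<rbrakk> \<Longrightarrow>
        (a \<oplus> b) \<odot>\<^bsub>M\<^esub> x = a \<odot>\<^bsub>M\<^esub> x \<oplus>\<^bsub>M\<^esub> b \<odot>\<^bsub>M\<^esub> x"
    and smult_r_distr:
      "\<lbrakk>a \<in> carrier R; x \<in> carrier M; y \<in> carrier M\<rbrakk> \<Longrightarrow>
        a \<odot>\<^bsub>M\<^esub> (x \<oplus>\<^bsub>M\<^esub> y) = a \<odot>\<^bsub>M\<^esub> x \<oplus>\<^bsub>M\<^esub> a \<odot>\<^bsub>M\<^esub> y"
    and smult_assoc1:
      "\<lbrakk>a \<in> carrier R; b \<in> carrier R; x \<in> carrier M\<rbrakk> \<Longrightarrow>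
        (a \<otimes> b) \<odot>\<^bsub>M\<^esub> x = a \<odot>\<^bsub>M\<^esub> (b \<odot>\<^bsub>M\<^esub> x)"
    and smult_one [simp]:
      "x \<in> carrier M \<Longrightarrow> \<one> \<odot>\<^bsub>M\<^esub> x = x"

definition finitely_generated_module ::
    "('r, 'x) ring_scheme \<Rightarrow> ('r, 'm, 'y) module_scheme \<Rightarrow> bool" where
  "finitely_generated_module R M \<longleftrightarrow>
    (\<exists>S. finite S \<and> S \<subseteq> carrier M \<and>
      (\<forall>x\<in>carrier M. \<exists>a\<in>S \<rightarrow> carrier R. x = (\<Oplus>\<^bsub>M\<^esub>s\<in>S. a s \<odot>\<^bsub>M\<^esub> s)))"

text \<open>Homomorphisms are extensional, so that equal maps on the carrier are equal functions.\<close>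

definition lin_hom ::
    "('r, 'x) ring_scheme \<Rightarrow> ('r, 'm, 'y) module_scheme \<Rightarrow> ('r, 'n, 'z) module_scheme \<Rightarrow>
      ('m \<Rightarrow> 'n) set" where
  "lin_hom R M N = {f \<in> carrier M \<rightarrow>\<^sub>E carrier N.
      (\<forall>x\<in>carrier M. \<forall>y\<in>carrier M. f (x \<oplus>\<^bsub>M\<^esub> y) = f x \<oplus>\<^bsub>N\<^esub> f y) \<and>
      (\<forall>a\<in>carrier R. \<forall>x\<in>carrier M. f (a \<odot>\<^bsub>M\<^esub> x) = a \<odot>\<^bsub>N\<^esub> f x)}"

definition hom_group ::
    "('r, 'x) ring_scheme \<Rightarrow> ('r, 'm, 'y) module_scheme \<Rightarrow> ('r, 'n, 'z) module_scheme \<Rightarrow>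
      ('m \<Rightarrow> 'n) monoid" where
  "hom_group R M N =
    \<lparr>carrier = lin_hom R M N,
     monoid.mult = (\<lambda>f g. \<lambda>x\<in>carrier M. f x \<oplus>\<^bsub>N\<^esub> g x),
     one = (\<lambda>x\<in>carrier M. \<zero>\<^bsub>N\<^esub>)\<rparr>"

text \<open>The fields \<open>mult\<close> and \<open>one\<close> of a module record carry no meaning.\<close>

definition free_module :: "('r, 'x) ring_scheme \<Rightarrow> 'b set \<Rightarrow> ('r, 'b \<Rightarrow> 'r) module" where
  "free_module R B =
    \<lparr>carrier = {f. (\<forall>b. f b \<in> carrier R) \<and> finite {b. f b \<noteq> \<zero>\<^bsub>R\<^esub>} \<and>
                   (\<forall>b. b \<notin> B \<longrightarrow> f b = \<zero>\<^bsub>R\<^esub>)},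
     monoid.mult = undefined,
     one = undefined,
     ring.zero = (\<lambda>b. \<zero>\<^bsub>R\<^esub>),
     add = (\<lambda>f g b. f b \<oplus>\<^bsub>R\<^esub> g b),
     smult = (\<lambda>a f b. a \<otimes>\<^bsub>R\<^esub> f b)\<rparr>"


section \<open>Free resolutions and Ext\<close>

text \<open>
  The free modules on \<open>B n\<close> form an exact sequence ending in \<open>M \<rightarrow> 0\<close>, with augmentation \<open>\<epsilon>\<close>
  and differentials \<open>d n\<close> from degree \<open>n + 1\<close> to degree \<open>n\<close>.
\<close>

definition free_resolution ::
    "('r, 'x) ring_scheme \<Rightarrow> ('r, 'm, 'y) module_scheme \<Rightarrow> (nat \<Rightarrow> 'b set) \<Rightarrow>
      (nat \<Rightarrow> ('b \<Rightarrow> 'r) \<Rightarrow> ('b \<Rightarrow> 'r)) \<Rightarrow> (('b \<Rightarrow> 'r) \<Rightarrow> 'm) \<Rightarrow> bool" where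
  "free_resolution R M B d \<epsilon> \<longleftrightarrow>
    (let F = (\<lambda>n. free_module R (B n)) in
      \<epsilon> \<in> lin_hom R (F 0) M \<and>
      (\<forall>n. d n \<in> lin_hom R (F (Suc n)) (F n)) \<and>
      \<epsilon> ` carrier (F 0) = carrier M \<and>
      d 0 ` carrier (F 1) = a_kernel (F 0) M \<epsilon> \<and>
      (\<forall>n. d (Suc n) ` carrier (F (Suc (Suc n))) = a_kernel (F (Suc n)) (F n) (d n)))"

definition cochains ::
    "('r, 'x) ring_scheme \<Rightarrow> (nat \<Rightarrow> 'b set) \<Rightarrow> ('r, 'n, 'z) module_scheme \<Rightarrow> nat \<Rightarrow>
      (('b \<Rightarrow> 'r) \<Rightarrow> 'n) monoid" where
  "cochains R B N n = hom_group R (free_module R (B n)) N"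

definition coboundary ::
    "('r, 'x) ring_scheme \<Rightarrow> (nat \<Rightarrow> 'b set) \<Rightarrow> (nat \<Rightarrow> ('b \<Rightarrow> 'r) \<Rightarrow> ('b \<Rightarrow> 'r)) \<Rightarrow> nat \<Rightarrow>
      (('b \<Rightarrow> 'r) \<Rightarrow> 'n) \<Rightarrow> (('b \<Rightarrow> 'r) \<Rightarrow> 'n)" where
  "coboundary R B d n f = compose (carrier (free_module R (B (Suc n)))) f (d n)"

definition cocycles ::
    "('r, 'x) ring_scheme \<Rightarrow> (nat \<Rightarrow> 'b set) \<Rightarrow> (nat \<Rightarrow> ('b \<Rightarrow> 'r) \<Rightarrow> ('b \<Rightarrow> 'r)) \<Rightarrow>
      ('r, 'n, 'z) module_scheme \<Rightarrow> nat \<Rightarrow> (('b \<Rightarrow> 'r) \<Rightarrow> 'n) set" where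
  "cocycles R B d N n =
    kernel (cochains R B N n) (cochains R B N (Suc n)) (coboundary R B d n)"

definition coboundaries ::
    "('r, 'x) ring_scheme \<Rightarrow> (nat \<Rightarrow> 'b set) \<Rightarrow> (nat \<Rightarrow> ('b \<Rightarrow> 'r) \<Rightarrow> ('b \<Rightarrow> 'r)) \<Rightarrow>
      ('r, 'n, 'z) module_scheme \<Rightarrow> nat \<Rightarrow> (('b \<Rightarrow> 'r) \<Rightarrow> 'n) set" where
  "coboundaries R B d N n =
    (case n of 0 \<Rightarrow> {\<one>\<^bsub>cochains R B N 0\<^esub>}
     | Suc m \<Rightarrow> coboundary R B d m ` carrier (cochains R B N m))"

definition cohomology ::
    "('r, 'x) ring_scheme \<Rightarrow> (nat \<Rightarrow> 'b set) \<Rightarrow> (nat \<Rightarrow> ('b \<Rightarrow> 'r) \<Rightarrow> ('b \<Rightarrow> 'r)) \<Rightarrow>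
      ('r, 'n, 'z) module_scheme \<Rightarrow> nat \<Rightarrow> (('b \<Rightarrow> 'r) \<Rightarrow> 'n) set monoid" where
  "cohomology R B d N n =
    (cochains R B N n\<lparr>carrier := cocycles R B d N n\<rparr>) Mod coboundaries R B d N n"

text \<open>
  Names for basis elements. A definition cannot quantify over types, so the resolution defining
  \<open>Ext R M N\<close> has to be chosen within one type depending only on the types of \<open>R\<close> and \<open>M\<close>. The
  type below is large enough for every module to have a free resolution in it: the elements of
  \<open>M\<close> have names, and so do the elements of free modules on sets of names (see
  \<open>free_resolution_exists\<close>).
\<close>

datatype ('r, 'm) basis_name = Gen 'm | Syz "('r \<times> ('r, 'm) basis_name) list"

text \<open>
  The cohomology of \<open>Hom(P, N)\<close> for a chosen free resolution \<open>P\<close> of \<open>M\<close>. The group is written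
  multiplicatively.
\<close>

definition Ext ::
    "('r, 'x) ring_scheme \<Rightarrow> ('r, 'm, 'y) module_scheme \<Rightarrow> ('r, 'n, 'z) module_scheme \<Rightarrow> nat \<Rightarrow>
      ((('r, 'm) basis_name \<Rightarrow> 'r) \<Rightarrow> 'n) set monoid" where
  "Ext R M N n =
    (let (B, d, \<epsilon>) = (SOME P. case P of (B, d, \<epsilon>) \<Rightarrow> free_resolution R M B d \<epsilon>)
     in cohomology R B d N n)"


section \<open>The exterior algebra is a ring\<close>

lemma free_algebra_simps:
  "carrier (free_algebra K c) = {f. (\<forall>w. f w \<in> carrier K) \<and> finite {w. f w \<noteq> \<zero>\<^bsub>K\<^esub>} \<and>
     (\<forall>w. \<not> set w \<subseteq> {1..c} \<longrightarrow> f w = \<zero>\<^bsub>K\<^esub>)}"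
  "f \<otimes>\<^bsub>free_algebra K c\<^esub> g =
     (\<lambda>w. \<Oplus>\<^bsub>K\<^esub>i\<in>{..length w}. f (take i w) \<otimes>\<^bsub>K\<^esub> g (drop i w))"
  "\<one>\<^bsub>free_algebra K c\<^esub> = (\<lambda>w. if w = [] then \<one>\<^bsub>K\<^esub> else \<zero>\<^bsub>K\<^esub>)"
  "\<zero>\<^bsub>free_algebra K c\<^esub> = (\<lambda>w. \<zero>\<^bsub>K\<^esub>)"
  "f \<oplus>\<^bsub>free_algebra K c\<^esub> g = (\<lambda>w. f w \<oplus>\<^bsub>K\<^esub> g w)"
  by (simp_all add: free_algebra_def)

context ring
begin

definition conv :: "(nat list \<Rightarrow> 'a) \<Rightarrow> (nat list \<Rightarrow> 'a) \<Rightarrow> nat list \<Rightarrow> 'a" where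
  "conv f g w = (\<Oplus>i\<in>{..length w}. f (take i w) \<otimes> g (drop i w))"

lemma conv_Nil:
  assumes "range f \<subseteq> carrier R" "range g \<subseteq> carrier R"
  shows "conv f g [] = f [] \<otimes> g []"
  using assms by (simp add: conv_def image_subset_iff)

lemma conv_Cons:
  assumes "range f \<subseteq> carrier R" "range g \<subseteq> carrier R"
  shows "conv f g (x # w) = f [] \<otimes> g (x # w) \<oplus> conv (\<lambda>v. f (x # v)) g w"
proof -
  have "conv f g (x # w) =
      (\<Oplus>i\<in>{..length w}. f (take (Suc i) (x # w)) \<otimes> g (drop (Suc i) (x # w))) \<oplus>
      f [] \<otimes> g (x # w)"
    unfolding conv_def length_Cons using assms
    by (subst finsum_Suc2) (auto simp: image_subset_iff)
  also have "\<dots> = conv (\<lambda>v. f (x # v)) g w \<oplus> f [] \<otimes> g (x # w)"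
    by (simp add: conv_def)
  finally show ?thesis
    using assms by (simp add: a_comm conv_def image_subset_iff Pi_def)
qed

lemma conv_closed:
  assumes "range f \<subseteq> carrier R" "range g \<subseteq> carrier R"
  shows "conv f g w \<in> carrier R"
  using assms by (auto simp: conv_def image_subset_iff)

lemma conv_add_left:
  assumes "range f \<subseteq> carrier R" "range f' \<subseteq> carrier R" "range g \<subseteq> carrier R"
  shows "conv (\<lambda>v. f v \<oplus> f' v) g w = conv f g w \<oplus> conv f' g w"
  using assms by (simp add: conv_def image_subset_iff l_distr Pi_def flip: finsum_addf)

lemma conv_add_right:
  assumes "range f \<subseteq> carrier R" "range g \<subseteq> carrier R" "range g' \<subseteq> carrier R"
  shows "conv f (\<lambda>v. g v \<oplus> g' v) w = conv f g w \<oplus> conv f g' w"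
  using assms by (simp add: conv_def image_subset_iff r_distr Pi_def flip: finsum_addf)

lemma conv_smult:
  assumes "a \<in> carrier R" "range f \<subseteq> carrier R" "range g \<subseteq> carrier R"
  shows "conv (\<lambda>v. a \<otimes> f v) g w = a \<otimes> conv f g w"
  using assms by (simp add: conv_def image_subset_iff m_assoc Pi_def finsum_rdistr)

lemma conv_assoc:
  assumes "range f \<subseteq> carrier R" "range g \<subseteq> carrier R" "range h \<subseteq> carrier R"
  shows "conv (conv f g) h w = conv f (conv g h) w"
  using assms(1)
proof (induction w arbitrary: f)
  case Nil
  have *: "range (conv f g) \<subseteq> carrier R"
    if "range f \<subseteq> carrier R" for f using conv_closed[OF that assms(2)] by auto
  have "range (conv g h) \<subseteq> carrier R"
    using conv_closed[OF assms(2,3)] by auto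
  moreover have "f [] \<in> carrier R" "g [] \<in> carrier R" "h [] \<in> carrier R"
    using assms Nil by auto
  ultimately show ?case
    using Nil assms * by (simp add: conv_Nil m_assoc)
next
  case (Cons x w)
  let ?f = "\<lambda>v. f (x # v)" and ?g = "\<lambda>v. g (x # v)"
  have f: "range ?f \<subseteq> carrier R" and g: "range ?g \<subseteq> carrier R"
    using Cons.prems assms by auto
  have cl: "f [] \<in> carrier R" "g [] \<in> carrier R" "h (x # w) \<in> carrier R"
    using assms Cons.prems by auto
  have fg: "range (conv f g) \<subseteq> carrier R" "range (conv ?f g) \<subseteq> carrier R"
    "range (conv g h) \<subseteq> carrier R"
    "range (\<lambda>v. f [] \<otimes> ?g v) \<subseteq> carrier R"
    using conv_closed Cons.prems assms f g cl by auto
  have "conv (conv f g) h (x # w)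
      = conv f g [] \<otimes> h (x # w) \<oplus> conv (\<lambda>v. conv f g (x # v)) h w"
    using fg assms by (simp add: conv_Cons)
  also have "\<dots> = f [] \<otimes> g [] \<otimes> h (x # w) \<oplus> conv (\<lambda>v. f [] \<otimes> ?g v \<oplus> conv ?f g v) h w"
    using Cons.prems assms by (simp add: conv_Cons conv_Nil)
  also have "\<dots> = f [] \<otimes> g [] \<otimes> h (x # w) \<oplus>
      (f [] \<otimes> conv ?g h w \<oplus> conv (conv ?f g) h w)"
    using fg assms g cl by (simp add: conv_add_left conv_smult)
  also have "\<dots> = f [] \<otimes> (g [] \<otimes> h (x # w) \<oplus> conv ?g h w) \<oplus> conv ?f (conv g h) w"
    using Cons.IH[OF f] conv_closed[OF g assms(3)] conv_closed[OF f fg(3)] cl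
    by (simp add: r_distr m_assoc a_assoc)
  also have "\<dots> = conv f (conv g h) (x # w)"
    using fg assms Cons.prems by (simp add: conv_Cons)
  finally show ?case .
qed

lemma conv_one_left:
  assumes "range f \<subseteq> carrier R"
  shows "conv (\<lambda>w. if w = [] then \<one> else \<zero>) f w = f w"
proof -
  have "conv (\<lambda>w. \<zero>) f w = \<zero>" for w
    using assms by (simp add: conv_def image_subset_iff)
  then show ?thesis
    using assms by (cases w) (auto simp: conv_Nil conv_Cons image_subset_iff)
qed

lemma conv_one_right:
  assumes "range f \<subseteq> carrier R"
  shows "conv f (\<lambda>w. if w = [] then \<one> else \<zero>) w = f w"
  using assms
proof (induction w arbitrary: f)
  case Nil
  then show ?case by (subst conv_Nil) (auto simp: image_subset_iff)
next
  case (Cons x w)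
  then have "range (\<lambda>v. f (x # v)) \<subseteq> carrier R" by auto
  from Cons.IH[OF this] show ?case
    using Cons.prems by (subst conv_Cons) (auto simp: image_subset_iff)
qed

lemma conv_nonzeroE:
  assumes "conv f g w \<noteq> \<zero>" "range f \<subseteq> carrier R" "range g \<subseteq> carrier R"
  obtains u v where "w = u @ v" "f u \<noteq> \<zero>" "g v \<noteq> \<zero>"
proof -
  have "\<exists>i. f (take i w) \<otimes> g (drop i w) \<noteq> \<zero>"
    using assms(1) by (auto simp: conv_def intro: ccontr)
  then obtain i where i: "f (take i w) \<otimes> g (drop i w) \<noteq> \<zero>" ..
  have "f (take i w) \<in> carrier R" "g (drop i w) \<in> carrier R" using assms by auto
  with i have "f (take i w) \<noteq> \<zero>" "g (drop i w) \<noteq> \<zero>" by auto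
  then show thesis using that[of "take i w" "drop i w"] by simp
qed

lemma mult_free_algebra: "f \<otimes>\<^bsub>free_algebra R c\<^esub> g = conv f g"
  by (simp add: free_algebra_simps conv_def fun_eq_iff)

lemma free_algebra_range: "f \<in> carrier (free_algebra R c) \<Longrightarrow> range f \<subseteq> carrier R"
  by (auto simp: free_algebra_simps)

lemma free_algebra_ring: "ring (free_algebra R c)"
proof (rule ringI)
  let ?F = "free_algebra R c"
  show "abelian_group ?F"
  proof (rule abelian_groupI)
    fix f g assume f: "f \<in> carrier ?F" and g: "g \<in> carrier ?F"
    have "{w. f w \<oplus> g w \<noteq> \<zero>} \<subseteq> {w. f w \<noteq> \<zero>} \<union> {w. g w \<noteq> \<zero>}"
      by auto
    with f g show "f \<oplus>\<^bsub>?F\<^esub> g \<in> carrier ?F"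
      by (auto simp: free_algebra_simps intro: finite_subset)
    show "f \<oplus>\<^bsub>?F\<^esub> g = g \<oplus>\<^bsub>?F\<^esub> f"
      using f g by (auto simp: free_algebra_simps a_comm)
  next
    fix f assume f: "f \<in> carrier ?F"
    have "{w. \<ominus> f w \<noteq> \<zero>} \<subseteq> {w. f w \<noteq> \<zero>}"
      by auto
    with f have "(\<lambda>w. \<ominus> f w) \<in> carrier ?F"
      by (auto simp: free_algebra_simps intro: finite_subset)
    moreover have "(\<lambda>w. \<ominus> f w) \<oplus>\<^bsub>?F\<^esub> f = \<zero>\<^bsub>?F\<^esub>"
      using f by (auto simp: free_algebra_simps l_neg)
    ultimately show "\<exists>g\<in>carrier ?F. g \<oplus>\<^bsub>?F\<^esub> f = \<zero>\<^bsub>?F\<^esub>" by blast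
  qed (auto simp: free_algebra_simps a_assoc)
  show "Group.monoid ?F"
  proof (rule monoidI)
    fix f g assume f: "f \<in> carrier ?F" and g: "g \<in> carrier ?F"
    note r = free_algebra_range[OF f] free_algebra_range[OF g]
    have "{w. conv f g w \<noteq> \<zero>} \<subseteq> (\<lambda>(u, v). u @ v) ` ({w. f w \<noteq> \<zero>} \<times> {w. g w \<noteq> \<zero>})"
      by (auto elim!: conv_nonzeroE[OF _ r])
    then have "finite {w. conv f g w \<noteq> \<zero>}"
      by (rule finite_subset) (use f g in \<open>auto simp: free_algebra_simps\<close>)
    moreover have "conv f g w = \<zero>" if "\<not> set w \<subseteq> {1..c}" for w
    proof (rule ccontr)
      assume "conv f g w \<noteq> \<zero>"
      then obtain u v where uv: "w = u @ v" "f u \<noteq> \<zero>" "g v \<noteq> \<zero>"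
        by (rule conv_nonzeroE[OF _ r])
      then have "set u \<subseteq> {1..c}" "set v \<subseteq> {1..c}"
        using f g unfolding free_algebra_simps by blast+
      with that uv show False by simp
    qed
    ultimately show "f \<otimes>\<^bsub>?F\<^esub> g \<in> carrier ?F"
      using conv_closed[OF r] unfolding mult_free_algebra by (simp add: free_algebra_simps)
  next
    fix f g h assume "f \<in> carrier ?F" "g \<in> carrier ?F" "h \<in> carrier ?F"
    then show "f \<otimes>\<^bsub>?F\<^esub> g \<otimes>\<^bsub>?F\<^esub> h = f \<otimes>\<^bsub>?F\<^esub> (g \<otimes>\<^bsub>?F\<^esub> h)"
      unfolding mult_free_algebra by (intro ext conv_assoc free_algebra_range)
  next
    show "\<one>\<^bsub>?F\<^esub> \<in> carrier ?F"
      by (auto simp: free_algebra_simps intro: finite_subset[of _ "{[]}"])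
  next
    fix f assume "f \<in> carrier ?F"
    then show "\<one>\<^bsub>?F\<^esub> \<otimes>\<^bsub>?F\<^esub> f = f" "f \<otimes>\<^bsub>?F\<^esub> \<one>\<^bsub>?F\<^esub> = f"
      unfolding mult_free_algebra free_algebra_simps(3)
      by (intro ext conv_one_left conv_one_right free_algebra_range, assumption)+
  qed
  fix f g h assume "f \<in> carrier ?F" "g \<in> carrier ?F" "h \<in> carrier ?F"
  note r = this[THEN free_algebra_range]
  show "(f \<oplus>\<^bsub>?F\<^esub> g) \<otimes>\<^bsub>?F\<^esub> h = f \<otimes>\<^bsub>?F\<^esub> h \<oplus>\<^bsub>?F\<^esub> g \<otimes>\<^bsub>?F\<^esub> h"
    "h \<otimes>\<^bsub>?F\<^esub> (f \<oplus>\<^bsub>?F\<^esub> g) = h \<otimes>\<^bsub>?F\<^esub> f \<oplus>\<^bsub>?F\<^esub> h \<otimes>\<^bsub>?F\<^esub> g"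
    unfolding mult_free_algebra free_algebra_simps(5)
    using r by (auto simp: conv_add_left conv_add_right fun_eq_iff)
qed

lemma exterior_algebra_ring: "ring (exterior_algebra R c)"
proof -
  interpret F: ring "free_algebra R c" by (rule free_algebra_ring)
  have x: "free_gen R i \<in> carrier (free_algebra R c)" if "i \<in> {1..c}" for i
    using that by (auto simp: free_gen_def free_algebra_simps intro: finite_subset[of _ "{[i]}"])
  have "exterior_relations R c \<subseteq> carrier (free_algebra R c)"
    using x by (auto simp: exterior_relations_def Let_def)
  then show ?thesis
    unfolding exterior_algebra_def by (intro ideal.quotient_is_ring F.genideal_ideal)
qed

end


section \<open>Every module has a free resolution\<close>

lemma free_module_simps:
  "carrier (free_module R B) = {f. (\<forall>b. f b \<in> carrier R) \<and> finite {b. f b \<noteq> \<zero>\<^bsub>R\<^esub>} \<and>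
     (\<forall>b. b \<notin> B \<longrightarrow> f b = \<zero>\<^bsub>R\<^esub>)}"
  "\<zero>\<^bsub>free_module R B\<^esub> = (\<lambda>b. \<zero>\<^bsub>R\<^esub>)"
  "f \<oplus>\<^bsub>free_module R B\<^esub> g = (\<lambda>b. f b \<oplus>\<^bsub>R\<^esub> g b)"
  "a \<odot>\<^bsub>free_module R B\<^esub> f = (\<lambda>b. a \<otimes>\<^bsub>R\<^esub> f b)"
  by (simp_all add: free_module_def)

lemma (in ring) free_module_left_module: "left_module R (free_module R B)"
proof -
  let ?F = "free_module R B"
  have "abelian_group ?F"
  proof (rule abelian_groupI)
    fix f g assume f: "f \<in> carrier ?F" and g: "g \<in> carrier ?F"
    have "{w. f w \<oplus> g w \<noteq> \<zero>} \<subseteq> {w. f w \<noteq> \<zero>} \<union> {w. g w \<noteq> \<zero>}"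
      by auto
    with f g show "f \<oplus>\<^bsub>?F\<^esub> g \<in> carrier ?F"
      by (auto simp: free_module_simps intro: finite_subset)
    show "f \<oplus>\<^bsub>?F\<^esub> g = g \<oplus>\<^bsub>?F\<^esub> f"
      using f g by (auto simp: free_module_simps a_comm)
  next
    fix f assume f: "f \<in> carrier ?F"
    have "{w. \<ominus> f w \<noteq> \<zero>} \<subseteq> {w. f w \<noteq> \<zero>}"
      by auto
    with f have "(\<lambda>w. \<ominus> f w) \<in> carrier ?F"
      by (auto simp: free_module_simps intro: finite_subset)
    moreover have "(\<lambda>w. \<ominus> f w) \<oplus>\<^bsub>?F\<^esub> f = \<zero>\<^bsub>?F\<^esub>"
      using f by (auto simp: free_module_simps l_neg)
    ultimately show "\<exists>g\<in>carrier ?F. g \<oplus>\<^bsub>?F\<^esub> f = \<zero>\<^bsub>?F\<^esub>" by blast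
  qed (auto simp: free_module_simps a_assoc)
  moreover have "left_module_axioms R ?F"
  proof
    fix a f assume a: "a \<in> carrier R" and f: "f \<in> carrier ?F"
    have "{b. a \<otimes> f b \<noteq> \<zero>} \<subseteq> {b. f b \<noteq> \<zero>}" using a by auto
    with a f show "a \<odot>\<^bsub>?F\<^esub> f \<in> carrier ?F"
      by (auto simp: free_module_simps intro: finite_subset)
  qed (auto simp: free_module_simps l_distr r_distr m_assoc)
  ultimately show ?thesis
    by (intro left_module.intro ring_axioms)
qed

context left_module
begin

lemma smult_zero_left: "x \<in> carrier M \<Longrightarrow> \<zero> \<odot>\<^bsub>M\<^esub> x = \<zero>\<^bsub>M\<^esub>"
  by (metis M.add.r_cancel_one R.l_zero R.zero_closed smult_closed smult_l_distr)

lemma smult_zero_right: "a \<in> carrier R \<Longrightarrow> a \<odot>\<^bsub>M\<^esub> \<zero>\<^bsub>M\<^esub> = \<zero>\<^bsub>M\<^esub>"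
  by (metis M.add.r_cancel_one M.l_zero M.zero_closed smult_closed smult_r_distr)

lemma smult_finsum:
  assumes "finite A" "a \<in> carrier R" "f \<in> A \<rightarrow> carrier M"
  shows "a \<odot>\<^bsub>M\<^esub> (\<Oplus>\<^bsub>M\<^esub>i\<in>A. f i) = (\<Oplus>\<^bsub>M\<^esub>i\<in>A. a \<odot>\<^bsub>M\<^esub> f i)"
  using assms(1,3)
  by (induction A) (use assms(2) in \<open>auto simp: smult_zero_right smult_r_distr Pi_def\<close>)

definition combination :: "('i \<Rightarrow> 'c) \<Rightarrow> ('i \<Rightarrow> 'a) \<Rightarrow> 'c" where
  "combination \<phi> f = (\<Oplus>\<^bsub>M\<^esub>b\<in>{b. f b \<noteq> \<zero>}. f b \<odot>\<^bsub>M\<^esub> \<phi> b)"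

lemma combination_superset:
  assumes "f \<in> carrier (free_module R B)" "\<phi> \<in> B \<rightarrow> carrier M"
    "finite S" "{b. f b \<noteq> \<zero>} \<subseteq> S" "S \<subseteq> B"
  shows "combination \<phi> f = (\<Oplus>\<^bsub>M\<^esub>b\<in>S. f b \<odot>\<^bsub>M\<^esub> \<phi> b)"
  unfolding combination_def
  by (rule M.add.finprod_mono_neutral_cong_left)
    (use assms in \<open>auto simp: free_module_simps smult_zero_left Pi_def subset_iff\<close>)

lemma combination_lin_hom:
  assumes \<phi>: "\<phi> \<in> B \<rightarrow> carrier M"
  shows "restrict (combination \<phi>) (carrier (free_module R B)) \<in> lin_hom R (free_module R B) M"
proof -
  let ?F = "free_module R B"
  interpret F: left_module R ?F by (rule R.free_module_left_module)
  have supp: "finite {b. f b \<noteq> \<zero>}" "{b. f b \<noteq> \<zero>} \<subseteq> B" if "f \<in> carrier ?F" for f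
    using that by (auto simp: free_module_simps)
  have cl: "(\<lambda>b. f b \<odot>\<^bsub>M\<^esub> \<phi> b) \<in> S \<rightarrow> carrier M" if "f \<in> carrier ?F" "S \<subseteq> B" for f S
    using that \<phi> by (auto simp: free_module_simps Pi_def)
  have closed: "combination \<phi> f \<in> carrier M" if "f \<in> carrier ?F" for f
    unfolding combination_def by (intro M.finsum_closed cl that supp)
  have add: "combination \<phi> (f \<oplus>\<^bsub>?F\<^esub> g) = combination \<phi> f \<oplus>\<^bsub>M\<^esub> combination \<phi> g"
    if f: "f \<in> carrier ?F" and g: "g \<in> carrier ?F" for f g
  proof -
    let ?S = "{b. f b \<noteq> \<zero>} \<union> {b. g b \<noteq> \<zero>}"
    have S: "finite ?S" "?S \<subseteq> B" using supp f g by auto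
    have "combination \<phi> (f \<oplus>\<^bsub>?F\<^esub> g) = (\<Oplus>\<^bsub>M\<^esub>b\<in>?S. (f b \<oplus> g b) \<odot>\<^bsub>M\<^esub> \<phi> b)"
      by (subst combination_superset[OF F.add.m_closed[OF f g] \<phi> S(1) _ S(2)])
        (auto simp: free_module_simps)
    also have "\<dots> = (\<Oplus>\<^bsub>M\<^esub>b\<in>?S. f b \<odot>\<^bsub>M\<^esub> \<phi> b \<oplus>\<^bsub>M\<^esub> g b \<odot>\<^bsub>M\<^esub> \<phi> b)"
    proof (rule M.finsum_cong')
      show "(\<lambda>b. f b \<odot>\<^bsub>M\<^esub> \<phi> b \<oplus>\<^bsub>M\<^esub> g b \<odot>\<^bsub>M\<^esub> \<phi> b) \<in> ?S \<rightarrow> carrier M"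
        using cl[OF f S(2)] cl[OF g S(2)] by (simp add: Pi_def)
      fix b assume "b \<in> ?S"
      then have "\<phi> b \<in> carrier M" using S(2) \<phi> by blast
      then show "(f b \<oplus> g b) \<odot>\<^bsub>M\<^esub> \<phi> b = f b \<odot>\<^bsub>M\<^esub> \<phi> b \<oplus>\<^bsub>M\<^esub> g b \<odot>\<^bsub>M\<^esub> \<phi> b"
        using f g by (simp add: free_module_simps smult_l_distr)
    qed simp
    also have "\<dots> = combination \<phi> f \<oplus>\<^bsub>M\<^esub> combination \<phi> g"
      using combination_superset[OF f \<phi> S(1) _ S(2)] combination_superset[OF g \<phi> S(1) _ S(2)]
        cl[OF f S(2)] cl[OF g S(2)] by (simp add: M.finsum_addf)
    finally show ?thesis .
  qed
  have smult: "combination \<phi> (a \<odot>\<^bsub>?F\<^esub> f) = a \<odot>\<^bsub>M\<^esub> combination \<phi> f"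
    if a: "a \<in> carrier R" and f: "f \<in> carrier ?F" for a f
  proof -
    let ?S = "{b. f b \<noteq> \<zero>}"
    note S = supp[OF f]
    have "combination \<phi> (a \<odot>\<^bsub>?F\<^esub> f) = (\<Oplus>\<^bsub>M\<^esub>b\<in>?S. (a \<otimes> f b) \<odot>\<^bsub>M\<^esub> \<phi> b)"
      by (subst combination_superset[OF F.smult_closed[OF a f] \<phi> S(1) _ S(2)])
        (use a in \<open>auto simp: free_module_simps\<close>)
    also have "\<dots> = (\<Oplus>\<^bsub>M\<^esub>b\<in>?S. a \<odot>\<^bsub>M\<^esub> (f b \<odot>\<^bsub>M\<^esub> \<phi> b))"
    proof (rule M.finsum_cong')
      show "(\<lambda>b. a \<odot>\<^bsub>M\<^esub> (f b \<odot>\<^bsub>M\<^esub> \<phi> b)) \<in> ?S \<rightarrow> carrier M"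
        using cl[OF f S(2)] a by (simp add: Pi_def)
      fix b assume "b \<in> ?S"
      then have "\<phi> b \<in> carrier M" using S(2) \<phi> by blast
      then show "(a \<otimes> f b) \<odot>\<^bsub>M\<^esub> \<phi> b = a \<odot>\<^bsub>M\<^esub> (f b \<odot>\<^bsub>M\<^esub> \<phi> b)"
        using f a by (simp add: free_module_simps smult_assoc1)
    qed simp
    also have "\<dots> = a \<odot>\<^bsub>M\<^esub> combination \<phi> f"
      unfolding combination_def by (intro smult_finsum[symmetric] S a cl f)
    finally show ?thesis .
  qed
  show ?thesis
    using closed add smult by (simp add: lin_hom_def)
qed

lemma free_cover:
  assumes \<phi>: "\<phi> ` B = carrier M"
  shows "\<exists>h\<in>lin_hom R (free_module R B) M. h ` carrier (free_module R B) = carrier M"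
proof
  let ?F = "free_module R B"
  let ?h = "restrict (combination \<phi>) (carrier ?F)"
  have \<phi>': "\<phi> \<in> B \<rightarrow> carrier M" using \<phi> by auto
  show h: "?h \<in> lin_hom R ?F M" by (rule combination_lin_hom[OF \<phi>'])
  have "x \<in> ?h ` carrier ?F" if "x \<in> carrier M" for x
  proof -
    from that \<phi> obtain b where b: "b \<in> B" "x = \<phi> b" by auto
    let ?\<delta> = "\<lambda>b'. if b' = b then \<one> else \<zero>"
    have \<delta>: "?\<delta> \<in> carrier ?F"
      using b by (auto simp: free_module_simps intro: finite_subset[of _ "{b}"])
    have "combination \<phi> ?\<delta> = (\<Oplus>\<^bsub>M\<^esub>b'\<in>{b}. ?\<delta> b' \<odot>\<^bsub>M\<^esub> \<phi> b')"
      by (rule combination_superset[OF \<delta> \<phi>']) (use b in auto)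
    also have "\<dots> = x"
      using b that by (subst M.finsum_insert) auto
    finally show ?thesis using \<delta> by force
  qed
  moreover have "?h ` carrier ?F \<subseteq> carrier M"
    using h unfolding lin_hom_def by (auto simp: PiE_iff)
  ultimately show "?h ` carrier ?F = carrier M" by blast
qed

lemma lin_hom_kernel_left_module:
  assumes N: "left_module R N" and h: "h \<in> lin_hom R M N"
  shows "left_module R (M\<lparr>carrier := a_kernel M N h\<rparr>)"
proof -
  interpret N: left_module R N by (rule N)
  let ?K = "M\<lparr>carrier := a_kernel M N h\<rparr>"
  have add: "h (x \<oplus>\<^bsub>M\<^esub> y) = h x \<oplus>\<^bsub>N\<^esub> h y" if "x \<in> carrier M" "y \<in> carrier M" for x y
    using h that by (simp add: lin_hom_def)
  have sm: "h (a \<odot>\<^bsub>M\<^esub> x) = a \<odot>\<^bsub>N\<^esub> h x" if "a \<in> carrier R" "x \<in> carrier M" for a x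
    using h that by (simp add: lin_hom_def)
  have cl: "h x \<in> carrier N" if "x \<in> carrier M" for x
    using h that by (auto simp: lin_hom_def)
  have zero: "h \<zero>\<^bsub>M\<^esub> = \<zero>\<^bsub>N\<^esub>"
    by (metis M.l_zero M.zero_closed N.add.r_cancel_one add cl)
  have neg: "\<exists>y\<in>a_kernel M N h. y \<oplus>\<^bsub>M\<^esub> x = \<zero>\<^bsub>M\<^esub>" if "x \<in> a_kernel M N h" for x
  proof
    from that have x: "x \<in> carrier M" "h x = \<zero>\<^bsub>N\<^esub>" by (auto simp: a_kernel_def')
    show "\<ominus>\<^bsub>M\<^esub> x \<oplus>\<^bsub>M\<^esub> x = \<zero>\<^bsub>M\<^esub>" using x by (simp add: M.l_neg)
    have "h (\<ominus>\<^bsub>M\<^esub> x) \<oplus>\<^bsub>N\<^esub> \<zero>\<^bsub>N\<^esub> = \<zero>\<^bsub>N\<^esub>"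
      using add[of "\<ominus>\<^bsub>M\<^esub> x" x] x zero by (simp add: M.l_neg)
    then show "\<ominus>\<^bsub>M\<^esub> x \<in> a_kernel M N h"
      using x cl[of "\<ominus>\<^bsub>M\<^esub> x"] by (simp add: a_kernel_def')
  qed
  have "abelian_group ?K"
    by (rule abelian_groupI)
      (use neg in \<open>auto simp: a_kernel_def' add zero M.a_assoc intro: M.a_comm\<close>)
  moreover have "left_module_axioms R ?K"
    by unfold_locales
      (auto simp: a_kernel_def' sm N.smult_zero_right smult_l_distr smult_r_distr smult_assoc1)
  ultimately show ?thesis
    by (intro left_module.intro R.ring_axioms)
qed

end

definition syz_name :: "('r, 'x) ring_scheme \<Rightarrow> (('r, 'm) basis_name \<Rightarrow> 'r) \<Rightarrow> ('r, 'm) basis_name"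
  where "syz_name R f = Syz (SOME xs. set xs = (\<lambda>b. (f b, b)) ` {b. f b \<noteq> \<zero>\<^bsub>R\<^esub>})"

lemma syz_name_inj:
  fixes R :: "('r, 'x) ring_scheme" and B :: "('r, 'm) basis_name set"
  shows "inj_on (syz_name R) (carrier (free_module R B))"
proof (rule inj_onI)
  define gr where "gr f = (\<lambda>b. (f b, b)) ` {b. f b \<noteq> \<zero>\<^bsub>R\<^esub>}" for f :: "('r, 'm) basis_name \<Rightarrow> 'r"
  have gr: "(f b, b) \<in> gr f \<longleftrightarrow> f b \<noteq> \<zero>\<^bsub>R\<^esub>" "(y, b) \<in> gr f \<Longrightarrow> y = f b" for f b y
    by (auto simp: gr_def)
  fix f g assume f: "f \<in> carrier (free_module R B)" and g: "g \<in> carrier (free_module R B)"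
    and fg: "syz_name R f = syz_name R g"
  have *: "set (SOME xs. set xs = gr f) = gr f" if "f \<in> carrier (free_module R B)" for f
    by (rule someI_ex, rule finite_list) (use that in \<open>simp add: gr_def free_module_simps\<close>)
  have "(SOME xs. set xs = gr f) = (SOME xs. set xs = gr g)"
    using fg unfolding syz_name_def gr_def by (rule basis_name.inject(2)[THEN iffD1])
  then have eq: "gr f = gr g"
    using *[OF f] *[OF g] by metis
  show "f = g"
  proof
    fix b
    show "f b = g b"
      using gr[where f = f and b = b] gr[where f = g and b = b] eq by metis
  qed
qed

theorem free_resolution_exists:
  fixes R :: "('r, 'x) ring_scheme" and M :: "('r, 'm, 'y) module_scheme"
  assumes M: "left_module R M"
  shows "\<exists>(B :: nat \<Rightarrow> ('r, 'm) basis_name set) d \<epsilon>. free_resolution R M B d \<epsilon>"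
proof -
  interpret M: left_module R M by (rule M)
  let ?F = "\<lambda>B :: ('r, 'm) basis_name set. free_module R B"
  define B0 :: "('r, 'm) basis_name set" where "B0 = Gen ` carrier M"
  have "(\<lambda>g. case g of Gen m \<Rightarrow> m) ` B0 = carrier M"
    by (force simp: B0_def image_image)
  from M.free_cover[OF this] obtain \<epsilon> where
    \<epsilon>: "\<epsilon> \<in> lin_hom R (?F B0) M" "\<epsilon> ` carrier (?F B0) = carrier M" by blast
  interpret F0: left_module R "?F B0" by (rule M.R.free_module_left_module)
  define P where "P = (\<lambda>(n::nat) (B, K, d :: (('r, 'm) basis_name \<Rightarrow> 'r) \<Rightarrow> ('r, 'm) basis_name \<Rightarrow> 'r).
    K \<subseteq> carrier (?F B) \<and> left_module R ((?F B)\<lparr>carrier := K\<rparr>) \<and>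
    (n = 0 \<longrightarrow> B = B0 \<and> K = a_kernel (?F B0) M \<epsilon>))"
  define Q where "Q = (\<lambda>(n::nat) (B, K, d :: (('r, 'm) basis_name \<Rightarrow> 'r) \<Rightarrow> ('r, 'm) basis_name \<Rightarrow> 'r) (B', K', d').
    d' \<in> lin_hom R (?F B') (?F B) \<and> d' ` carrier (?F B') = K \<and> K' = a_kernel (?F B') (?F B) d')"
  have start: "\<exists>X. P 0 X"
    using F0.lin_hom_kernel_left_module[OF M \<epsilon>(1)]
    by (intro exI[of _ "(B0, a_kernel (?F B0) M \<epsilon>, undefined)"])
      (auto simp: P_def a_kernel_def')
  have step: "\<exists>Y. P (Suc n) Y \<and> Q n X Y" if PX: "P n X" for X n
  proof -
    obtain B K d where X: "X = (B, K, d)" by (cases X)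
    with PX have K: "K \<subseteq> carrier (?F B)" and "left_module R ((?F B)\<lparr>carrier := K\<rparr>)"
      by (auto simp: P_def)
    then interpret K: left_module R "(?F B)\<lparr>carrier := K\<rparr>" by simp
    let ?B = "syz_name R ` K"
    have "inv_into K (syz_name R) ` ?B = carrier ((?F B)\<lparr>carrier := K\<rparr>)"
      using inj_on_subset[OF syz_name_inj K] by (force simp: image_image)
    from K.free_cover[OF this] obtain h where
      h: "h \<in> lin_hom R (?F ?B) ((?F B)\<lparr>carrier := K\<rparr>)" "h ` carrier (?F ?B) = K" by auto
    have h': "h \<in> lin_hom R (?F ?B) (?F B)"
      using h(1) K by (auto simp: lin_hom_def PiE_iff)
    interpret F': left_module R "?F ?B" by (rule M.R.free_module_left_module)
    have "P (Suc n) (?B, a_kernel (?F ?B) (?F B) h, h)"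
      using F'.lin_hom_kernel_left_module[OF M.R.free_module_left_module h']
      by (auto simp: P_def a_kernel_def')
    moreover have "Q n X (?B, a_kernel (?F ?B) (?F B) h, h)"
      using h h' by (simp add: Q_def X)
    ultimately show ?thesis by blast
  qed
  obtain X where X: "\<And>n. P n (X n)" "\<And>n. Q n (X n) (X (Suc n))"
    using dependent_nat_choice[of P Q] start step by metis
  define B where "B n = fst (X n)" for n
  define K where "K n = fst (snd (X n))" for n
  define d where "d n = snd (snd (X (Suc n)))" for n
  have *: "B 0 = B0" "K 0 = a_kernel (?F B0) M \<epsilon>"
    using X(1)[of 0] by (auto simp: P_def B_def K_def split: prod.splits)
  have **: "d n \<in> lin_hom R (?F (B (Suc n))) (?F (B n))" "d n ` carrier (?F (B (Suc n))) = K n"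
    "K (Suc n) = a_kernel (?F (B (Suc n))) (?F (B n)) (d n)" for n
    using X(2)[of n] by (auto simp: Q_def B_def K_def d_def split: prod.splits)
  have "free_resolution R M B d \<epsilon>"
    unfolding free_resolution_def Let_def using * ** \<epsilon> by auto
  then show ?thesis by blast
qed


section \<open>Ext is an abelian group\<close>

lemma hom_group_comm_group:
  assumes "left_module R M" "left_module R N"
  shows "comm_group (hom_group R M N)"
proof -
  interpret M: left_module R M by fact
  interpret N: left_module R N by fact
  let ?H = "hom_group R M N"
  show ?thesis
  proof (rule comm_groupI)
    fix f g assume fg: "f \<in> carrier ?H" "g \<in> carrier ?H"
    then have cl: "f x \<in> carrier N" "g x \<in> carrier N" if "x \<in> carrier M" for x
      using that by (auto simp: hom_group_def lin_hom_def)
    show "f \<otimes>\<^bsub>?H\<^esub> g \<in> carrier ?H"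
      using fg cl by (simp add: hom_group_def lin_hom_def N.a_ac N.smult_r_distr)
    show "f \<otimes>\<^bsub>?H\<^esub> g = g \<otimes>\<^bsub>?H\<^esub> f"
      using cl by (auto simp: hom_group_def restrict_def N.a_comm fun_eq_iff)
    fix h assume "h \<in> carrier ?H"
    then have "h x \<in> carrier N" if "x \<in> carrier M" for x
      using that by (auto simp: hom_group_def lin_hom_def)
    with cl show "f \<otimes>\<^bsub>?H\<^esub> g \<otimes>\<^bsub>?H\<^esub> h = f \<otimes>\<^bsub>?H\<^esub> (g \<otimes>\<^bsub>?H\<^esub> h)"
      by (auto simp: hom_group_def restrict_def N.a_assoc fun_eq_iff)
  next
    show "\<one>\<^bsub>?H\<^esub> \<in> carrier ?H"
      by (simp add: hom_group_def lin_hom_def N.smult_zero_right)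
  next
    fix f assume f: "f \<in> carrier ?H"
    then have cl: "f x \<in> carrier N" if "x \<in> carrier M" for x
      using that by (auto simp: hom_group_def lin_hom_def)
    have "f \<in> extensional (carrier M)"
      using f by (auto simp: hom_group_def lin_hom_def PiE_def)
    then show "\<one>\<^bsub>?H\<^esub> \<otimes>\<^bsub>?H\<^esub> f = f"
      using cl by (auto simp: hom_group_def fun_eq_iff extensional_def)
    have neg: "a \<odot>\<^bsub>N\<^esub> (\<ominus>\<^bsub>N\<^esub> y) = \<ominus>\<^bsub>N\<^esub> (a \<odot>\<^bsub>N\<^esub> y)" if "a \<in> carrier R" "y \<in> carrier N" for a y
      using that N.smult_r_distr[of a "\<ominus>\<^bsub>N\<^esub> y" y]
      by (simp add: N.l_neg N.smult_zero_right N.minus_equality)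
    let ?g = "\<lambda>x\<in>carrier M. \<ominus>\<^bsub>N\<^esub> f x"
    have "?g \<in> carrier ?H"
      using f cl by (simp add: hom_group_def lin_hom_def N.minus_add neg)
    moreover have "?g \<otimes>\<^bsub>?H\<^esub> f = \<one>\<^bsub>?H\<^esub>"
      using cl by (auto simp: hom_group_def fun_eq_iff N.l_neg)
    ultimately show "\<exists>g\<in>carrier ?H. g \<otimes>\<^bsub>?H\<^esub> f = \<one>\<^bsub>?H\<^esub>" by blast
  qed
qed

lemma cohomology_comm_group:
  assumes M: "left_module R M" and N: "left_module R N"
    and res: "free_resolution R M B d \<epsilon>"
  shows "comm_group (cohomology R B d N n)"
proof -
  interpret M: left_module R M by fact
  interpret N: left_module R N by fact
  let ?F = "\<lambda>n. free_module R (B n)" and ?C = "cochains R B N" and ?\<delta> = "coboundary R B d"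
  have F: "left_module R (?F n)" for n by (rule M.R.free_module_left_module)
  have C: "comm_group (?C n)" for n
    unfolding cochains_def by (rule hom_group_comm_group[OF F N])
  have d: "d n \<in> lin_hom R (?F (Suc n)) (?F n)" for n
    using res by (simp add: free_resolution_def Let_def)
  have d_cl: "d n x \<in> carrier (?F n)" if "x \<in> carrier (?F (Suc n))" for n x
    using d[of n] that by (auto simp: lin_hom_def)
  have dd: "d n (d (Suc n) x) = \<zero>\<^bsub>?F n\<^esub>" if "x \<in> carrier (?F (Suc (Suc n)))" for n x
  proof -
    have "d (Suc n) ` carrier (?F (Suc (Suc n))) = a_kernel (?F (Suc n)) (?F n) (d n)"
      using res by (simp add: free_resolution_def Let_def)
    with that have "d (Suc n) x \<in> a_kernel (?F (Suc n)) (?F n) (d n)" by blast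
    then show ?thesis by (simp add: a_kernel_def')
  qed
  have mem: "?\<delta> n f \<in> carrier (?C (Suc n))" if "f \<in> carrier (?C n)" for n f
  proof -
    interpret F: left_module R "?F (Suc n)" by (rule F)
    have f: "f \<in> lin_hom R (?F n) N" using that by (simp add: cochains_def hom_group_def)
    have f_cl: "f y \<in> carrier N" if "y \<in> carrier (?F n)" for y
      using f that by (auto simp: lin_hom_def)
    have f_lin: "f (y \<oplus>\<^bsub>?F n\<^esub> z) = f y \<oplus>\<^bsub>N\<^esub> f z" "a \<in> carrier R \<Longrightarrow> f (a \<odot>\<^bsub>?F n\<^esub> y) = a \<odot>\<^bsub>N\<^esub> f y"
      if "y \<in> carrier (?F n)" "z \<in> carrier (?F n)" for a y z
      using f that by (simp_all add: lin_hom_def)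
    have d_lin: "d n (y \<oplus>\<^bsub>?F (Suc n)\<^esub> z) = d n y \<oplus>\<^bsub>?F n\<^esub> d n z"
      "a \<in> carrier R \<Longrightarrow> d n (a \<odot>\<^bsub>?F (Suc n)\<^esub> y) = a \<odot>\<^bsub>?F n\<^esub> d n y"
      if "y \<in> carrier (?F (Suc n))" "z \<in> carrier (?F (Suc n))" for a y z
      using d[of n] that by (simp_all add: lin_hom_def)
    have "?\<delta> n f \<in> lin_hom R (?F (Suc n)) N"
      unfolding lin_hom_def coboundary_def compose_def
      by (simp add: f_cl f_lin(1) f_lin(2)[OF d_cl d_cl] d_cl d_lin)
    then show ?thesis by (simp add: cochains_def hom_group_def)
  qed
  have hom: "group_hom (?C n) (?C (Suc n)) (?\<delta> n)" for n
  proof (intro group_hom.intro group_hom_axioms.intro homI)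
    show "Group.group (?C n)" "Group.group (?C (Suc n))" using C comm_group.axioms by blast+
    fix f g assume "f \<in> carrier (?C n)" "g \<in> carrier (?C n)"
    then show "?\<delta> n (f \<otimes>\<^bsub>?C n\<^esub> g) = ?\<delta> n f \<otimes>\<^bsub>?C (Suc n)\<^esub> ?\<delta> n g"
      using d_cl[of _ n]
      by (auto simp: cochains_def hom_group_def coboundary_def compose_def fun_eq_iff)
  qed (rule mem)
  let ?Z = "cocycles R B d N n" and ?B = "coboundaries R B d N n"
  have Z: "subgroup ?Z (?C n)"
    unfolding cocycles_def by (rule group_hom.subgroup_kernel[OF hom])
  have one: "f \<zero>\<^bsub>?F n\<^esub> = \<zero>\<^bsub>N\<^esub>" if "f \<in> carrier (?C n)" for f n
  proof -
    interpret F: left_module R "?F n" by (rule F)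
    have f: "f \<in> lin_hom R (?F n) N" using that by (simp add: cochains_def hom_group_def)
    have "f \<zero>\<^bsub>?F n\<^esub> \<in> carrier N" using f by (auto simp: lin_hom_def)
    moreover have "f \<zero>\<^bsub>?F n\<^esub> \<oplus>\<^bsub>N\<^esub> f \<zero>\<^bsub>?F n\<^esub> = f \<zero>\<^bsub>?F n\<^esub>"
      using f unfolding lin_hom_def
      by (smt (verit, best) F.M.l_zero F.M.zero_closed mem_Collect_eq)
    ultimately show ?thesis by (simp add: N.add.r_cancel_one)
  qed
  have B: "subgroup ?B (?C n)" and BZ: "?B \<subseteq> ?Z"
  proof -
    interpret group_hom "?C n" "?C (Suc n)" "?\<delta> n" by (rule hom)
    show "subgroup ?B (?C n)"
    proof (cases n)
      case 0
      then show ?thesis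
        using group.triv_subgroup[OF comm_group.axioms(2)[OF C, of n]] by (simp add: coboundaries_def)
    next
      case (Suc m)
      then show ?thesis
        using group_hom.img_is_subgroup[OF hom] by (simp add: coboundaries_def)
    qed
    show "?B \<subseteq> ?Z"
    proof (cases n)
      case 0
      then show ?thesis
        using subgroup.one_closed[OF Z] by (simp add: coboundaries_def)
    next
      case (Suc m)
      have "?\<delta> (Suc m) (?\<delta> m f) = \<one>\<^bsub>?C (Suc (Suc m))\<^esub>" if "f \<in> carrier (?C m)" for f
      proof
        fix x
        show "?\<delta> (Suc m) (?\<delta> m f) x = \<one>\<^bsub>?C (Suc (Suc m))\<^esub> x"
          using one[OF that] dd[of x m] d_cl[of x "Suc m"]
          by (simp add: cochains_def hom_group_def coboundary_def compose_def)
      qed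
      then show ?thesis
        using Suc mem by (auto simp: coboundaries_def cocycles_def kernel_def)
    qed
  qed
  have Zc: "comm_group (?C n\<lparr>carrier := ?Z\<rparr>)"
  proof (rule group.group_comm_groupI)
    show "Group.group (?C n\<lparr>carrier := ?Z\<rparr>)"
      by (rule subgroup.subgroup_is_group[OF Z comm_group.axioms(2)[OF C]])
    fix f g assume "f \<in> carrier (?C n\<lparr>carrier := ?Z\<rparr>)" "g \<in> carrier (?C n\<lparr>carrier := ?Z\<rparr>)"
    then have "f \<in> carrier (?C n)" "g \<in> carrier (?C n)"
      using subgroup.subset[OF Z] by auto
    then show "f \<otimes>\<^bsub>?C n\<lparr>carrier := ?Z\<rparr>\<^esub> g = g \<otimes>\<^bsub>?C n\<lparr>carrier := ?Z\<rparr>\<^esub> f"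
      using comm_monoid.m_comm[OF comm_group.axioms(1)[OF C]] by simp
  qed
  moreover have "subgroup ?B (?C n\<lparr>carrier := ?Z\<rparr>)"
    using group.subgroup_incl[OF comm_group.axioms(2)[OF C] B Z BZ] .
  ultimately show ?thesis
    unfolding cohomology_def by (rule comm_group.abelian_FactGroup)
qed

theorem Ext_comm_group:
  fixes R :: "('r, 'x) ring_scheme" and M :: "('r, 'm, 'y) module_scheme"
  assumes M: "left_module R M" and N: "left_module R N"
  shows "comm_group (Ext R M N n)"
proof -
  let ?P = "\<lambda>P :: (nat \<Rightarrow> ('r, 'm) basis_name set) \<times> _. case P of (B, d, \<epsilon>) \<Rightarrow> free_resolution R M B d \<epsilon>"
  obtain B d \<epsilon> where eq: "(SOME P. ?P P) = (B, d, \<epsilon>)" by (rule prod_cases3)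
  have "?P (SOME P. ?P P)"
  proof (rule someI_ex)
    obtain B :: "nat \<Rightarrow> ('r, 'm) basis_name set" and d \<epsilon> where "free_resolution R M B d \<epsilon>"
      using free_resolution_exists[OF M] by blast
    then have "?P (B, d, \<epsilon>)" by simp
    then show "\<exists>P. ?P P" ..
  qed
  then have "free_resolution R M B d \<epsilon>" unfolding eq by simp
  from cohomology_comm_group[OF M N this] show ?thesis
    unfolding Ext_def eq by simp
qed

end

theory Submission
  imports Defs "HOL-Algebra.Subrings" "HOL-Library.Multiset_Order" Complex_Main
begin

text \<open>
  Write \<open>k\<close> for the field and \<open>H = Hom\<^sub>k(M, N)\<close>. The operators \<open>f \<mapsto> x\<^sub>i f - f x\<^sub>i\<close> and \<open>f \<mapsto> x\<^sub>i f + f x\<^sub>i\<close> on \<open>H\<close>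
  are the coefficients of two differentials \<open>D\<^sup>- = \<Sum>\<^sub>i \<eta>\<^sub>i (x\<^sub>i f - f x\<^sub>i)\<close> and \<open>D\<^sup>+ = \<Sum>\<^sub>i \<eta>\<^sub>i (x\<^sub>i f + f x\<^sub>i)\<close> on \<open>H \<otimes> S\<close>,
  where \<open>S = k[\<eta>\<^sub>1, \<dots>, \<eta>\<^sub>c]\<close>. They are linear over \<open>S\<close>, raise the degree by one, and satisfy \<open>D\<^sup>+ D\<^sup>- = 0 = D\<^sup>- D\<^sup>+\<close>.
  Let \<open>E\<^sup>\<plusminus>\<^sub>n\<close> be the kernel of \<open>D\<^sup>\<plusminus>\<close> modulo the image of the other one, in degree \<open>n\<close>. For \<open>n > 0\<close> the group
  \<open>Ext\<^sup>n(M, N)\<close> is \<open>E\<^sup>+\<^sub>n\<close> for odd \<open>n\<close> and \<open>E\<^sup>-\<^sub>n\<close> for even \<open>n\<close>. Indeed, if \<open>M\<close> is free, then \<open>E\<^sup>\<plusminus>\<close> vanishes in positive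
  degrees, thanks to the contraction operators on the exterior algebra (\<open>free_module_hom_exact\<close>). A short
  exact sequence \<open>0 \<rightarrow> Z \<rightarrow> F \<rightarrow> M \<rightarrow> 0\<close> remains exact under \<open>Hom\<^sub>k(-, N)\<close>, so the cohomology of the complexes
  shifts along a free resolution as Ext does. Only the vanishing of the groups matters, and it is all that is compared
  (\<open>cohomology_trivial_iff_hom_exact\<close>).

  Two properties of these complexes give the result. First, \<open>H\<close> has finite dimension, so the cocycles
  of each sign form a finitely generated graded module over \<open>S\<close>; in high degrees, cocycles are sums of variables times cocycles
  of degree one less, and \<open>E\<^sup>\<plusminus>\<^sub>n = 0\<close> implies \<open>E\<^sup>\<plusminus>\<^sub>n\<^sub>+\<^sub>1 = 0\<close> (\<open>exactness_persists\<close>). Secondly, if \<open>E\<^sup>+\<^sub>n\<close> and \<open>E\<^sup>-\<^sub>n\<close> vanish for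
  all large \<open>n\<close>, they vanish for all \<open>n > 0\<close> (\<open>exact_at_if_eventually_exact\<close>), by induction on the number of
  variables through the long exact sequence of multiplication by one variable.

  Suppose now that Ext vanishes in even degrees and in odd degrees that are arbitrarily high. By the first
  property \<open>E\<^sup>-\<close> and \<open>E\<^sup>+\<close> both vanish in all high degrees, and by the second one in all positive degrees.
\<close>


section \<open>Finite sums in abelian groups\<close>

lemma (in abelian_group) minus_zero_eq: "\<ominus> \<zero> = \<zero>"
  by (rule minus_equality) simp_all

lemma (in abelian_group) finsum_minus:
  assumes "f \<in> I \<rightarrow> carrier G"
  shows "(\<Oplus>i\<in>I. \<ominus> f i) = \<ominus> (\<Oplus>i\<in>I. f i)"
  using assms
proof (induction I rule: infinite_finite_induct)
  case (insert x F)
  then show ?case by (simp add: minus_add Pi_def)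
qed (simp_all add: minus_zero_eq)

text \<open>
  The reason why Koszul differentials square to zero. The diagonal is a separate hypothesis because
  antisymmetry does not kill it in characteristic two.
\<close>

lemma (in abelian_group) double_finsum_antisymmetric:
  assumes "finite I"
    and "\<And>i j. i \<in> I \<Longrightarrow> j \<in> I \<Longrightarrow> T i j \<in> carrier G"
    and "\<And>i j. i \<in> I \<Longrightarrow> j \<in> I \<Longrightarrow> T i j \<oplus> T j i = \<zero>"
    and "\<And>i. i \<in> I \<Longrightarrow> T i i = \<zero>"
  shows "(\<Oplus>i\<in>I. \<Oplus>j\<in>I. T i j) = \<zero>"
  using assms
proof (induction I)
  case (insert x F)
  have cl: "(\<Oplus>j\<in>F. T x j) \<in> carrier G" "(\<Oplus>j\<in>F. T j x) \<in> carrier G"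
    using insert.prems by auto
  have row: "(\<Oplus>j\<in>insert x F. T i j) = T i x \<oplus> (\<Oplus>j\<in>F. T i j)" if "i \<in> F" for i
    using insert.hyps insert.prems(1) that by (subst finsum_insert) auto
  have "(\<Oplus>i\<in>insert x F. \<Oplus>j\<in>insert x F. T i j)
      = (\<Oplus>j\<in>insert x F. T x j) \<oplus> (\<Oplus>i\<in>F. \<Oplus>j\<in>insert x F. T i j)"
    using insert.hyps insert.prems(1) by (subst finsum_insert) auto
  also have "(\<Oplus>i\<in>F. \<Oplus>j\<in>insert x F. T i j) = (\<Oplus>i\<in>F. T i x \<oplus> (\<Oplus>j\<in>F. T i j))"
    by (rule finsum_cong') (use insert.prems(1) row in \<open>auto\<close>)
  also have "(\<Oplus>i\<in>F. T i x \<oplus> (\<Oplus>j\<in>F. T i j)) = (\<Oplus>i\<in>F. T i x) \<oplus> (\<Oplus>i\<in>F. \<Oplus>j\<in>F. T i j)"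
    using insert.prems by (subst finsum_addf) auto
  also have "(\<Oplus>i\<in>F. \<Oplus>j\<in>F. T i j) = \<zero>"
    using insert.prems by (intro insert.IH) auto
  also have "(\<Oplus>j\<in>insert x F. T x j) = (\<Oplus>j\<in>F. T x j)"
    using insert.hyps insert.prems cl by (subst finsum_insert) auto
  also have "(\<Oplus>j\<in>F. T x j) \<oplus> ((\<Oplus>i\<in>F. T i x) \<oplus> \<zero>) = (\<Oplus>j\<in>F. T x j \<oplus> T j x)"
    using insert.prems cl by (subst finsum_addf) auto
  also have "\<dots> = \<zero>"
    using insert.prems by (intro add.finprod_one_eqI) auto
  finally show ?case .
qed auto


section \<open>Koszul complexes\<close>

text \<open>
  A monomial in the variables \<open>\<eta>\<^sub>0, \<dots>, \<eta>\<^sub>j\<^sub>-\<^sub>1\<close> is the multiset of its factors.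
\<close>

definition monomials :: "nat \<Rightarrow> nat \<Rightarrow> nat multiset set" where
  "monomials j n = {m. size m = n \<and> set_mset m \<subseteq> {..<j}}"

lemma monomials_one: "monomials j (Suc 0) = (\<lambda>i. {#i#}) ` {..<j}"
  unfolding monomials_def by (auto simp flip: One_nat_def dest!: size_1_singleton_mset)

text \<open>
  The prototype is \<open>U = Hom(M, N)\<close> over a module category of an exterior algebra, with
  \<open>a False i f = x\<^sub>i f - f x\<^sub>i\<close> and \<open>a True i f = x\<^sub>i f + f x\<^sub>i\<close>. Such operators neither square to zero nor
  anticommute on their own; they do so only when the two signs alternate. A cochain of degree \<open>n\<close> is a
  polynomial with coefficients in \<open>U\<close>, homogeneous of degree \<open>n\<close> in commuting variables \<open>\<eta>\<^sub>i\<close>, and the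
  differential of sign \<open>p\<close> is \<open>\<Sum>\<^sub>i \<eta>\<^sub>i a p i\<close>.
\<close>

locale koszul = abelian_group U for U :: "('b, 'z) ring_scheme" (structure) +
  fixes a :: "bool \<Rightarrow> nat \<Rightarrow> 'b \<Rightarrow> 'b"
  assumes a_closed [simp, intro]: "u \<in> carrier U \<Longrightarrow> a p i u \<in> carrier U"
    and a_add: "u \<in> carrier U \<Longrightarrow> v \<in> carrier U \<Longrightarrow> a p i (u \<oplus> v) = a p i u \<oplus> a p i v"
    and a_anti: "u \<in> carrier U \<Longrightarrow> a (\<not> p) i (a p j u) \<oplus> a (\<not> p) j (a p i u) = \<zero>"
    and a_square: "u \<in> carrier U \<Longrightarrow> a (\<not> p) i (a p i u) = \<zero>"
begin

text \<open>
  Cochains are functions on all monomials, of every degree, with values in \<open>U\<close>. Whether one is a cocycle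
  or a coboundary in degree \<open>n\<close> depends only on its values at the monomials of degree \<open>n\<close>.
\<close>

definition differential :: "bool \<Rightarrow> (nat multiset \<Rightarrow> 'b) \<Rightarrow> nat multiset \<Rightarrow> 'b" where
  "differential p \<phi> m = (\<Oplus>i\<in>set_mset m. a p i (\<phi> (m - {#i#})))"

definition times_var :: "nat \<Rightarrow> (nat multiset \<Rightarrow> 'b) \<Rightarrow> nat multiset \<Rightarrow> 'b" where
  "times_var j \<phi> m = (if j \<in># m then \<phi> (m - {#j#}) else \<zero>)"

text \<open>
  The sign \<open>p\<close> is that of the outgoing differential; the incoming one has the opposite sign. With this
  indexing multiplication by a variable preserves both cocycles and coboundaries of a given sign.
\<close>

definition cocycle :: "nat \<Rightarrow> bool \<Rightarrow> nat \<Rightarrow> (nat multiset \<Rightarrow> 'b) \<Rightarrow> bool" where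
  "cocycle j p n \<phi> \<longleftrightarrow>
    range \<phi> \<subseteq> carrier U \<and> (\<forall>m\<in>monomials j (Suc n). differential p \<phi> m = \<zero>)"

definition coboundary :: "nat \<Rightarrow> bool \<Rightarrow> nat \<Rightarrow> (nat multiset \<Rightarrow> 'b) \<Rightarrow> bool" where
  "coboundary j p n \<phi> \<longleftrightarrow>
    (\<exists>\<psi>. range \<psi> \<subseteq> carrier U \<and> (\<forall>m\<in>monomials j n. \<phi> m = differential (\<not> p) \<psi> m))"

definition exact_at :: "nat \<Rightarrow> bool \<Rightarrow> nat \<Rightarrow> bool" where
  "exact_at j p n \<longleftrightarrow> (\<forall>\<phi>. cocycle j p n \<phi> \<longrightarrow> coboundary j p n \<phi>)"

lemma exact_atE:
  assumes "exact_at j p n" "cocycle j p n \<phi>"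
  obtains \<psi> where "range \<psi> \<subseteq> carrier U" "\<And>m. m \<in> monomials j n \<Longrightarrow> \<phi> m = differential (\<not> p) \<psi> m"
  using assms unfolding exact_at_def coboundary_def by auto

lemma a_zero [simp]: "a p i \<zero> = \<zero>"
  using a_add[of \<zero> \<zero> p i] by (metis a_closed add.r_cancel_one l_zero zero_closed)

lemma a_minus: "u \<in> carrier U \<Longrightarrow> a p i (\<ominus> u) = \<ominus> a p i u"
  using a_add[of u "\<ominus> u" p i] by (metis a_closed a_inv_closed a_zero minus_equality r_neg a_comm)

lemma a_finsum:
  assumes "f \<in> I \<rightarrow> carrier U"
  shows "a p i (\<Oplus>j\<in>I. f j) = (\<Oplus>j\<in>I. a p i (f j))"
  using assms
proof (induction I rule: infinite_finite_induct)
  case (insert x F)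
  then show ?case by (simp add: a_add Pi_def)
qed simp_all

lemma a_swap: "u \<in> carrier U \<Longrightarrow> a (\<not> p) i (a p j u) = \<ominus> a (\<not> p) j (a p i u)"
  by (intro minus_equality[symmetric] a_anti a_closed)

lemma differential_closed [simp, intro]:
  "range \<phi> \<subseteq> carrier U \<Longrightarrow> differential p \<phi> m \<in> carrier U"
  unfolding differential_def by (intro finsum_closed) auto

lemma times_var_closed: "range \<phi> \<subseteq> carrier U \<Longrightarrow> range (times_var j \<phi>) \<subseteq> carrier U"
  by (auto simp: times_var_def)

lemma differential_cong:
  assumes "\<And>i. i \<in># m \<Longrightarrow> \<phi> (m - {#i#}) = \<psi> (m - {#i#})" "range \<psi> \<subseteq> carrier U"
  shows "differential p \<phi> m = differential p \<psi> m"
  unfolding differential_def by (rule finsum_cong') (use assms in \<open>auto dest: range_subsetD\<close>)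

lemma differential_add:
  assumes "range \<phi> \<subseteq> carrier U" "range \<psi> \<subseteq> carrier U"
  shows "differential p (\<lambda>m. \<phi> m \<oplus> \<psi> m) m = differential p \<phi> m \<oplus> differential p \<psi> m"
proof -
  have "\<phi> m \<in> carrier U" "\<psi> m \<in> carrier U" for m using assms by auto
  then show ?thesis
    unfolding differential_def by (subst finsum_addf[symmetric]) (auto simp: a_add)
qed

lemma differential_minus:
  assumes "range \<phi> \<subseteq> carrier U"
  shows "differential p (\<lambda>m. \<ominus> \<phi> m) m = \<ominus> differential p \<phi> m"
proof -
  have "\<phi> m \<in> carrier U" for m using assms by auto
  then show ?thesis
    unfolding differential_def by (subst finsum_minus[symmetric]) (auto simp: a_minus)
qed

lemma differential_diff:
  assumes "range \<phi> \<subseteq> carrier U" "range \<psi> \<subseteq> carrier U"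
  shows "differential p (\<lambda>m. \<phi> m \<ominus> \<psi> m) m = differential p \<phi> m \<ominus> differential p \<psi> m"
proof -
  have "range (\<lambda>m. \<ominus> \<psi> m) \<subseteq> carrier U" using assms by auto
  then show ?thesis
    unfolding minus_eq using assms by (simp add: differential_add differential_minus)
qed

lemma differential_times_var:
  assumes "range \<phi> \<subseteq> carrier U"
  shows "differential p (times_var j \<phi>) m = times_var j (differential p \<phi>) m"
proof (cases "j \<in># m")
  case True
  have cl: "\<phi> m \<in> carrier U" for m using assms by auto
  have "(\<Oplus>i\<in>set_mset m. a p i (times_var j \<phi> (m - {#i#}))) =
      (\<Oplus>i\<in>set_mset (m - {#j#}). a p i (\<phi> (m - {#j#} - {#i#})))"
  proof (rule add.finprod_mono_neutral_cong_right)
    show "set_mset (m - {#j#}) \<subseteq> set_mset m" by (meson in_diffD subsetI)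
    show "\<And>i. i \<in> set_mset m - set_mset (m - {#j#}) \<Longrightarrow> a p i (times_var j \<phi> (m - {#i#})) = \<zero>"
      using True by (auto simp: times_var_def in_diff_count split: if_splits)
    show "\<And>i. i \<in> set_mset (m - {#j#}) \<Longrightarrow>
        a p i (times_var j \<phi> (m - {#i#})) = a p i (\<phi> (m - {#j#} - {#i#}))"
      using True by (auto simp: times_var_def in_diff_count add_mset_commute split: if_splits)
  qed (use cl in \<open>auto simp: times_var_def\<close>)
  with True show ?thesis by (simp add: differential_def times_var_def)
next
  case False
  then have "j \<notin># m - {#i#}" for i by (meson in_diffD)
  with False show ?thesis
    by (auto simp: differential_def times_var_def intro!: add.finprod_one_eqI)
qed

lemma differential_single: "range \<phi> \<subseteq> carrier U \<Longrightarrow> differential p \<phi> {#i#} = a p i (\<phi> {#})"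
  by (simp add: differential_def range_subsetD)

lemma differential_squared:
  assumes "range \<phi> \<subseteq> carrier U"
  shows "differential (\<not> p) (differential p \<phi>) m = \<zero>"
proof -
  have cl: "\<phi> m \<in> carrier U" for m using assms by auto
  let ?I = "set_mset m"
  define T where "T i j = (if j \<in># m - {#i#} then a (\<not> p) i (a p j (\<phi> (m - {#i#} - {#j#}))) else \<zero>)" for i j
  have sym: "j \<in># m - {#i#} \<longleftrightarrow> i \<in># m - {#j#}" if "i \<in># m" "j \<in># m" for i j
    using that by (auto simp: in_diff_count)
  have "differential (\<not> p) (differential p \<phi>) m = (\<Oplus>i\<in>?I. \<Oplus>j\<in>?I. T i j)"
    unfolding differential_def
  proof (rule finsum_cong')
    fix i assume i: "i \<in> ?I"
    have "a (\<not> p) i (\<Oplus>j\<in>set_mset (m - {#i#}). a p j (\<phi> (m - {#i#} - {#j#}))) =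
      (\<Oplus>j\<in>set_mset (m - {#i#}). a (\<not> p) i (a p j (\<phi> (m - {#i#} - {#j#}))))"
      using cl by (intro a_finsum) auto
    also have "\<dots> = (\<Oplus>j\<in>?I. T i j)"
      by (rule add.finprod_mono_neutral_cong_left) (use cl in \<open>auto simp: T_def dest: in_diffD\<close>)
    finally show "a (\<not> p) i (\<Oplus>j\<in>set_mset (m - {#i#}). a p j (\<phi> (m - {#i#} - {#j#}))) = (\<Oplus>j\<in>?I. T i j)" .
  qed (use cl in \<open>auto simp: T_def\<close>)
  also have "\<dots> = \<zero>"
    by (rule double_finsum_antisymmetric)
      (use cl in \<open>auto simp: T_def sym a_anti a_square add_mset_commute\<close>)
  finally show ?thesis .
qed

text \<open>
  Setting the last variable \<open>\<eta>\<^sub>j\<close> to zero is a surjection of complexes whose kernel is the image of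
  multiplication by \<open>\<eta>\<^sub>j\<close>. In the resulting long exact sequence the cohomology in fewer variables sits
  between two groups in all variables, of the same degree and of opposite signs.
\<close>

lemma exact_at_fewer_variables:
  assumes "\<And>p. exact_at (Suc j) p n"
  shows "exact_at j p n"
  unfolding exact_at_def
proof (intro allI impI)
  fix \<phi> assume "cocycle j p n \<phi>"
  then have \<phi>: "range \<phi> \<subseteq> carrier U" and d\<phi>: "\<And>m. m \<in> monomials j (Suc n) \<Longrightarrow> differential p \<phi> m = \<zero>"
    by (auto simp: cocycle_def)
  \<comment> \<open>Lift the cocycle by zero; the differential of the lift is a multiple \<open>\<eta>\<^sub>j \<psi>\<close>, and \<open>\<psi>\<close> is the connecting cocycle.\<close>
  define \<phi>' where "\<phi>' m = (if j \<in># m then \<zero> else \<phi> m)" for m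
  define \<psi> where "\<psi> m = a p j (\<phi>' m)" for m
  have \<phi>': "range \<phi>' \<subseteq> carrier U" using \<phi> by (auto simp: \<phi>'_def dest: range_subsetD)
  have cl': "\<phi>' m \<in> carrier U" "\<phi> m \<in> carrier U" for m using \<phi>' \<phi> by auto
  have \<psi>: "range \<psi> \<subseteq> carrier U" using cl' by (auto simp: \<psi>_def)
  have d0: "differential p \<phi>' m = differential p \<phi> m" if "j \<notin># m" for m
    by (rule differential_cong) (use that \<phi> in \<open>auto simp: \<phi>'_def dest: in_diffD\<close>)
  have d1: "differential q (\<lambda>m. f (\<phi>' m)) m = a q j (f (\<phi>' (m - {#j#})))"
    if "j \<in># m" "f \<in> carrier U \<rightarrow> carrier U" "f \<zero> = \<zero>" for q m f
  proof -
    have "differential q (\<lambda>m. f (\<phi>' m)) m = (\<Oplus>i\<in>{j}. a q i (f (\<phi>' (m - {#i#}))))"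
      unfolding differential_def
    proof (rule add.finprod_mono_neutral_cong_right)
      show "\<And>i. i \<in> set_mset m - {j} \<Longrightarrow> a q i (f (\<phi>' (m - {#i#}))) = \<zero>"
        using that by (auto simp: \<phi>'_def in_diff_count)
    qed (use that cl' in \<open>auto simp: Pi_iff\<close>)
    then show ?thesis using that(2) cl' by (simp add: Pi_iff)
  qed
  have "cocycle (Suc j) (\<not> p) n \<psi>"
    unfolding cocycle_def
  proof (intro conjI ballI \<psi>)
    fix m assume m: "m \<in> monomials (Suc j) (Suc n)"
    show "differential (\<not> p) \<psi> m = \<zero>"
    proof (cases "j \<in># m")
      case True
      then show ?thesis
        unfolding \<psi>_def using d1[OF True, of "a p j" "\<not> p"] cl' by (simp add: Pi_iff a_square)
    next
      case False
      with m have m': "m \<in> monomials j (Suc n)" by (auto simp: monomials_def less_Suc_eq)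
      have "differential (\<not> p) \<psi> m = (\<Oplus>i\<in>set_mset m. \<ominus> a (\<not> p) j (a p i (\<phi>' (m - {#i#}))))"
        unfolding differential_def \<psi>_def
        by (rule finsum_cong') (use cl' in \<open>auto intro: a_swap\<close>)
      also have "\<dots> = \<ominus> a (\<not> p) j (differential p \<phi>' m)"
        unfolding differential_def using cl' by (simp add: finsum_minus a_finsum Pi_iff)
      finally show ?thesis
        using d0[OF False] d\<phi>[OF m'] by (simp add: minus_zero_eq)
    qed
  qed
  then obtain \<theta> where \<theta>: "range \<theta> \<subseteq> carrier U" "\<And>m. m \<in> monomials (Suc j) n \<Longrightarrow> \<psi> m = differential p \<theta> m"
    by (rule exact_atE[OF assms[of "\<not> p"], unfolded not_not]) (rule that)
  define \<chi> where "\<chi> m = \<phi>' m \<ominus> times_var j \<theta> m" for m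
  have "cocycle (Suc j) p n \<chi>"
    unfolding cocycle_def
  proof (intro conjI ballI)
    show "range \<chi> \<subseteq> carrier U"
      using cl' range_subsetD[OF times_var_closed[OF \<theta>(1)]] by (auto simp: \<chi>_def)
    fix m assume m: "m \<in> monomials (Suc j) (Suc n)"
    have *: "differential p \<chi> m = differential p \<phi>' m \<ominus> times_var j (differential p \<theta>) m"
      unfolding \<chi>_def by (simp add: differential_diff \<phi>' times_var_closed \<theta> differential_times_var)
    show "differential p \<chi> m = \<zero>"
    proof (cases "j \<in># m")
      case True
      then have "m - {#j#} \<in> monomials (Suc j) n"
        using m by (auto simp: monomials_def size_Diff_singleton dest: in_diffD)
      then have "times_var j (differential p \<theta>) m = a p j (\<phi>' (m - {#j#}))"
        using True \<theta>(2) by (simp add: times_var_def \<psi>_def)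
      then show ?thesis
        unfolding * using d1[OF True, of "\<lambda>x. x" p] cl' by (simp add: Pi_iff minus_eq r_neg)
    next
      case False
      with m have "m \<in> monomials j (Suc n)" by (auto simp: monomials_def less_Suc_eq)
      then show ?thesis
        unfolding * using False d0[OF False] d\<phi> by (simp add: times_var_def minus_eq minus_zero_eq)
    qed
  qed
  then obtain \<omega> where \<omega>: "range \<omega> \<subseteq> carrier U"
    "\<And>m. m \<in> monomials (Suc j) n \<Longrightarrow> \<chi> m = differential (\<not> p) \<omega> m"
    by (rule exact_atE[OF assms]) (rule that)
  have "\<phi> m = differential (\<not> p) \<omega> m" if "m \<in> monomials j n" for m
  proof -
    from that have "j \<notin># m" "m \<in> monomials (Suc j) n" by (auto simp: monomials_def)
    with \<omega>(2)[of m] show ?thesis using cl' by (simp add: \<chi>_def \<phi>'_def times_var_def minus_eq minus_zero_eq)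
  qed
  with \<omega>(1) show "coboundary j p n \<phi>" by (auto simp: coboundary_def)
qed

lemma times_var_cancel:
  assumes "range \<phi> \<subseteq> carrier U" "range \<psi> \<subseteq> carrier U"
    and "\<And>m. m \<in> monomials (Suc j) (Suc n) \<Longrightarrow> differential p (times_var j \<phi>) m = times_var j \<psi> m"
    and "m \<in> monomials (Suc j) n"
  shows "differential p \<phi> m = \<psi> m"
proof -
  from assms(4) have "m + {#j#} \<in> monomials (Suc j) (Suc n)" by (auto simp: monomials_def)
  from assms(3)[OF this] show ?thesis
    by (simp add: differential_times_var assms(1) times_var_def)
qed

lemma divide_by_var:
  assumes "range \<phi> \<subseteq> carrier U" "\<And>m. m \<in> monomials j n \<Longrightarrow> \<phi> m = \<zero>"
  obtains \<omega> where "range \<omega> \<subseteq> carrier U" "\<And>m. m \<in> monomials (Suc j) n \<Longrightarrow> \<phi> m = times_var j \<omega> m"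
proof
  show "range (\<lambda>m. \<phi> (m + {#j#})) \<subseteq> carrier U" using assms(1) by auto
  show "\<phi> m = times_var j (\<lambda>m. \<phi> (m + {#j#})) m" if "m \<in> monomials (Suc j) n" for m
  proof (cases "j \<in># m")
    case False
    with that have "m \<in> monomials j n" by (auto simp: monomials_def less_Suc_eq)
    with False assms(2) show ?thesis by (simp add: times_var_def)
  qed (simp add: times_var_def)
qed

lemma differential_cong_monomials:
  assumes "\<And>m. m \<in> monomials j n \<Longrightarrow> \<phi> m = \<psi> m" "range \<psi> \<subseteq> carrier U"
    and "m \<in> monomials j (Suc n)"
  shows "differential p \<phi> m = differential p \<psi> m"
proof (rule differential_cong[OF _ assms(2)])
  fix i assume "i \<in># m"
  then have "m - {#i#} \<in> monomials j n"
    using assms(3) by (auto simp: monomials_def size_Diff_singleton dest: in_diffD)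
  then show "\<phi> (m - {#i#}) = \<psi> (m - {#i#})" by (rule assms(1))
qed

text \<open>
  The same long exact sequence: if the cohomology in fewer variables vanishes in degree \<open>n\<close>, then
  multiplication by \<open>\<eta>\<^sub>j\<close> is injective from degree \<open>n\<close> to degree \<open>n + 1\<close>.
\<close>

lemma exact_at_lower_degree:
  assumes "exact_at j (\<not> p) n" "exact_at (Suc j) p (Suc n)"
  shows "exact_at (Suc j) p n"
  unfolding exact_at_def
proof (intro allI impI)
  fix \<phi> assume "cocycle (Suc j) p n \<phi>"
  then have \<phi>: "range \<phi> \<subseteq> carrier U"
    and d\<phi>: "\<And>m. m \<in> monomials (Suc j) (Suc n) \<Longrightarrow> differential p \<phi> m = \<zero>"
    by (auto simp: cocycle_def)
  have "cocycle (Suc j) p (Suc n) (times_var j \<phi>)"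
    unfolding cocycle_def
  proof (intro conjI ballI times_var_closed \<phi>)
    fix m assume m: "m \<in> monomials (Suc j) (Suc (Suc n))"
    have "m - {#j#} \<in> monomials (Suc j) (Suc n)" if "j \<in># m"
      using m that by (auto simp: monomials_def size_Diff_singleton dest: in_diffD)
    then show "differential p (times_var j \<phi>) m = \<zero>"
      using d\<phi> by (simp add: differential_times_var \<phi>, simp add: times_var_def)
  qed
  then obtain \<psi> where \<psi>: "range \<psi> \<subseteq> carrier U"
    "\<And>m. m \<in> monomials (Suc j) (Suc n) \<Longrightarrow> times_var j \<phi> m = differential (\<not> p) \<psi> m"
    by (rule exact_atE[OF assms(2)]) (rule that)
  have "cocycle j (\<not> p) n \<psi>"
    unfolding cocycle_def
  proof (intro conjI ballI \<psi>(1))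
    fix m assume "m \<in> monomials j (Suc n)"
    then have "m \<in> monomials (Suc j) (Suc n)" "j \<notin># m" by (auto simp: monomials_def)
    then show "differential (\<not> p) \<psi> m = \<zero>" using \<psi>(2)[of m] by (simp add: times_var_def)
  qed
  then obtain \<theta> where \<theta>: "range \<theta> \<subseteq> carrier U"
    "\<And>m. m \<in> monomials j n \<Longrightarrow> \<psi> m = differential p \<theta> m"
    by (rule exact_atE[OF assms(1), unfolded not_not]) (rule that)
  have d\<theta>: "range (differential p \<theta>) \<subseteq> carrier U" using \<theta>(1) by auto
  have cl: "\<psi> m \<in> carrier U" "differential p \<theta> m \<in> carrier U" for m using \<psi>(1) d\<theta> by auto
  have 1: "range (\<lambda>m. \<psi> m \<ominus> differential p \<theta> m) \<subseteq> carrier U" using cl by auto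
  have 2: "\<psi> m \<ominus> differential p \<theta> m = \<zero>" if "m \<in> monomials j n" for m
    using \<theta>(2)[OF that] cl by (simp add: minus_eq r_neg)
  obtain \<omega> where \<omega>: "range \<omega> \<subseteq> carrier U"
    "\<And>m. m \<in> monomials (Suc j) n \<Longrightarrow> \<psi> m \<ominus> differential p \<theta> m = times_var j \<omega> m"
    using divide_by_var[OF 1 2] by blast
  have *: "differential (\<not> p) (times_var j \<omega>) m = times_var j \<phi> m" if m: "m \<in> monomials (Suc j) (Suc n)" for m
  proof -
    have "differential (\<not> p) (times_var j \<omega>) m = differential (\<not> p) (\<lambda>m. \<psi> m \<ominus> differential p \<theta> m) m"
      by (rule differential_cong_monomials[OF _ 1 m]) (simp add: \<omega>(2))
    also have "\<dots> = differential (\<not> p) \<psi> m \<ominus> \<zero>"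
      by (simp add: differential_diff \<psi>(1) d\<theta> differential_squared \<theta>(1))
    finally show ?thesis using \<psi>(2)[OF m] \<psi>(1) by (simp add: minus_eq minus_zero_eq)
  qed
  have "differential (\<not> p) \<omega> m = \<phi> m" if "m \<in> monomials (Suc j) n" for m
    by (rule times_var_cancel[OF \<omega>(1) \<phi> * that])
  with \<omega>(1) show "coboundary (Suc j) p n \<phi>" unfolding coboundary_def by metis
qed

text \<open>
  Induction on the number of variables. Vanishing in high degrees restricts to fewer variables, where it
  therefore holds in all positive degrees; so multiplication by the last variable is injective on
  cohomology in positive degrees, and vanishing descends from high degrees. Without variables there is
  nothing in positive degree.
\<close>

theorem exact_at_if_eventually_exact:
  assumes "\<And>p n. n \<ge> n0 \<Longrightarrow> exact_at j p n" "n > 0"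
  shows "exact_at j p n"
  using assms
proof (induction j arbitrary: p n)
  case 0
  then have "monomials 0 n = {}" by (auto simp: monomials_def)
  then show ?case by (auto simp: exact_at_def coboundary_def)
next
  case (Suc j)
  have *: "exact_at j p n" if "n > 0" for p n
    using that by (rule Suc.IH[rotated]) (rule exact_at_fewer_variables, rule Suc.prems(1))
  show ?case
  proof (cases "n \<ge> n0")
    case False
    then have "n \<le> n0" by simp
    then show ?thesis using Suc.prems(2)
    proof (induction n rule: inc_induct)
      case base
      then show ?case by (intro Suc.prems(1)) simp
    next
      case (step k)
      then show ?case by (auto intro: exact_at_lower_degree[OF *])
    qed
  qed (rule Suc.prems)
qed

text \<open>
  Now multiplication by \<open>\<eta>\<^sub>j\<close> maps cohomology onto cohomology in each positive degree. By induction on the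
  degree only degree one remains: there a class comes from an element of \<open>U\<close> killed by all operators, and the hypothesis \<open>lift\<close>
  says that the connecting map already hits it.
\<close>

lemma exact_at_more_variables:
  assumes exact: "\<And>p n. n > 0 \<Longrightarrow> exact_at j p n"
    and lift: "\<And>p u. u \<in> carrier U \<Longrightarrow> (\<And>i. i \<le> j \<Longrightarrow> a p i u = \<zero>) \<Longrightarrow>
      \<exists>v\<in>carrier U. (\<forall>i<j. a (\<not> p) i v = \<zero>) \<and> a (\<not> p) j v = u"
    and "n > 0"
  shows "exact_at (Suc j) p n"
  using \<open>n > 0\<close>
proof (induction n)
  case (Suc n)
  show ?case
    unfolding exact_at_def
  proof (intro allI impI)
    fix \<phi> assume "cocycle (Suc j) p (Suc n) \<phi>"
    then have \<phi>: "range \<phi> \<subseteq> carrier U"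
      and d\<phi>: "\<And>m. m \<in> monomials (Suc j) (Suc (Suc n)) \<Longrightarrow> differential p \<phi> m = \<zero>"
      by (auto simp: cocycle_def)
    have "cocycle j p (Suc n) \<phi>"
      using \<phi> d\<phi> by (auto simp: cocycle_def monomials_def lessThan_Suc)
    then obtain \<theta> where \<theta>: "range \<theta> \<subseteq> carrier U"
      "\<And>m. m \<in> monomials j (Suc n) \<Longrightarrow> \<phi> m = differential (\<not> p) \<theta> m"
      by (rule exact_atE[OF exact, OF zero_less_Suc]) (rule that)
    have d\<theta>: "range (differential (\<not> p) \<theta>) \<subseteq> carrier U" using \<theta>(1) by auto
    have cl: "\<phi> m \<in> carrier U" "differential (\<not> p) \<theta> m \<in> carrier U" for m using \<phi> d\<theta> by auto
    have 1: "range (\<lambda>m. \<phi> m \<ominus> differential (\<not> p) \<theta> m) \<subseteq> carrier U" using cl by auto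
    have 2: "\<phi> m \<ominus> differential (\<not> p) \<theta> m = \<zero>" if "m \<in> monomials j (Suc n)" for m
      using \<theta>(2)[OF that] cl by (simp add: minus_eq r_neg)
    obtain \<omega> where \<omega>: "range \<omega> \<subseteq> carrier U"
      "\<And>m. m \<in> monomials (Suc j) (Suc n) \<Longrightarrow> \<phi> m \<ominus> differential (\<not> p) \<theta> m = times_var j \<omega> m"
      using divide_by_var[OF 1 2] by blast
    have *: "differential p (times_var j \<omega>) m = times_var j (\<lambda>_. \<zero>) m"
      if m: "m \<in> monomials (Suc j) (Suc (Suc n))" for m
    proof -
      have "differential p (times_var j \<omega>) m = differential p (\<lambda>m. \<phi> m \<ominus> differential (\<not> p) \<theta> m) m"
        by (rule differential_cong_monomials[OF _ 1 m]) (simp add: \<omega>(2))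
      also have "\<dots> = \<zero>"
        using differential_squared[OF \<theta>(1), of "\<not> p" m] d\<phi>[OF m]
        by (simp add: differential_diff \<phi> d\<theta>, simp add: minus_eq minus_zero_eq)
      finally show ?thesis by (simp add: times_var_def)
    qed
    have d\<omega>: "differential p \<omega> m = \<zero>" if "m \<in> monomials (Suc j) (Suc n)" for m
      by (rule times_var_cancel[OF \<omega>(1) _ * that]) auto
    \<comment> \<open>The quotient \<open>\<omega>\<close> is a cocycle of degree \<open>n\<close>: use \<open>lift\<close> if \<open>n = 0\<close>, induction otherwise.\<close>
    obtain \<xi> where \<xi>: "range \<xi> \<subseteq> carrier U"
      "\<And>m. m \<in> monomials (Suc j) (Suc n) \<Longrightarrow> times_var j \<omega> m = differential (\<not> p) \<xi> m"
    proof (cases n)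
      case 0
      have "a p i (\<omega> {#}) = \<zero>" if "i \<le> j" for i
      proof -
        have "{#i#} \<in> monomials (Suc j) (Suc n)" using that 0 by (auto simp: monomials_def)
        from d\<omega>[OF this] show ?thesis
          using range_subsetD[OF \<omega>(1)] by (simp add: differential_def)
      qed
      with lift[of "\<omega> {#}" p] obtain v where v: "v \<in> carrier U" "\<forall>i<j. a (\<not> p) i v = \<zero>"
        "a (\<not> p) j v = \<omega> {#}" using range_subsetD[OF \<omega>(1)] by blast
      show thesis
      proof (rule that[of "\<lambda>_. v"])
        fix m assume "m \<in> monomials (Suc j) (Suc n)"
        then have m: "size m = 1" "set_mset m \<subseteq> {..<Suc j}" using 0 by (auto simp: monomials_def)
        obtain i where "m = {#i#}" using size_1_singleton_mset[OF m(1)] by blast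
        with m(2) have i: "m = {#i#}" "i \<le> j" by auto
        show "times_var j \<omega> m = differential (\<not> p) (\<lambda>_. v) m"
          using v i by (cases "i = j") (simp_all add: times_var_def differential_single image_subset_iff)
      qed (use v in auto)
    next
      case (Suc n')
      then have "n > 0" by simp
      have "cocycle (Suc j) p n \<omega>" unfolding cocycle_def using \<omega>(1) d\<omega> by blast
      then obtain \<xi> where \<xi>: "range \<xi> \<subseteq> carrier U"
        "\<And>m. m \<in> monomials (Suc j) n \<Longrightarrow> \<omega> m = differential (\<not> p) \<xi> m"
        by (rule exact_atE[OF Suc.IH[OF \<open>n > 0\<close>]]) (rule that)
      show thesis
      proof (rule that[of "times_var j \<xi>"])
        fix m assume m: "m \<in> monomials (Suc j) (Suc n)"
        have "j \<in># m \<Longrightarrow> m - {#j#} \<in> monomials (Suc j) n"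
          using m by (auto simp: monomials_def size_Diff_singleton dest: in_diffD)
        then show "times_var j \<omega> m = differential (\<not> p) (times_var j \<xi>) m"
          by (simp add: differential_times_var \<xi>(1), simp add: times_var_def \<xi>(2))
      qed (rule times_var_closed[OF \<xi>(1)])
    qed
    have "\<phi> m = differential (\<not> p) (\<lambda>m. \<theta> m \<oplus> \<xi> m) m" if "m \<in> monomials (Suc j) (Suc n)" for m
    proof -
      have "\<phi> m = (\<phi> m \<ominus> differential (\<not> p) \<theta> m) \<oplus> differential (\<not> p) \<theta> m"
        using cl by (simp add: minus_eq a_assoc l_neg)
      then show ?thesis
        using \<omega>(2)[OF that] \<xi>(2)[OF that] cl
        by (simp add: differential_add \<theta>(1) \<xi>(1) a_comm)
    qed
    moreover have "range (\<lambda>m. \<theta> m \<oplus> \<xi> m) \<subseteq> carrier U"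
      using range_subsetD[OF \<theta>(1)] range_subsetD[OF \<xi>(1)] by auto
    ultimately show "coboundary (Suc j) p (Suc n) \<phi>" unfolding coboundary_def by blast
  qed
qed simp

end


section \<open>Exact sequences of Koszul complexes\<close>

text \<open>
  A short exact sequence of coefficients gives one of complexes and so a long exact sequence. Only
  its consequences for vanishing are derived, in the form of dimension shifting along a middle term that is
  exact in positive degrees.
\<close>

locale koszul_exact_sequence =
  sub: koszul U1 a1 + mid: koszul U2 a2 + quot: koszul U3 a3
  for U1 :: "('b1, 'z1) ring_scheme" and a1 and U2 :: "('b2, 'z2) ring_scheme" and a2
    and U3 :: "('b3, 'z3) ring_scheme" and a3 +
  fixes P :: "'b1 \<Rightarrow> 'b2" and R :: "'b2 \<Rightarrow> 'b3"
  assumes P_hom: "P \<in> hom (add_monoid U1) (add_monoid U2)"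
    and R_hom: "R \<in> hom (add_monoid U2) (add_monoid U3)"
    and P_act: "u \<in> carrier U1 \<Longrightarrow> P (a1 p i u) = a2 p i (P u)"
    and R_act: "v \<in> carrier U2 \<Longrightarrow> R (a2 p i v) = a3 p i (R v)"
    and P_inj: "inj_on P (carrier U1)"
    and exact: "v \<in> carrier U2 \<Longrightarrow> R v = \<zero>\<^bsub>U3\<^esub> \<longleftrightarrow> v \<in> P ` carrier U1"
    and R_surj: "R ` carrier U2 = carrier U3"
begin

lemma P_closed [simp]: "u \<in> carrier U1 \<Longrightarrow> P u \<in> carrier U2"
  and R_closed [simp]: "v \<in> carrier U2 \<Longrightarrow> R v \<in> carrier U3"
  and P_add: "u \<in> carrier U1 \<Longrightarrow> u' \<in> carrier U1 \<Longrightarrow> P (u \<oplus>\<^bsub>U1\<^esub> u') = P u \<oplus>\<^bsub>U2\<^esub> P u'"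
  and R_add: "v \<in> carrier U2 \<Longrightarrow> v' \<in> carrier U2 \<Longrightarrow> R (v \<oplus>\<^bsub>U2\<^esub> v') = R v \<oplus>\<^bsub>U3\<^esub> R v'"
  using P_hom R_hom by (auto simp: hom_def)

lemma P_zero [simp]: "P \<zero>\<^bsub>U1\<^esub> = \<zero>\<^bsub>U2\<^esub>"
  using P_add[of "\<zero>\<^bsub>U1\<^esub>" "\<zero>\<^bsub>U1\<^esub>"] by (metis P_closed mid.add.r_cancel_one sub.l_zero sub.zero_closed)

lemma R_zero [simp]: "R \<zero>\<^bsub>U2\<^esub> = \<zero>\<^bsub>U3\<^esub>"
  using R_add[of "\<zero>\<^bsub>U2\<^esub>" "\<zero>\<^bsub>U2\<^esub>"] by (metis R_closed quot.add.r_cancel_one mid.l_zero mid.zero_closed)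

lemma R_P [simp]: "u \<in> carrier U1 \<Longrightarrow> R (P u) = \<zero>\<^bsub>U3\<^esub>"
  using exact by auto

lemma R_minus: "v \<in> carrier U2 \<Longrightarrow> R (\<ominus>\<^bsub>U2\<^esub> v) = \<ominus>\<^bsub>U3\<^esub> R v"
  using R_add[of "\<ominus>\<^bsub>U2\<^esub> v" v]
  by (metis R_closed R_zero mid.a_inv_closed mid.l_neg quot.minus_equality)

lemma R_diff: "v \<in> carrier U2 \<Longrightarrow> v' \<in> carrier U2 \<Longrightarrow> R (v \<ominus>\<^bsub>U2\<^esub> v') = R v \<ominus>\<^bsub>U3\<^esub> R v'"
  by (simp add: mid.minus_eq quot.minus_eq R_add R_minus)

lemma differential_P:
  assumes "range \<phi> \<subseteq> carrier U1"
  shows "mid.differential p (\<lambda>m. P (\<phi> m)) m = P (sub.differential p \<phi> m)"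
proof -
  have cl: "\<phi> m \<in> carrier U1" for m using assms by auto
  have "P (\<Oplus>\<^bsub>U1\<^esub>i\<in>I. f i) = (\<Oplus>\<^bsub>U2\<^esub>i\<in>I. P (f i))" if "finite I" "f \<in> I \<rightarrow> carrier U1" for I :: "nat set" and f
    using that by (induction I) (auto simp: P_add Pi_def)
  then show ?thesis
    unfolding mid.differential_def sub.differential_def
    using cl by (auto simp: P_act intro!: mid.finsum_cong')
qed

lemma differential_R:
  assumes "range \<phi> \<subseteq> carrier U2"
  shows "quot.differential p (\<lambda>m. R (\<phi> m)) m = R (mid.differential p \<phi> m)"
proof -
  have cl: "\<phi> m \<in> carrier U2" for m using assms by auto
  have "R (\<Oplus>\<^bsub>U2\<^esub>i\<in>I. f i) = (\<Oplus>\<^bsub>U3\<^esub>i\<in>I. R (f i))" if "finite I" "f \<in> I \<rightarrow> carrier U2" for I :: "nat set" and f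
    using that by (induction I) (auto simp: R_add Pi_def)
  then show ?thesis
    unfolding quot.differential_def mid.differential_def
    using cl by (auto simp: R_act intro!: quot.finsum_cong')
qed

lemma lift_R:
  assumes "range \<phi> \<subseteq> carrier U3"
  obtains \<psi> where "range \<psi> \<subseteq> carrier U2" "\<And>m. R (\<psi> m) = \<phi> m"
proof
  have *: "\<phi> m \<in> R ` carrier U2" for m using assms R_surj by auto
  show "range (\<lambda>m. inv_into (carrier U2) R (\<phi> m)) \<subseteq> carrier U2"
    using inv_into_into[OF *] by auto
  show "R (inv_into (carrier U2) R (\<phi> m)) = \<phi> m" for m
    by (rule f_inv_into_f[OF *])
qed

lemma lift_P:
  assumes "range \<phi> \<subseteq> carrier U2" "\<And>m. m \<in> S \<Longrightarrow> R (\<phi> m) = \<zero>\<^bsub>U3\<^esub>"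
  obtains \<psi> where "range \<psi> \<subseteq> carrier U1" "\<And>m. m \<in> S \<Longrightarrow> P (\<psi> m) = \<phi> m"
proof
  define \<psi> where "\<psi> m = (if m \<in> S then inv_into (carrier U1) P (\<phi> m) else \<zero>\<^bsub>U1\<^esub>)" for m
  have *: "\<phi> m \<in> P ` carrier U1" if "m \<in> S" for m
    using assms(1) assms(2)[OF that] exact[of "\<phi> m"] by auto
  show "range \<psi> \<subseteq> carrier U1"
    using inv_into_into[OF *] by (auto simp: \<psi>_def)
  show "P (\<psi> m) = \<phi> m" if "m \<in> S" for m
    using f_inv_into_f[OF *] that by (simp add: \<psi>_def)
qed

text \<open>
  The hypothesis says that \<open>\<phi>\<close> lifts a cocycle of the quotient; \<open>\<chi>\<close> represents the image of its class under
  the connecting map.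
\<close>

lemma connecting_cocycle:
  assumes "range \<phi> \<subseteq> carrier U2"
    and "\<And>m. m \<in> monomials j (Suc n) \<Longrightarrow> R (mid.differential p \<phi> m) = \<zero>\<^bsub>U3\<^esub>"
  obtains \<chi> where "sub.cocycle j (\<not> p) (Suc n) \<chi>"
    "\<And>m. m \<in> monomials j (Suc n) \<Longrightarrow> P (\<chi> m) = mid.differential p \<phi> m"
proof -
  have d\<phi>: "range (mid.differential p \<phi>) \<subseteq> carrier U2" using assms(1) by auto
  obtain \<chi> where \<chi>: "range \<chi> \<subseteq> carrier U1"
    "\<And>m. m \<in> monomials j (Suc n) \<Longrightarrow> P (\<chi> m) = mid.differential p \<phi> m"
    by (rule lift_P[OF d\<phi> assms(2)]) (assumption, rule that)
  have "sub.cocycle j (\<not> p) (Suc n) \<chi>"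
    unfolding sub.cocycle_def
  proof (intro conjI ballI \<chi>(1))
    fix m assume m: "m \<in> monomials j (Suc (Suc n))"
    have "P (sub.differential (\<not> p) \<chi> m) = mid.differential (\<not> p) (\<lambda>m. P (\<chi> m)) m"
      by (rule differential_P[OF \<chi>(1), symmetric])
    also have "\<dots> = mid.differential (\<not> p) (mid.differential p \<phi>) m"
      by (rule mid.differential_cong_monomials[OF _ d\<phi> m]) (rule \<chi>(2))
    also have "\<dots> = P \<zero>\<^bsub>U1\<^esub>" using mid.differential_squared[OF assms(1)] by simp
    finally show "sub.differential (\<not> p) \<chi> m = \<zero>\<^bsub>U1\<^esub>"
      using inj_onD[OF P_inj] \<chi>(1) by (metis sub.differential_closed sub.zero_closed)
  qed
  with \<chi>(2) show thesis by (rule that[rotated])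
qed

text \<open>
  If the connecting map has target zero, every cocycle of the quotient lifts to a cocycle.
\<close>

lemma adjusted_lift:
  assumes sub: "sub.exact_at j (\<not> p) (Suc n)" and \<phi>: "quot.cocycle j p n \<phi>"
  obtains \<psi> where "mid.cocycle j p n \<psi>" "\<And>m. R (\<psi> m) = \<phi> m"
proof -
  have r\<phi>: "range \<phi> \<subseteq> carrier U3" using \<phi> by (simp add: quot.cocycle_def)
  obtain \<psi> where \<psi>: "range \<psi> \<subseteq> carrier U2" "\<And>m. R (\<psi> m) = \<phi> m"
    by (rule lift_R[OF r\<phi>]) (rule that)
  have "R (mid.differential p \<psi> m) = \<zero>\<^bsub>U3\<^esub>" if "m \<in> monomials j (Suc n)" for m
    using \<phi> that differential_R[OF \<psi>(1), of p m] \<psi>(2) by (simp add: quot.cocycle_def)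
  then obtain \<chi> where \<chi>: "sub.cocycle j (\<not> p) (Suc n) \<chi>"
    "\<And>m. m \<in> monomials j (Suc n) \<Longrightarrow> P (\<chi> m) = mid.differential p \<psi> m"
    by (rule connecting_cocycle[OF \<psi>(1)]) (assumption, rule that)
  obtain \<omega> where \<omega>: "range \<omega> \<subseteq> carrier U1"
    "\<And>m. m \<in> monomials j (Suc n) \<Longrightarrow> \<chi> m = sub.differential p \<omega> m"
    by (rule sub.exact_atE[OF sub \<chi>(1), unfolded not_not]) (rule that)
  have cl: "\<psi> m \<in> carrier U2" "P (\<omega> m) \<in> carrier U2" "\<omega> m \<in> carrier U1" for m
    using range_subsetD[OF \<psi>(1)] range_subsetD[OF \<omega>(1)] by auto
  have P\<omega>: "range (\<lambda>m. P (\<omega> m)) \<subseteq> carrier U2" using cl by auto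
  show thesis
  proof
    show "mid.cocycle j p n (\<lambda>m. \<psi> m \<ominus>\<^bsub>U2\<^esub> P (\<omega> m))"
      unfolding mid.cocycle_def
    proof (intro conjI ballI)
      fix m assume "m \<in> monomials j (Suc n)"
      with \<chi>(2) \<omega>(2) have "P (sub.differential p \<omega> m) = mid.differential p \<psi> m" by simp
      then show "mid.differential p (\<lambda>m. \<psi> m \<ominus>\<^bsub>U2\<^esub> P (\<omega> m)) m = \<zero>\<^bsub>U2\<^esub>"
        unfolding mid.differential_diff[OF \<psi>(1) P\<omega>] using \<psi>(1)
        by (simp add: differential_P \<omega>(1) mid.minus_eq mid.r_neg)
    qed (use cl in auto)
    show "R (\<psi> m \<ominus>\<^bsub>U2\<^esub> P (\<omega> m)) = \<phi> m" for m
      using cl[of m] r\<phi> by (simp add: R_diff \<psi>(2) quot.minus_eq quot.minus_zero_eq range_subsetD)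
  qed
qed

lemma exact_at_shift_down:
  assumes "mid.exact_at j p n" "sub.exact_at j (\<not> p) (Suc n)"
  shows "quot.exact_at j p n"
  unfolding quot.exact_at_def
proof (intro allI impI)
  fix \<phi> assume "quot.cocycle j p n \<phi>"
  then obtain \<psi> where \<psi>: "mid.cocycle j p n \<psi>" "\<And>m. R (\<psi> m) = \<phi> m"
    by (rule adjusted_lift[OF assms(2)]) (rule that)
  obtain \<theta> where \<theta>: "range \<theta> \<subseteq> carrier U2"
    "\<And>m. m \<in> monomials j n \<Longrightarrow> \<psi> m = mid.differential (\<not> p) \<theta> m"
    by (rule mid.exact_atE[OF assms(1) \<psi>(1)]) (rule that)
  have "range (\<lambda>m. R (\<theta> m)) \<subseteq> carrier U3" using \<theta>(1) by auto
  moreover have "\<phi> m = quot.differential (\<not> p) (\<lambda>m. R (\<theta> m)) m" if "m \<in> monomials j n" for m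
    using \<psi>(2)[of m] \<theta>(2)[OF that] by (simp add: differential_R \<theta>(1))
  ultimately show "quot.coboundary j p n \<phi>" unfolding quot.coboundary_def by blast
qed

lemma pulled_back_cocycle_exact:
  assumes mid: "mid.exact_at j (\<not> p) (Suc n)" and \<chi>: "sub.cocycle j (\<not> p) (Suc n) \<chi>"
  obtains \<phi> where "range \<phi> \<subseteq> carrier U2" "quot.cocycle j p n (\<lambda>m. R (\<phi> m))"
    "\<And>m. m \<in> monomials j (Suc n) \<Longrightarrow> P (\<chi> m) = mid.differential p \<phi> m"
proof -
  have r\<chi>: "range \<chi> \<subseteq> carrier U1" using \<chi> by (simp add: sub.cocycle_def)
  then have "mid.cocycle j (\<not> p) (Suc n) (\<lambda>m. P (\<chi> m))"
    using \<chi> by (auto simp: mid.cocycle_def sub.cocycle_def differential_P)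
  then obtain \<phi> where \<phi>: "range \<phi> \<subseteq> carrier U2"
    "\<And>m. m \<in> monomials j (Suc n) \<Longrightarrow> P (\<chi> m) = mid.differential p \<phi> m"
    by (rule mid.exact_atE[OF mid, unfolded not_not]) (rule that)
  have "quot.differential p (\<lambda>m. R (\<phi> m)) m = \<zero>\<^bsub>U3\<^esub>" if "m \<in> monomials j (Suc n)" for m
    using r\<chi> by (simp add: differential_R \<phi>(1) flip: \<phi>(2)[OF that], simp add: range_subsetD)
  then have "quot.cocycle j p n (\<lambda>m. R (\<phi> m))"
    using \<phi>(1) by (auto simp: quot.cocycle_def)
  with \<phi> show thesis by (intro that)
qed

lemma sub_coboundary:
  assumes \<chi>: "range \<chi> \<subseteq> carrier U1" and \<phi>: "range \<phi> \<subseteq> carrier U2"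
    and eq: "\<And>m. m \<in> monomials j (Suc n) \<Longrightarrow> P (\<chi> m) = mid.differential p \<phi> m"
    and zero: "\<And>m. m \<in> monomials j n \<Longrightarrow> R (\<phi> m) = \<zero>\<^bsub>U3\<^esub>"
  shows "sub.coboundary j (\<not> p) (Suc n) \<chi>"
proof -
  obtain \<omega> where \<omega>: "range \<omega> \<subseteq> carrier U1" "\<And>m. m \<in> monomials j n \<Longrightarrow> P (\<omega> m) = \<phi> m"
    by (rule lift_P[OF \<phi> zero]) (assumption, rule that)
  have "\<chi> m = sub.differential p \<omega> m" if m: "m \<in> monomials j (Suc n)" for m
  proof -
    have "P (\<chi> m) = mid.differential p (\<lambda>m. P (\<omega> m)) m"
      unfolding eq[OF m] by (rule mid.differential_cong_monomials[OF _ _ m])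
        (use \<omega> in \<open>auto\<close>)
    then show ?thesis
      using inj_onD[OF P_inj] \<chi> \<omega>(1) by (simp add: differential_P range_subsetD)
  qed
  with \<omega>(1) show ?thesis unfolding sub.coboundary_def not_not by blast
qed

lemma exact_at_shift_up:
  assumes "mid.exact_at j (\<not> p) (Suc n)" "quot.exact_at j p n"
  shows "sub.exact_at j (\<not> p) (Suc n)"
  unfolding sub.exact_at_def
proof (intro allI impI)
  fix \<chi> assume \<chi>: "sub.cocycle j (\<not> p) (Suc n) \<chi>"
  obtain \<phi> where \<phi>: "range \<phi> \<subseteq> carrier U2" "quot.cocycle j p n (\<lambda>m. R (\<phi> m))"
    "\<And>m. m \<in> monomials j (Suc n) \<Longrightarrow> P (\<chi> m) = mid.differential p \<phi> m"
    by (rule pulled_back_cocycle_exact[OF assms(1) \<chi>]) (rule that)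
  obtain \<theta>' where \<theta>': "range \<theta>' \<subseteq> carrier U3"
    "\<And>m. m \<in> monomials j n \<Longrightarrow> R (\<phi> m) = quot.differential (\<not> p) \<theta>' m"
    by (rule quot.exact_atE[OF assms(2) \<phi>(2)]) (rule that)
  obtain \<theta> where \<theta>: "range \<theta> \<subseteq> carrier U2" "\<And>m. R (\<theta> m) = \<theta>' m"
    by (rule lift_R[OF \<theta>'(1)]) (rule that)
  have d\<theta>: "range (mid.differential (\<not> p) \<theta>) \<subseteq> carrier U2" using \<theta>(1) by auto
  have cl: "\<phi> m \<in> carrier U2" "mid.differential (\<not> p) \<theta> m \<in> carrier U2" for m
    using \<phi>(1) d\<theta> by auto
  show "sub.coboundary j (\<not> p) (Suc n) \<chi>"
  proof (rule sub_coboundary)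
    show "range \<chi> \<subseteq> carrier U1" using \<chi> by (simp add: sub.cocycle_def)
    show "range (\<lambda>m. \<phi> m \<ominus>\<^bsub>U2\<^esub> mid.differential (\<not> p) \<theta> m) \<subseteq> carrier U2" using cl by auto
    show "R (\<phi> m \<ominus>\<^bsub>U2\<^esub> mid.differential (\<not> p) \<theta> m) = \<zero>\<^bsub>U3\<^esub>" if "m \<in> monomials j n" for m
      using \<theta>'(2)[OF that] differential_R[OF \<theta>(1), of "\<not> p" m] cl[of m]
      by (simp add: R_diff \<theta>(2) quot.minus_eq quot.r_neg)
    show "P (\<chi> m) = mid.differential p (\<lambda>m. \<phi> m \<ominus>\<^bsub>U2\<^esub> mid.differential (\<not> p) \<theta> m) m"
      if "m \<in> monomials j (Suc n)" for m
      using \<phi>(3)[OF that] mid.differential_squared[OF \<theta>(1), of "\<not> p" m]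
      by (simp add: mid.differential_diff \<phi>(1) d\<theta>, simp add: mid.minus_eq mid.minus_zero_eq \<phi>(1))
  qed
qed

text \<open>
  In degree zero the cocycles are the elements killed by all operators of sign \<open>p\<close>. Since they need not
  vanish, the dimension shift starts with the cokernel of the map on these invariants.
\<close>

lemma exact_at_one_iff_lift_invariants:
  assumes "mid.exact_at j (\<not> p) 1"
  shows "sub.exact_at j (\<not> p) 1 \<longleftrightarrow>
    (\<forall>w\<in>carrier U3. (\<forall>i<j. a3 p i w = \<zero>\<^bsub>U3\<^esub>) \<longrightarrow>
      (\<exists>v\<in>carrier U2. (\<forall>i<j. a2 p i v = \<zero>\<^bsub>U2\<^esub>) \<and> R v = w))"
    (is "_ \<longleftrightarrow> ?lift")
proof
  have inv_quot: "quot.cocycle j p 0 \<phi> \<longleftrightarrow> range \<phi> \<subseteq> carrier U3 \<and> (\<forall>i<j. a3 p i (\<phi> {#}) = \<zero>\<^bsub>U3\<^esub>)" for \<phi>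
    unfolding quot.cocycle_def monomials_one
    by (auto simp: quot.differential_single range_subsetD)
  have inv_mid: "mid.cocycle j p 0 \<phi> \<longleftrightarrow> range \<phi> \<subseteq> carrier U2 \<and> (\<forall>i<j. a2 p i (\<phi> {#}) = \<zero>\<^bsub>U2\<^esub>)" for \<phi>
    unfolding mid.cocycle_def monomials_one
    by (auto simp: mid.differential_single range_subsetD)
  show ?lift if sub: "sub.exact_at j (\<not> p) 1"
  proof (intro ballI impI)
    fix w assume "w \<in> carrier U3" "\<forall>i<j. a3 p i w = \<zero>\<^bsub>U3\<^esub>"
    then have "quot.cocycle j p 0 (\<lambda>_. w)" unfolding inv_quot by auto
    then obtain \<psi> where "mid.cocycle j p 0 \<psi>" "\<And>m. R (\<psi> m) = w"
      by (rule adjusted_lift[OF sub[unfolded One_nat_def]]) (rule that)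
    then show "\<exists>v\<in>carrier U2. (\<forall>i<j. a2 p i v = \<zero>\<^bsub>U2\<^esub>) \<and> R v = w"
      unfolding inv_mid by (intro bexI[of _ "\<psi> {#}"]) auto
  qed
  show "sub.exact_at j (\<not> p) 1" if lift: ?lift
    unfolding sub.exact_at_def
  proof (intro allI impI)
    fix \<chi> assume \<chi>: "sub.cocycle j (\<not> p) 1 \<chi>"
    obtain \<phi> where \<phi>: "range \<phi> \<subseteq> carrier U2" "quot.cocycle j p 0 (\<lambda>m. R (\<phi> m))"
      "\<And>m. m \<in> monomials j (Suc 0) \<Longrightarrow> P (\<chi> m) = mid.differential p \<phi> m"
      by (rule pulled_back_cocycle_exact[OF assms[unfolded One_nat_def] \<chi>[unfolded One_nat_def]]) (rule that)
    have "R (\<phi> {#}) \<in> carrier U3" "\<forall>i<j. a3 p i (R (\<phi> {#})) = \<zero>\<^bsub>U3\<^esub>"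
      using \<phi>(2) unfolding inv_quot by auto
    with lift obtain v where v: "v \<in> carrier U2" "\<forall>i<j. a2 p i v = \<zero>\<^bsub>U2\<^esub>" "R v = R (\<phi> {#})" by metis
    have cl: "\<phi> m \<in> carrier U2" for m using \<phi>(1) by auto
    have rv: "range (\<lambda>_. v) \<subseteq> carrier U2" using v by auto
    have dv: "mid.differential p (\<lambda>_. v) m = \<zero>\<^bsub>U2\<^esub>" if "m \<in> monomials j (Suc 0)" for m
    proof -
      have "mid.cocycle j p 0 (\<lambda>_. v)" unfolding inv_mid using v rv by simp
      with that show ?thesis unfolding mid.cocycle_def by blast
    qed
    have "sub.coboundary j (\<not> p) (Suc 0) \<chi>"
    proof (rule sub_coboundary)
      show "range \<chi> \<subseteq> carrier U1" using \<chi> by (simp add: sub.cocycle_def)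
      show "range (\<lambda>m. \<phi> m \<ominus>\<^bsub>U2\<^esub> v) \<subseteq> carrier U2" using cl v by auto
      show "R (\<phi> m \<ominus>\<^bsub>U2\<^esub> v) = \<zero>\<^bsub>U3\<^esub>" if "m \<in> monomials j 0" for m
        using that v cl by (simp add: monomials_def R_diff quot.minus_eq quot.r_neg)
      show "P (\<chi> m) = mid.differential p (\<lambda>m. \<phi> m \<ominus>\<^bsub>U2\<^esub> v) m" if "m \<in> monomials j (Suc 0)" for m
        using \<phi>(3)[OF that] dv[OF that]
        unfolding mid.differential_diff[OF \<phi>(1) rv] by (simp add: mid.minus_eq mid.minus_zero_eq \<phi>(1))
    qed
    then show "sub.coboundary j (\<not> p) 1 \<chi>" by simp
  qed
qed

end


section \<open>Dickson's lemma\<close>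

text \<open>
  A decreasing sequence of natural numbers is eventually constant.
\<close>

lemma nat_seq_mono_subseq:
  fixes s :: "nat \<Rightarrow> nat"
  obtains r :: "nat \<Rightarrow> nat" where "strict_mono r" "\<And>k l. k \<le> l \<Longrightarrow> s (r k) \<le> s (r l)"
proof -
  obtain f where f: "strict_mono f" "monoseq (\<lambda>n. s (f n))" using seq_monosub by blast
  show thesis
  proof (cases "\<forall>m n. m \<le> n \<longrightarrow> s (f m) \<le> s (f n)")
    case True
    with f(1) show thesis by (intro that[of f]) auto
  next
    case False
    with f(2) have dec: "\<And>m n. m \<le> n \<Longrightarrow> s (f n) \<le> s (f m)" by (auto simp: monoseq_def)
    define N where "N = (LEAST v. v \<in> range (\<lambda>n. s (f n)))"
    have "N \<in> range (\<lambda>n. s (f n))" unfolding N_def by (rule LeastI[of _ "s (f 0)"]) simp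
    then obtain n0 where n0: "s (f n0) = N" by auto
    have "s (f n) = N" if "n \<ge> n0" for n
    proof (rule antisym)
      show "s (f n) \<le> N" using dec[OF that] n0 by simp
      show "N \<le> s (f n)" unfolding N_def by (rule Least_le) simp
    qed
    then show thesis using f(1)
      by (intro that[of "\<lambda>n. f (n0 + n)"]) (auto simp: strict_mono_def)
  qed
qed

text \<open>
  Dickson's lemma: thin out the sequence for one variable after the other.
\<close>

lemma multiset_seq_mono_subseq:
  fixes s :: "nat \<Rightarrow> nat multiset"
  assumes "\<And>n. set_mset (s n) \<subseteq> {..<c}"
  obtains r :: "nat \<Rightarrow> nat" where "strict_mono r" "\<And>k l. k \<le> l \<Longrightarrow> s (r k) \<subseteq># s (r l)"
proof -
  have "\<exists>r :: nat \<Rightarrow> nat. strict_mono r \<and> (\<forall>i<d. \<forall>k l. k \<le> l \<longrightarrow> count (s (r k)) i \<le> count (s (r l)) i)" for d :: nat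
  proof (induction d)
    case 0
    show ?case by (intro exI[of _ "\<lambda>n. n"]) (auto simp: strict_mono_def)
  next
    case (Suc d)
    then obtain r :: "nat \<Rightarrow> nat" where r: "strict_mono r" "\<forall>i<d. \<forall>k l. k \<le> l \<longrightarrow> count (s (r k)) i \<le> count (s (r l)) i"
      by blast
    obtain r' :: "nat \<Rightarrow> nat" where r': "strict_mono r'" "\<And>k l. k \<le> l \<Longrightarrow> count (s (r (r' k))) d \<le> count (s (r (r' l))) d"
      by (rule nat_seq_mono_subseq[of "\<lambda>n. count (s (r n)) d"]) (rule that)
    have mono: "r' k \<le> r' l" if "k \<le> l" for k l using r'(1) that by (simp add: strict_mono_less_eq)
    have "count (s (r (r' k))) i \<le> count (s (r (r' l))) i" if "i < Suc d" "k \<le> l" for i k l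
      using r(2) r'(2)[OF that(2)] mono[OF that(2)] that(1) by (cases "i = d") auto
    moreover have "strict_mono (\<lambda>n. r (r' n))" using r(1) r'(1) by (simp add: strict_mono_def)
    ultimately show ?case by (intro exI[of _ "\<lambda>n. r (r' n)"]) blast
  qed
  from this[of c] obtain r :: "nat \<Rightarrow> nat" where
    r: "strict_mono r" "\<forall>i<c. \<forall>k l. k \<le> l \<longrightarrow> count (s (r k)) i \<le> count (s (r l)) i"
    by (elim exE conjE) (rule that)
  have "s (r k) \<subseteq># s (r l)" if "k \<le> l" for k l
  proof (rule mset_subset_eqI)
    fix i
    have "count (s (r k)) i = 0" if "\<not> i < c"
      using assms[of "r k"] that by (auto simp: count_eq_zero_iff)
    with r(2) \<open>k \<le> l\<close> show "count (s (r k)) i \<le> count (s (r l)) i" by (cases "i < c") auto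
  qed
  with r(1) show thesis by (rule that)
qed


section \<open>Ascending chains of submodules\<close>

definition submodule_in :: "('r, 'x) ring_scheme \<Rightarrow> ('r, 'u, 'y) module_scheme \<Rightarrow> 'u set \<Rightarrow> bool" where
  "submodule_in R U V \<longleftrightarrow> V \<subseteq> carrier U \<and> \<zero>\<^bsub>U\<^esub> \<in> V \<and> (\<forall>v\<in>V. \<forall>w\<in>V. v \<oplus>\<^bsub>U\<^esub> w \<in> V) \<and>
    (\<forall>a\<in>carrier R. \<forall>v\<in>V. a \<odot>\<^bsub>U\<^esub> v \<in> V)"

text \<open>
  Chains are restricted to a subset \<open>S\<close> so that the condition can be proved along a filtration without
  forming submodules as module records.
\<close>

definition acc_within :: "('r, 'x) ring_scheme \<Rightarrow> ('r, 'u, 'y) module_scheme \<Rightarrow> 'u set \<Rightarrow> bool" where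
  "acc_within R U S \<longleftrightarrow> (\<forall>V :: nat \<Rightarrow> 'u set.
    (\<forall>n. submodule_in R U (V n) \<and> V n \<subseteq> S \<and> V n \<subseteq> V (Suc n)) \<longrightarrow> (\<exists>n0. \<forall>n\<ge>n0. V n = V n0))"

lemma acc_withinD:
  assumes "acc_within R U S"
    and "\<And>n :: nat. submodule_in R U (V n) \<and> V n \<subseteq> S \<and> V n \<subseteq> V (Suc n)"
  shows "\<exists>n0. \<forall>n\<ge>n0. V n = V n0"
  by (rule assms(1)[unfolded acc_within_def, rule_format]) (rule assms(2))

lemma (in left_module) smult_minus_one: "x \<in> carrier M \<Longrightarrow> (\<ominus> \<one>) \<odot>\<^bsub>M\<^esub> x = \<ominus>\<^bsub>M\<^esub> x"
  using smult_l_distr[of "\<ominus> \<one>" \<one> x] by (intro M.minus_equality[symmetric]) (auto simp: R.l_neg smult_zero_left)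

lemma (in left_module) submodule_in_minus:
  assumes "submodule_in R M V" "v \<in> V"
  shows "\<ominus>\<^bsub>M\<^esub> v \<in> V"
  using assms smult_minus_one[of v] unfolding submodule_in_def by (metis R.a_inv_closed R.one_closed subsetD)


section \<open>Persistence of exactness\<close>

locale koszul_module = koszul U a + U: left_module k U
  for k :: "('r, 'x) ring_scheme" and U :: "('r, 'b, 'z) module_scheme" (structure) and a +
  assumes a_smult: "\<alpha> \<in> carrier k \<Longrightarrow> u \<in> carrier U \<Longrightarrow> a p i (\<alpha> \<odot> u) = \<alpha> \<odot> a p i u"
begin

lemma differential_smult:
  assumes "range \<phi> \<subseteq> carrier U" "\<alpha> \<in> carrier k"
  shows "differential p (\<lambda>m. \<alpha> \<odot> \<phi> m) m = \<alpha> \<odot> differential p \<phi> m"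
proof -
  have "\<phi> m \<in> carrier U" for m using assms by auto
  then show ?thesis
    unfolding differential_def using assms(2)
    by (subst U.smult_finsum) (auto simp: a_smult)
qed

text \<open>
  Monomials are compared by the multiset order, which is total and compatible with multiplication. The
  cocycles form a graded submodule of the polynomials over \<open>U\<close>; what follows is the argument of Hilbert's
  basis theorem for it, with the chain condition on \<open>U\<close> in place of a noetherian coefficient ring.
\<close>

definition leading_coeffs :: "nat \<Rightarrow> bool \<Rightarrow> nat multiset \<Rightarrow> 'b set" where
  "leading_coeffs j p m = {\<phi> m |\<phi>. cocycle j p (size m) \<phi> \<and>
    (\<forall>m'\<in>monomials j (size m). m < m' \<longrightarrow> \<phi> m' = \<zero>)}"

lemma cocycle_add:
  assumes "cocycle j p n \<phi>" "cocycle j p n \<psi>"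
  shows "cocycle j p n (\<lambda>m. \<phi> m \<oplus> \<psi> m)"
  using assms by (auto simp: cocycle_def differential_add image_subset_iff)

lemma cocycle_minus:
  assumes "cocycle j p n \<phi>"
  shows "cocycle j p n (\<lambda>m. \<ominus> \<phi> m)"
  using assms by (auto simp: cocycle_def differential_minus image_subset_iff minus_zero_eq)

lemma cocycle_smult:
  assumes "cocycle j p n \<phi>" "\<alpha> \<in> carrier k"
  shows "cocycle j p n (\<lambda>m. \<alpha> \<odot> \<phi> m)"
  using assms by (auto simp: cocycle_def differential_smult image_subset_iff U.smult_zero_right)

lemma cocycle_zero: "cocycle j p n (\<lambda>m. \<zero>)"
  by (auto simp: cocycle_def differential_def)

lemma cocycle_times_var:
  assumes "cocycle j p n \<phi>" "i < j"
  shows "cocycle j p (Suc n) (times_var i \<phi>)"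
proof -
  have r: "range \<phi> \<subseteq> carrier U" using assms by (simp add: cocycle_def)
  have "m - {#i#} \<in> monomials j (Suc n)" if "m \<in> monomials j (Suc (Suc n))" "i \<in># m" for m
    using that by (auto simp: monomials_def size_Diff_singleton dest: in_diffD)
  then have "times_var i (differential p \<phi>) m = \<zero>" if "m \<in> monomials j (Suc (Suc n))" for m
    using assms(1) that by (simp add: times_var_def cocycle_def)
  then show ?thesis
    using r by (simp add: cocycle_def times_var_closed differential_times_var)
qed

lemma leading_coeffs_submodule: "submodule_in k U (leading_coeffs j p m)"
  unfolding submodule_in_def
proof (intro conjI ballI subsetI)
  fix v assume "v \<in> leading_coeffs j p m"
  then obtain \<phi> where \<phi>: "cocycle j p (size m) \<phi>" "\<And>m'. m' \<in> monomials j (size m) \<Longrightarrow> m < m' \<Longrightarrow> \<phi> m' = \<zero>"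
    "v = \<phi> m" by (auto simp: leading_coeffs_def)
  then show "v \<in> carrier U" by (auto simp: cocycle_def)
  show "\<alpha> \<odot> v \<in> leading_coeffs j p m" if "\<alpha> \<in> carrier k" for \<alpha>
    unfolding leading_coeffs_def using \<phi> cocycle_smult[OF \<phi>(1) that]
    by (intro CollectI exI[of _ "\<lambda>m. \<alpha> \<odot> \<phi> m"]) (simp add: U.smult_zero_right that)
  fix w assume "w \<in> leading_coeffs j p m"
  then obtain \<psi> where \<psi>: "cocycle j p (size m) \<psi>" "\<And>m'. m' \<in> monomials j (size m) \<Longrightarrow> m < m' \<Longrightarrow> \<psi> m' = \<zero>"
    "w = \<psi> m" by (auto simp: leading_coeffs_def)
  show "v \<oplus> w \<in> leading_coeffs j p m"
    unfolding leading_coeffs_def using \<phi> \<psi> cocycle_add[OF \<phi>(1) \<psi>(1)]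
    by (intro CollectI exI[of _ "\<lambda>m. \<phi> m \<oplus> \<psi> m"]) simp
next
  show "\<zero> \<in> leading_coeffs j p m"
    unfolding leading_coeffs_def using cocycle_zero[of j p "size m"]
    by (intro CollectI exI[of _ "\<lambda>_. \<zero>"]) simp
qed

lemma leading_coeffs_mono_step:
  assumes "i < j"
  shows "leading_coeffs j p m \<subseteq> leading_coeffs j p (add_mset i m)"
proof
  fix v assume "v \<in> leading_coeffs j p m"
  then obtain \<phi> where \<phi>: "cocycle j p (size m) \<phi>" "\<And>m'. m' \<in> monomials j (size m) \<Longrightarrow> m < m' \<Longrightarrow> \<phi> m' = \<zero>"
    "v = \<phi> m" by (auto simp: leading_coeffs_def)
  have "times_var i \<phi> m' = \<zero>" if m': "m' \<in> monomials j (Suc (size m))" "add_mset i m < m'" for m'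
  proof (cases "i \<in># m'")
    case True
    then obtain m'' where m'': "m' = add_mset i m''" by (metis mset_add)
    with m' have "m'' \<in> monomials j (size m)" "m < m''" by (auto simp: monomials_def)
    with \<phi>(2) m'' show ?thesis by (simp add: times_var_def)
  qed (simp add: times_var_def)
  moreover have "times_var i \<phi> (add_mset i m) = v" using \<phi>(3) by (simp add: times_var_def)
  ultimately show "v \<in> leading_coeffs j p (add_mset i m)"
    unfolding leading_coeffs_def using cocycle_times_var[OF \<phi>(1) assms]
    by (intro CollectI exI[of _ "times_var i \<phi>"]) simp
qed

lemma leading_coeffs_mono:
  assumes "m \<subseteq># m'" "set_mset m' \<subseteq> {..<j}"
  shows "leading_coeffs j p m \<subseteq> leading_coeffs j p m'"
proof -
  have "set_mset d \<subseteq> {..<j} \<Longrightarrow> leading_coeffs j p m \<subseteq> leading_coeffs j p (m + d)" for d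
  proof (induction d)
    case (add i d)
    then have "leading_coeffs j p m \<subseteq> leading_coeffs j p (m + d)" by simp
    also have "\<dots> \<subseteq> leading_coeffs j p (add_mset i (m + d))"
      using add.prems by (intro leading_coeffs_mono_step) auto
    finally show ?case by simp
  qed simp
  moreover have "set_mset (m' - m) \<subseteq> {..<j}" using assms(2) by (meson in_diffD subset_iff)
  ultimately show ?thesis using assms(1) by (metis subset_mset.add_diff_inverse)
qed

text \<open>
  Otherwise there are monomials of unbounded degree at which the leading coefficients grow compared to
  every divisor of degree one less. By Dickson's lemma some of them form an infinite chain of proper divisors, along
  which the leading coefficients increase strictly.
\<close>

lemma leading_coeffs_stable:
  assumes acc: "acc_within k U (carrier U)"
  obtains n0 where "\<And>m. size m > n0 \<Longrightarrow> set_mset m \<subseteq> {..<j} \<Longrightarrow>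
    \<exists>i\<in>#m. leading_coeffs j p m = leading_coeffs j p (m - {#i#})"
proof (rule ccontr)
  assume "\<not> thesis"
  then have "\<exists>m. size m > n \<and> set_mset m \<subseteq> {..<j} \<and>
      (\<forall>i\<in>#m. leading_coeffs j p m \<noteq> leading_coeffs j p (m - {#i#}))"
    for n using that[of n] by blast
  then obtain f where f: "\<And>n. size (f n) > n" "\<And>n. set_mset (f n) \<subseteq> {..<j}"
    "\<And>n i. i \<in># f n \<Longrightarrow> leading_coeffs j p (f n) \<noteq> leading_coeffs j p (f n - {#i#})"
    by metis
  \<comment> \<open>Choose the bad monomials with increasing degrees, so that divisibility along a subsequence is proper.\<close>
  define s where "s = rec_nat (f 0) (\<lambda>_ m. f (size m))"
  have s: "s (Suc n) = f (size (s n))" for n by (simp add: s_def)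
  have "\<exists>l. s n = f l" for n by (cases n) (auto simp: s_def)
  then have s': "set_mset (s n) \<subseteq> {..<j}" "\<And>i. i \<in># s n \<Longrightarrow> leading_coeffs j p (s n) \<noteq> leading_coeffs j p (s n - {#i#})" for n
    using f(2,3) by metis+
  have size_s: "strict_mono (\<lambda>n. size (s n))" by (simp add: strict_mono_Suc_iff s f(1))
  obtain r :: "nat \<Rightarrow> nat" where r: "strict_mono r" "\<And>k l. k \<le> l \<Longrightarrow> s (r k) \<subseteq># s (r l)"
    by (rule multiset_seq_mono_subseq[of s j, OF s'(1)]) (rule that)
  define V where "V n = leading_coeffs j p (s (r n))" for n
  have strict: "V n \<subset> V (Suc n)" for n
  proof -
    have "size (s (r n)) < size (s (r (Suc n)))"
      using size_s r(1) by (simp add: strict_mono_def)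
    then have "s (r n) \<noteq> s (r (Suc n))" by auto
    with r(2)[of n "Suc n"] have "s (r n) \<subset># s (r (Suc n))" by (simp add: subset_mset.le_neq_trans)
    then obtain i where i: "i \<in># s (r (Suc n))" "s (r n) \<subseteq># s (r (Suc n)) - {#i#}"
    proof -
      assume *: "\<And>i. i \<in># s (r (Suc n)) \<Longrightarrow> s (r n) \<subseteq># s (r (Suc n)) - {#i#} \<Longrightarrow> thesis"
      from \<open>s (r n) \<subset># s (r (Suc n))\<close> obtain i d where "s (r (Suc n)) = add_mset i (s (r n) + d)"
        by (metis mset_subset_eq_exists_conv multiset_nonemptyE mset_add subset_mset.less_le
            add.right_neutral union_mset_add_mset_right)
      then show thesis by (intro *[of i]) auto
    qed
    have "V n \<subseteq> leading_coeffs j p (s (r (Suc n)) - {#i#})"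
      unfolding V_def by (rule leading_coeffs_mono[OF i(2)]) (meson in_diffD s'(1) subset_iff)
    also have "\<dots> \<subset> V (Suc n)"
    proof (rule psubsetI)
      show "leading_coeffs j p (s (r (Suc n)) - {#i#}) \<subseteq> V (Suc n)"
        unfolding V_def by (rule leading_coeffs_mono[OF diff_subset_eq_self s'(1)])
      show "leading_coeffs j p (s (r (Suc n)) - {#i#}) \<noteq> V (Suc n)"
        unfolding V_def using s'(2)[OF i(1)] by simp
    qed
    finally show ?thesis .
  qed
  have "submodule_in k U (V n) \<and> V n \<subseteq> carrier U \<and> V n \<subseteq> V (Suc n)" for n
    using strict[of n] leading_coeffs_submodule[of j p "s (r n)"] by (auto simp: V_def submodule_in_def)
  then have "\<exists>n0. \<forall>n\<ge>n0. V n = V n0" by (rule acc_withinD[OF acc])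
  then obtain n0 where "\<forall>n\<ge>n0. V n = V n0" ..
  then have "V (Suc n0) = V n0" using le_SucI[OF order_refl, of n0] by blast
  then show False using strict[of n0] by auto
qed

lemma finite_monomials: "finite (monomials j n)"
proof (induction n)
  case (Suc n)
  have "monomials j (Suc n) \<subseteq> (\<lambda>(i, m). add_mset i m) ` ({..<j} \<times> monomials j n)"
  proof
    fix m assume m: "m \<in> monomials j (Suc n)"
    then obtain i m' where "m = add_mset i m'"
      using size_eq_Suc_imp_eq_union[of m n] by (auto simp: monomials_def)
    with m show "m \<in> (\<lambda>(i, m). add_mset i m) ` ({..<j} \<times> monomials j n)" by (auto simp: monomials_def)
  qed
  then show ?case using Suc finite_subset by blast
qed (simp add: monomials_def)

lemma coboundary_zero: "coboundary j p n (\<lambda>_. \<zero>)"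
  unfolding coboundary_def by (intro exI[of _ "\<lambda>_. \<zero>"]) (simp add: differential_def)

lemma coboundary_add:
  assumes "coboundary j p n \<phi>" "coboundary j p n \<psi>"
  shows "coboundary j p n (\<lambda>m. \<phi> m \<oplus> \<psi> m)"
proof -
  from assms obtain f g where "range f \<subseteq> carrier U" "\<forall>m\<in>monomials j n. \<phi> m = differential (\<not> p) f m"
    "range g \<subseteq> carrier U" "\<forall>m\<in>monomials j n. \<psi> m = differential (\<not> p) g m"
    by (auto simp: coboundary_def)
  then show ?thesis unfolding coboundary_def
    by (intro exI[of _ "\<lambda>m. f m \<oplus> g m"]) (auto simp: differential_add image_subset_iff)
qed

lemma coboundary_times_var:
  assumes "coboundary j p n \<phi>" "i < j"
  shows "coboundary j p (Suc n) (times_var i \<phi>)"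
proof -
  from assms obtain f where f: "range f \<subseteq> carrier U" "\<forall>m\<in>monomials j n. \<phi> m = differential (\<not> p) f m"
    by (auto simp: coboundary_def)
  have "m - {#i#} \<in> monomials j n" if "m \<in> monomials j (Suc n)" "i \<in># m" for m
    using that by (auto simp: monomials_def size_Diff_singleton dest: in_diffD)
  with f show ?thesis unfolding coboundary_def
    by (intro exI[of _ "times_var i f"]) (auto simp: differential_times_var times_var_closed, auto simp: times_var_def)
qed

lemma coboundary_cong:
  assumes "coboundary j p n \<phi>" "\<And>m. m \<in> monomials j n \<Longrightarrow> \<psi> m = \<phi> m"
  shows "coboundary j p n \<psi>"
  using assms by (auto simp: coboundary_def)

text \<open>
  In large degrees the leading term of a cocycle is a variable times the leading term of a cocycle of
  degree one less. Subtracting the multiple and repeating, every cocycle of degree \<open>n + 1\<close> is a sum of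
  multiples \<open>\<eta>\<^sub>i \<psi>\<close> of cocycles of degree \<open>n\<close>. If these are coboundaries, so are their multiples.
\<close>

theorem exactness_persists:
  assumes acc: "acc_within k U (carrier U)"
  shows "\<exists>n0. \<forall>n\<ge>n0. exact_at j p n \<longrightarrow> exact_at j p (Suc n)"
proof -
  obtain n0 where n0: "\<And>m. size m > n0 \<Longrightarrow> set_mset m \<subseteq> {..<j} \<Longrightarrow>
    \<exists>i\<in>#m. leading_coeffs j p m = leading_coeffs j p (m - {#i#})"
    by (rule leading_coeffs_stable[OF acc]) (rule that)
  have "exact_at j p (Suc n)" if n: "n \<ge> n0" and ex: "exact_at j p n" for n
  proof -
    \<comment> \<open>Induction on a strict upper bound \<open>m\<close> for the monomials that occur.\<close>
    have "coboundary j p (Suc n) \<phi>" if "cocycle j p (Suc n) \<phi>"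
      "\<And>m'. m' \<in> monomials j (Suc n) \<Longrightarrow> \<phi> m' \<noteq> \<zero> \<Longrightarrow> m' < m" for m \<phi>
      using that
    proof (induction m arbitrary: \<phi> rule: less_induct)
      case (less m)
      have \<phi>: "range \<phi> \<subseteq> carrier U" using less.prems by (simp add: cocycle_def)
      let ?S = "{m' \<in> monomials j (Suc n). \<phi> m' \<noteq> \<zero>}"
      show ?case
      proof (cases "?S = {}")
        case True
        then show ?thesis
          by (intro coboundary_cong[OF coboundary_zero]) auto
      next
        case False
        have fin: "finite ?S" using finite_monomials by simp
        define l where "l = Max ?S"
        have l: "l \<in> monomials j (Suc n)" "\<phi> l \<noteq> \<zero>" using Max_in[OF fin False] by (auto simp: l_def)
        have above: "\<phi> m' = \<zero>" if "m' \<in> monomials j (Suc n)" "l < m'" for m'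
          using Max_ge[OF fin, of m'] that leD[of m' l] by (auto simp: l_def)
        have sz: "size l = Suc n" "set_mset l \<subseteq> {..<j}" using l by (auto simp: monomials_def)
        obtain i where i: "i \<in># l" "leading_coeffs j p l = leading_coeffs j p (l - {#i#})"
          using n0[of l] sz n by auto
        then obtain l' where l': "l = add_mset i l'" by (metis mset_add)
        have "\<phi> l \<in> leading_coeffs j p l"
          unfolding leading_coeffs_def using above less.prems(1) sz by auto
        with i(2) l' have "\<phi> l \<in> leading_coeffs j p l'" by simp
        moreover have "size l' = n" using sz l' by simp
        ultimately obtain \<psi> where \<psi>: "cocycle j p n \<psi>"
          "\<And>m'. m' \<in> monomials j n \<Longrightarrow> l' < m' \<Longrightarrow> \<psi> m' = \<zero>" "\<phi> l = \<psi> l'"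
          unfolding leading_coeffs_def by auto
        have "i < j" using i(1) sz by auto
        have r\<psi>: "range \<psi> \<subseteq> carrier U" using \<psi> by (simp add: cocycle_def)
        have cl: "\<phi> m \<in> carrier U" "times_var i \<psi> m \<in> carrier U" for m
          using \<phi> range_subsetD[OF times_var_closed[OF r\<psi>]] by auto
        let ?\<chi> = "\<lambda>m. \<phi> m \<oplus> \<ominus> times_var i \<psi> m"
        have "coboundary j p (Suc n) ?\<chi>"
        proof (rule less.IH[of l])
          show "l < m" using less.prems(2) l by blast
          show "cocycle j p (Suc n) ?\<chi>"
            by (intro cocycle_add cocycle_minus cocycle_times_var less.prems \<psi> \<open>i < j\<close>)
          show "m' < l" if m': "m' \<in> monomials j (Suc n)" "?\<chi> m' \<noteq> \<zero>" for m'
          proof (rule ccontr)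
            assume "\<not> m' < l"
            then consider "m' = l" | "l < m'" by fastforce
            then have "?\<chi> m' = \<zero>"
            proof cases
              case 1
              then have "times_var i \<psi> m' = \<phi> m'" using l' \<psi>(3) by (simp add: times_var_def)
              then show ?thesis using cl by (simp add: r_neg)
            next
              case 2
              have "times_var i \<psi> m' = \<zero>"
              proof (cases "i \<in># m'")
                case True
                then obtain m'' where m'': "m' = add_mset i m''" by (metis mset_add)
                with m'(1) 2 l' have "m'' \<in> monomials j n" "l' < m''" by (auto simp: monomials_def)
                with \<psi>(2) m'' show ?thesis by (simp add: times_var_def)
              qed (simp add: times_var_def)
              with above[OF m'(1) 2] show ?thesis by (simp add: minus_zero_eq)
            qed
            with m'(2) show False by contradiction
          qed
        qed
        moreover have "coboundary j p (Suc n) (times_var i \<psi>)"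
          using ex \<psi>(1) \<open>i < j\<close> by (intro coboundary_times_var) (auto simp: exact_at_def)
        ultimately have "coboundary j p (Suc n) (\<lambda>m. ?\<chi> m \<oplus> times_var i \<psi> m)" by (rule coboundary_add)
        then show ?thesis
          by (rule coboundary_cong) (use cl in \<open>simp add: a_assoc l_neg\<close>)
      qed
    qed
    note * = this
    show ?thesis
      unfolding exact_at_def
    proof (intro allI impI)
      fix \<phi> assume \<phi>: "cocycle j p (Suc n) \<phi>"
      have "\<exists>m. \<forall>m'\<in>monomials j (Suc n). m' < m"
      proof -
        have "m' \<le> Max (insert {#} (monomials j (Suc n)))" if "m' \<in> monomials j (Suc n)" for m'
          using that finite_monomials[of j "Suc n"] by (intro Max_ge) auto
        then show ?thesis by (meson gt_ex le_less_trans)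
      qed
      then show "coboundary j p (Suc n) \<phi>" using *[OF \<phi>] by blast
    qed
  qed
  then show ?thesis by blast
qed

end


section \<open>Linear algebra over a field\<close>

lemma acc_within_subset: "acc_within R U S \<Longrightarrow> S' \<subseteq> S \<Longrightarrow> acc_within R U S'"
  unfolding acc_within_def by (meson order_trans)

lemma acc_within_zero: "acc_within R U {\<zero>\<^bsub>U\<^esub>}"
  unfolding acc_within_def
proof (intro allI impI)
  fix V
  assume "\<forall>n. submodule_in R U (V n) \<and> V n \<subseteq> {\<zero>\<^bsub>U\<^esub>} \<and> V n \<subseteq> V (Suc n)"
  then have "V n = {\<zero>\<^bsub>U\<^esub>}" for n by (auto simp: submodule_in_def)
  then show "\<exists>n0. \<forall>n\<ge>n0. V n = V n0" by simp
qed

lemma submodule_in_Int: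
  "submodule_in R U V \<Longrightarrow> submodule_in R U W \<Longrightarrow> submodule_in R U (V \<inter> W)"
  by (auto simp: submodule_in_def)

lemma chain_mono: "(\<And>n. V n \<subseteq> V (Suc n)) \<Longrightarrow> m \<le> n \<Longrightarrow> V m \<subseteq> (V n :: 'u set)"
  by (rule lift_Suc_mono_le)

context left_module
begin

lemma submodule_in_kernel:
  assumes N: "left_module R N" and S: "submodule_in R M S"
    and \<phi>: "\<And>v. v \<in> S \<Longrightarrow> \<phi> v \<in> carrier N"
      "\<And>v w. v \<in> S \<Longrightarrow> w \<in> S \<Longrightarrow> \<phi> (v \<oplus>\<^bsub>M\<^esub> w) = \<phi> v \<oplus>\<^bsub>N\<^esub> \<phi> w"
      "\<And>a v. a \<in> carrier R \<Longrightarrow> v \<in> S \<Longrightarrow> \<phi> (a \<odot>\<^bsub>M\<^esub> v) = a \<odot>\<^bsub>N\<^esub> \<phi> v"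
  shows "submodule_in R M {v \<in> S. \<phi> v = \<zero>\<^bsub>N\<^esub>}"
proof -
  interpret N: left_module R N by (rule N)
  have z: "\<zero>\<^bsub>M\<^esub> \<in> S" "S \<subseteq> carrier M" using S by (auto simp: submodule_in_def)
  have "\<phi> \<zero>\<^bsub>M\<^esub> = \<zero>\<^bsub>N\<^esub>"
    using \<phi>(1)[OF z(1)] \<phi>(2)[OF z(1) z(1)] by (simp add: N.add.r_cancel_one')
  then show ?thesis
    using S \<phi> by (auto simp: submodule_in_def N.smult_zero_right)
qed

lemma submodule_in_image:
  assumes N: "left_module R N" and S: "submodule_in R M S"
    and \<phi>: "\<And>v. v \<in> S \<Longrightarrow> \<phi> v \<in> carrier N"
      "\<And>v w. v \<in> S \<Longrightarrow> w \<in> S \<Longrightarrow> \<phi> (v \<oplus>\<^bsub>M\<^esub> w) = \<phi> v \<oplus>\<^bsub>N\<^esub> \<phi> w"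
      "\<And>a v. a \<in> carrier R \<Longrightarrow> v \<in> S \<Longrightarrow> \<phi> (a \<odot>\<^bsub>M\<^esub> v) = a \<odot>\<^bsub>N\<^esub> \<phi> v"
  shows "submodule_in R N (\<phi> ` S)"
proof -
  interpret N: left_module R N by (rule N)
  have z: "\<zero>\<^bsub>M\<^esub> \<in> S" using S by (auto simp: submodule_in_def)
  have "\<phi> \<zero>\<^bsub>M\<^esub> = \<zero>\<^bsub>N\<^esub>"
    using \<phi>(1)[OF z(1)] \<phi>(2)[OF z(1) z(1)] S by (auto simp: N.add.r_cancel_one' submodule_in_def)
  then have "\<zero>\<^bsub>N\<^esub> \<in> \<phi> ` S" using z by (metis imageI)
  then show ?thesis
    using S \<phi> by (auto simp: submodule_in_def simp flip: \<phi>(2,3))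
qed

text \<open>
  Nested submodules with the same image under \<open>\<phi>\<close> and the same intersection with its kernel are equal.
\<close>

lemma acc_within_extension:
  assumes N: "left_module R N" and S: "submodule_in R M S"
    and \<phi>: "\<And>v. v \<in> S \<Longrightarrow> \<phi> v \<in> carrier N"
      "\<And>v w. v \<in> S \<Longrightarrow> w \<in> S \<Longrightarrow> \<phi> (v \<oplus>\<^bsub>M\<^esub> w) = \<phi> v \<oplus>\<^bsub>N\<^esub> \<phi> w"
      "\<And>a v. a \<in> carrier R \<Longrightarrow> v \<in> S \<Longrightarrow> \<phi> (a \<odot>\<^bsub>M\<^esub> v) = a \<odot>\<^bsub>N\<^esub> \<phi> v"
    and acc: "acc_within R N (carrier N)" "acc_within R M {v \<in> S. \<phi> v = \<zero>\<^bsub>N\<^esub>}"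
  shows "acc_within R M S"
  unfolding acc_within_def
proof (intro allI impI)
  fix V :: "nat \<Rightarrow> 'c set"
  interpret N: left_module R N by (rule N)
  let ?K = "{v \<in> S. \<phi> v = \<zero>\<^bsub>N\<^esub>}"
  assume "\<forall>n. submodule_in R M (V n) \<and> V n \<subseteq> S \<and> V n \<subseteq> V (Suc n)"
  then have V: "submodule_in R M (V n)" "V n \<subseteq> S" "V n \<subseteq> V (Suc n)" for n by auto
  have mono: "m \<le> n \<Longrightarrow> V m \<subseteq> V n" for m n by (rule chain_mono) (rule V(3))
  have "submodule_in R N (\<phi> ` V n) \<and> \<phi> ` V n \<subseteq> carrier N \<and> \<phi> ` V n \<subseteq> \<phi> ` V (Suc n)" for n
  proof (intro conjI image_mono V)
    show "\<phi> ` V n \<subseteq> carrier N" using \<phi>(1) V(2) by blast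
    show "submodule_in R N (\<phi> ` V n)"
      by (rule submodule_in_image[OF N V(1)]) (use \<phi> V(2)[of n] in \<open>simp_all add: subset_iff\<close>)
  qed
  then have "\<exists>n1. \<forall>n\<ge>n1. \<phi> ` V n = \<phi> ` V n1" by (rule acc_withinD[OF acc(1)])
  then obtain n1 where n1: "\<forall>n\<ge>n1. \<phi> ` V n = \<phi> ` V n1" ..
  have "submodule_in R M (V n \<inter> ?K) \<and> V n \<inter> ?K \<subseteq> ?K \<and> V n \<inter> ?K \<subseteq> V (Suc n) \<inter> ?K" for n
  proof (intro conjI Int_lower2 Int_mono V submodule_in_Int order_refl)
    show "submodule_in R M ?K" by (rule submodule_in_kernel[OF N S \<phi>])
  qed
  then have "\<exists>n2. \<forall>n\<ge>n2. V n \<inter> ?K = V n2 \<inter> ?K" by (rule acc_withinD[OF acc(2)])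
  then obtain n2 where n2: "\<forall>n\<ge>n2. V n \<inter> ?K = V n2 \<inter> ?K" ..
  define n0 where "n0 = max n1 n2"
  have "V n \<subseteq> V n0" if "n \<ge> n0" for n
  proof
    fix v assume v: "v \<in> V n"
    have "n1 \<le> n" "n1 \<le> n0" "n2 \<le> n" "n2 \<le> n0" using that by (auto simp: n0_def)
    note n1 = n1[rule_format, OF this(1)] n1[rule_format, OF this(2)]
      and n2 = n2[rule_format, OF this(3)] n2[rule_format, OF this(4)]
    have "\<phi> ` V n = \<phi> ` V n0" using n1 by simp
    then have "\<phi> v \<in> \<phi> ` V n0" using v by (metis imageI)
    then obtain w where w: "w \<in> V n0" "\<phi> v = \<phi> w" by (elim imageE)
    have wn: "w \<in> V n" using w(1) mono[OF that] by blast
    have cl: "v \<in> carrier M" "w \<in> carrier M" "v \<in> S" "w \<in> S"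
      using v wn V(1,2)[of n] by (auto simp: submodule_in_def)
    have mw: "\<ominus>\<^bsub>M\<^esub> w \<in> V n" "\<ominus>\<^bsub>M\<^esub> w \<in> S"
      using submodule_in_minus[OF V(1) wn] V(2) by auto
    have d: "v \<oplus>\<^bsub>M\<^esub> \<ominus>\<^bsub>M\<^esub> w \<in> V n" using V(1)[of n] v mw by (auto simp: submodule_in_def)
    have "\<phi> (v \<oplus>\<^bsub>M\<^esub> \<ominus>\<^bsub>M\<^esub> w) = \<phi> (w \<oplus>\<^bsub>M\<^esub> \<ominus>\<^bsub>M\<^esub> w)"
      using cl mw w(2) \<phi>(2) by simp
    also have "\<dots> = \<phi> (\<zero> \<odot>\<^bsub>M\<^esub> w)" using cl by (simp add: M.r_neg smult_zero_left)
    also have "\<dots> = \<zero>\<^bsub>N\<^esub>" using cl \<phi>(1,3) by (simp add: N.smult_zero_left)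
    finally have "v \<oplus>\<^bsub>M\<^esub> \<ominus>\<^bsub>M\<^esub> w \<in> V n \<inter> ?K" using d V(2)[of n] by auto
    then have "v \<oplus>\<^bsub>M\<^esub> \<ominus>\<^bsub>M\<^esub> w \<in> V n2 \<inter> ?K" using n2 by simp
    then have "v \<oplus>\<^bsub>M\<^esub> \<ominus>\<^bsub>M\<^esub> w \<in> V n0" using n2 by blast
    with w(1) V(1)[of n0] have "(v \<oplus>\<^bsub>M\<^esub> \<ominus>\<^bsub>M\<^esub> w) \<oplus>\<^bsub>M\<^esub> w \<in> V n0" by (auto simp: submodule_in_def)
    then show "v \<in> V n0" using cl by (simp add: M.a_assoc M.l_neg)
  qed
  then have "V n = V n0" if "n \<ge> n0" for n using that mono[of n0 n] by blast
  then show "\<exists>n0. \<forall>n\<ge>n0. V n = V n0" by blast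
qed

primrec list_span :: "'c list \<Rightarrow> 'c set" where
  "list_span [] = {\<zero>\<^bsub>M\<^esub>}"
| "list_span (t # ts) = {v \<oplus>\<^bsub>M\<^esub> a \<odot>\<^bsub>M\<^esub> t | a v. a \<in> carrier R \<and> v \<in> list_span ts}"

lemma list_span_submodule: "set ts \<subseteq> carrier M \<Longrightarrow> submodule_in R M (list_span ts)"
proof (induction ts)
  case Nil
  then show ?case by (auto simp: submodule_in_def smult_zero_right)
next
  case (Cons t ts)
  then have t: "t \<in> carrier M" and sub: "submodule_in R M (list_span ts)" by auto
  then have S: "list_span ts \<subseteq> carrier M" "\<zero>\<^bsub>M\<^esub> \<in> list_span ts"
    and add: "\<And>v w. v \<in> list_span ts \<Longrightarrow> w \<in> list_span ts \<Longrightarrow> v \<oplus>\<^bsub>M\<^esub> w \<in> list_span ts"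
    and sm: "\<And>a v. a \<in> carrier R \<Longrightarrow> v \<in> list_span ts \<Longrightarrow> a \<odot>\<^bsub>M\<^esub> v \<in> list_span ts"
    by (auto simp: submodule_in_def)
  show ?case unfolding submodule_in_def
  proof (intro conjI ballI subsetI)
    show "\<zero>\<^bsub>M\<^esub> \<in> list_span (t # ts)"
      unfolding list_span.simps
      by (rule CollectI, rule exI[of _ \<zero>], rule exI[of _ "\<zero>\<^bsub>M\<^esub>"]) (simp add: smult_zero_left t S)
    fix x assume "x \<in> list_span (t # ts)"
    then obtain a v where x: "x = v \<oplus>\<^bsub>M\<^esub> a \<odot>\<^bsub>M\<^esub> t" "a \<in> carrier R" "v \<in> list_span ts" by auto
    then have v: "v \<in> carrier M" using S by auto
    then show "x \<in> carrier M" using x t by auto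
    show "b \<odot>\<^bsub>M\<^esub> x \<in> list_span (t # ts)" if b: "b \<in> carrier R" for b
      unfolding list_span.simps
      by (rule CollectI, rule exI[of _ "b \<otimes> a"], rule exI[of _ "b \<odot>\<^bsub>M\<^esub> v"])
        (use x t v b sm in \<open>simp add: smult_r_distr smult_assoc1\<close>)
    fix y assume "y \<in> list_span (t # ts)"
    then obtain b w where y: "y = w \<oplus>\<^bsub>M\<^esub> b \<odot>\<^bsub>M\<^esub> t" "b \<in> carrier R" "w \<in> list_span ts" by auto
    then have w: "w \<in> carrier M" using S by auto
    show "x \<oplus>\<^bsub>M\<^esub> y \<in> list_span (t # ts)"
      unfolding list_span.simps
      by (rule CollectI, rule exI[of _ "a \<oplus> b"], rule exI[of _ "v \<oplus>\<^bsub>M\<^esub> w"])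
        (use x y t v w add in \<open>simp add: smult_l_distr M.a_ac\<close>)
  qed
qed

lemma list_span_superset: "set ts \<subseteq> carrier M \<Longrightarrow> set ts \<subseteq> list_span ts"
proof (induction ts)
  case (Cons t ts)
  then have sub: "submodule_in R M (list_span ts)" and t: "t \<in> carrier M" by (auto intro: list_span_submodule)
  have "v \<in> list_span (t # ts)" if "v \<in> list_span ts" for v
    unfolding list_span.simps
    by (rule CollectI, rule exI[of _ \<zero>], rule exI[of _ v])
      (use that t sub in \<open>auto simp: smult_zero_left submodule_in_def\<close>)
  moreover have "t \<in> list_span (t # ts)"
    unfolding list_span.simps
    by (rule CollectI, rule exI[of _ \<one>], rule exI[of _ "\<zero>\<^bsub>M\<^esub>"])
      (use t sub in \<open>auto simp: submodule_in_def\<close>)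
  ultimately show ?case using Cons by auto
qed simp

lemma list_span_least:
  assumes W: "submodule_in R M W" and "set ts \<subseteq> W"
  shows "list_span ts \<subseteq> W"
  using assms(2)
proof (induction ts)
  case (Cons t ts)
  then have "v \<in> W" if "v \<in> list_span ts" for v using that by auto
  then have "v \<oplus>\<^bsub>M\<^esub> a \<odot>\<^bsub>M\<^esub> t \<in> W" if "v \<in> list_span ts" "a \<in> carrier R" for v a
    using W Cons.prems that by (simp add: submodule_in_def)
  then show ?case by auto
qed (use W in \<open>simp add: submodule_in_def\<close>)

text \<open>
  Induction on the length of the list. If some member of the chain contains a vector \<open>w\<close> outside the span
  of the tail, then \<open>w\<close> can replace the head of the list, and from then on the chain is
  determined by its intersection with the span of the tail.
\<close>

lemma acc_within_list_span:
  assumes inv: "\<And>a. a \<in> carrier R \<Longrightarrow> a \<noteq> \<zero> \<Longrightarrow> \<exists>b\<in>carrier R. b \<otimes> a = \<one>"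
    and "set ts \<subseteq> carrier M"
  shows "acc_within R M (list_span ts)"
  using assms(2)
proof (induction ts)
  case Nil
  then show ?case by (simp add: acc_within_zero)
next
  case (Cons t ts)
  then have t: "t \<in> carrier M" and acc: "acc_within R M (list_span ts)"
    and sub: "submodule_in R M (list_span ts)" by (auto intro: list_span_submodule)
  show ?case unfolding acc_within_def
  proof (intro allI impI)
    fix V :: "nat \<Rightarrow> 'c set"
    assume "\<forall>n. submodule_in R M (V n) \<and> V n \<subseteq> list_span (t # ts) \<and> V n \<subseteq> V (Suc n)"
    then have V: "submodule_in R M (V n)" "V n \<subseteq> list_span (t # ts)" "V n \<subseteq> V (Suc n)" for n by auto
    have mono: "m \<le> n \<Longrightarrow> V m \<subseteq> V n" for m n by (rule chain_mono) (rule V(3))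
    let ?S = "list_span ts"
    have "submodule_in R M (V n \<inter> ?S) \<and> V n \<inter> ?S \<subseteq> ?S \<and> V n \<inter> ?S \<subseteq> V (Suc n) \<inter> ?S" for n
      using submodule_in_Int[OF V(1) sub] V(3)[of n] by blast
    then have "\<exists>n1. \<forall>n\<ge>n1. V n \<inter> ?S = V n1 \<inter> ?S" by (rule acc_withinD[OF acc])
    then obtain n1 where n1: "\<forall>n\<ge>n1. V n \<inter> ?S = V n1 \<inter> ?S" ..
    show "\<exists>n0. \<forall>n\<ge>n0. V n = V n0"
    proof (cases "\<forall>n. V n \<subseteq> ?S")
      case True
      then have "V n \<inter> ?S = V n" for n by blast
      with n1 show ?thesis by auto
    next
      case False
      then obtain n2 w where w: "w \<in> V n2" "w \<notin> ?S" by blast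
      then obtain a v where wv: "w = v \<oplus>\<^bsub>M\<^esub> a \<odot>\<^bsub>M\<^esub> t" "a \<in> carrier R" "v \<in> ?S"
        using V(2)[of n2] by auto
      have vM: "v \<in> carrier M" using wv sub by (auto simp: submodule_in_def)
      have wM: "w \<in> carrier M" using wv vM t by auto
      have "a \<noteq> \<zero>" using w(2) wv vM t by (auto simp: smult_zero_left)
      then obtain b where b: "b \<in> carrier R" "b \<otimes> a = \<one>" using inv wv(2) by blast
      have t_eq: "b \<odot>\<^bsub>M\<^esub> w \<oplus>\<^bsub>M\<^esub> \<ominus>\<^bsub>M\<^esub> (b \<odot>\<^bsub>M\<^esub> v) = t"
      proof -
        have "b \<odot>\<^bsub>M\<^esub> w = b \<odot>\<^bsub>M\<^esub> v \<oplus>\<^bsub>M\<^esub> (b \<otimes> a) \<odot>\<^bsub>M\<^esub> t"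
          unfolding wv(1) using wv(2) b(1) vM t by (simp add: smult_r_distr smult_assoc1)
        then show ?thesis using b vM t by (simp add: M.a_ac M.r_neg)
      qed
      define n0 where "n0 = max n1 n2"
      have "V n \<subseteq> V n0" if "n \<ge> n0" for n
      proof
        fix y assume y: "y \<in> V n"
        then obtain e u where yu: "y = u \<oplus>\<^bsub>M\<^esub> e \<odot>\<^bsub>M\<^esub> t" "e \<in> carrier R" "u \<in> ?S" using V(2)[of n] by auto
        have uM: "u \<in> carrier M" using yu sub by (auto simp: submodule_in_def)
        let ?z = "(e \<otimes> b) \<odot>\<^bsub>M\<^esub> w" and ?y = "u \<oplus>\<^bsub>M\<^esub> \<ominus>\<^bsub>M\<^esub> ((e \<otimes> b) \<odot>\<^bsub>M\<^esub> v)"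
        have z: "?z \<in> V n0" "?z \<in> V n"
          using w(1) mono[of n2 n0] mono[of n2 n] V(1)[of n0] V(1)[of n] that yu(2) b(1)
          by (auto simp: n0_def submodule_in_def)
        have yS: "?y \<in> ?S"
          using sub yu(2,3) b(1) wv(3) submodule_in_minus[OF sub] by (auto simp: submodule_in_def)
        have "e \<odot>\<^bsub>M\<^esub> t = (e \<otimes> b) \<odot>\<^bsub>M\<^esub> w \<oplus>\<^bsub>M\<^esub> e \<odot>\<^bsub>M\<^esub> (\<ominus>\<^bsub>M\<^esub> (b \<odot>\<^bsub>M\<^esub> v))"
          unfolding t_eq[symmetric] using yu(2) b(1) wM vM by (simp add: smult_r_distr smult_assoc1)
        also have "e \<odot>\<^bsub>M\<^esub> (\<ominus>\<^bsub>M\<^esub> (b \<odot>\<^bsub>M\<^esub> v)) = \<ominus>\<^bsub>M\<^esub> ((e \<otimes> b) \<odot>\<^bsub>M\<^esub> v)"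
          using smult_r_distr[of e "\<ominus>\<^bsub>M\<^esub> (b \<odot>\<^bsub>M\<^esub> v)" "b \<odot>\<^bsub>M\<^esub> v"] yu(2) b(1) vM
          by (intro M.minus_equality[symmetric]) (auto simp: smult_assoc1 M.l_neg smult_zero_right)
        finally have y_eq: "y = ?y \<oplus>\<^bsub>M\<^esub> ?z"
          unfolding yu(1) using uM yu(2) b(1) vM wM by (simp add: M.a_ac)
        have "y \<oplus>\<^bsub>M\<^esub> \<ominus>\<^bsub>M\<^esub> ?z \<in> V n"
          using V(1)[of n] y submodule_in_minus[OF V(1) z(2)] by (auto simp: submodule_in_def)
        moreover have "y \<oplus>\<^bsub>M\<^esub> \<ominus>\<^bsub>M\<^esub> ?z = ?y"
          unfolding y_eq using uM yu(2) b(1) vM wM by (simp add: M.a_assoc M.r_neg)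
        ultimately have "?y \<in> V n \<inter> ?S" using yS by simp
        then have "?y \<in> V n1" using n1[rule_format, of n] that by (auto simp: n0_def)
        then have "?y \<in> V n0" using mono[of n1 n0] by (auto simp: n0_def)
        with z(1) V(1)[of n0] show "y \<in> V n0" unfolding y_eq by (auto simp: submodule_in_def)
      qed
      then have "V n = V n0" if "n \<ge> n0" for n using that mono[of n0 n] by blast
      then show ?thesis by blast
    qed
  qed
qed

end

text \<open>
  Zorn's lemma for graphs of linear maps. A graph is encoded as a submodule of the product in which the
  fibre over zero is trivial, since these conditions are visibly stable under unions of chains.
\<close>

lemma (in left_module) extend_linear_map:
  assumes N: "left_module R N"
    and inv: "\<And>a. a \<in> carrier R \<Longrightarrow> a \<noteq> \<zero> \<Longrightarrow> \<exists>b\<in>carrier R. b \<otimes> a = \<one>"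
    and V: "submodule_in R M V" and f: "f \<in> lin_hom R (M\<lparr>carrier := V\<rparr>) N"
  shows "\<exists>g\<in>lin_hom R M N. \<forall>v\<in>V. g v = f v"
proof -
  interpret N: left_module R N by (rule N)
  have fcl: "f v \<in> carrier N" if "v \<in> V" for v using f that by (auto simp: lin_hom_def)
  have f_add: "f (v \<oplus>\<^bsub>M\<^esub> w) = f v \<oplus>\<^bsub>N\<^esub> f w" if "v \<in> V" "w \<in> V" for v w
    using f that by (simp add: lin_hom_def)
  have f_sm: "f (a \<odot>\<^bsub>M\<^esub> v) = a \<odot>\<^bsub>N\<^esub> f v" if "v \<in> V" "a \<in> carrier R" for a v
    using f that by (simp add: lin_hom_def)
  have Vz: "\<zero>\<^bsub>M\<^esub> \<in> V" and VM: "V \<subseteq> carrier M" using V by (auto simp: submodule_in_def)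
  have fz: "f \<zero>\<^bsub>M\<^esub> = \<zero>\<^bsub>N\<^esub>"
    using f_sm[OF Vz R.zero_closed] fcl[OF Vz] by (simp add: smult_zero_right N.smult_zero_left)
  define \<G> where "\<G> = {G. G \<subseteq> carrier M \<times> carrier N \<and> (\<forall>v\<in>V. (v, f v) \<in> G) \<and>
    (\<forall>u y u' y'. (u, y) \<in> G \<longrightarrow> (u', y') \<in> G \<longrightarrow> (u \<oplus>\<^bsub>M\<^esub> u', y \<oplus>\<^bsub>N\<^esub> y') \<in> G) \<and>
    (\<forall>a\<in>carrier R. \<forall>u y. (u, y) \<in> G \<longrightarrow> (a \<odot>\<^bsub>M\<^esub> u, a \<odot>\<^bsub>N\<^esub> y) \<in> G) \<and>
    (\<forall>y. (\<zero>\<^bsub>M\<^esub>, y) \<in> G \<longrightarrow> y = \<zero>\<^bsub>N\<^esub>)}"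
  have "(\<lambda>v. (v, f v)) ` V \<in> \<G>"
    using VM V fcl fz by (auto simp: \<G>_def f_add f_sm submodule_in_def)
  then have "\<G> \<noteq> {}" by blast
  moreover have "\<Union>\<C> \<in> \<G>" if \<C>: "\<C> \<noteq> {}" "subset.chain \<G> \<C>" for \<C>
  proof -
    have sub: "G \<in> \<G>" if "G \<in> \<C>" for G using \<C>(2) that by (auto simp: subset.chain_def)
    have tot: "G \<subseteq> H \<or> H \<subseteq> G" if "G \<in> \<C>" "H \<in> \<C>" for G H
      using \<C>(2) that by (auto simp: subset_chain_def)
    have add: "(u \<oplus>\<^bsub>M\<^esub> u', y \<oplus>\<^bsub>N\<^esub> y') \<in> \<Union>\<C>" if "(u, y) \<in> \<Union>\<C>" "(u', y') \<in> \<Union>\<C>" for u y u' y'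
    proof -
      from that obtain G where "G \<in> \<C>" "(u, y) \<in> G" "(u', y') \<in> G" using tot by blast
      moreover from this sub[of G] have "(u \<oplus>\<^bsub>M\<^esub> u', y \<oplus>\<^bsub>N\<^esub> y') \<in> G" unfolding \<G>_def by blast
      ultimately show ?thesis by blast
    qed
    have sm: "(a \<odot>\<^bsub>M\<^esub> u, a \<odot>\<^bsub>N\<^esub> y) \<in> \<Union>\<C>" if "(u, y) \<in> \<Union>\<C>" "a \<in> carrier R" for a u y
    proof -
      from that obtain G where "G \<in> \<C>" "(u, y) \<in> G" by blast
      moreover from this sub[of G] that(2) have "(a \<odot>\<^bsub>M\<^esub> u, a \<odot>\<^bsub>N\<^esub> y) \<in> G" unfolding \<G>_def by blast
      ultimately show ?thesis by blast
    qed
    have z: "y = \<zero>\<^bsub>N\<^esub>" if "(\<zero>\<^bsub>M\<^esub>, y) \<in> \<Union>\<C>" for y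
    proof -
      from that obtain G where "G \<in> \<C>" "(\<zero>\<^bsub>M\<^esub>, y) \<in> G" by blast
      with sub[of G] show ?thesis by (auto simp: \<G>_def)
    qed
    have "\<Union>\<C> \<subseteq> carrier M \<times> carrier N" "\<forall>v\<in>V. (v, f v) \<in> \<Union>\<C>"
      using sub \<C>(1) by (fastforce simp: \<G>_def)+
    then show ?thesis unfolding \<G>_def using add sm z by blast
  qed
  ultimately have "\<exists>G\<in>\<G>. \<forall>X\<in>\<G>. G \<subseteq> X \<longrightarrow> X = G" by (rule subset_Zorn_nonempty)
  then obtain G where "G \<in> \<G>" and max: "\<And>X. X \<in> \<G> \<Longrightarrow> G \<subseteq> X \<Longrightarrow> X = G" by blast
  then have G: "G \<subseteq> carrier M \<times> carrier N" and Gf: "\<And>v. v \<in> V \<Longrightarrow> (v, f v) \<in> G"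
    and G_add: "\<And>u y u' y'. (u, y) \<in> G \<Longrightarrow> (u', y') \<in> G \<Longrightarrow> (u \<oplus>\<^bsub>M\<^esub> u', y \<oplus>\<^bsub>N\<^esub> y') \<in> G"
    and G_sm: "\<And>a u y. a \<in> carrier R \<Longrightarrow> (u, y) \<in> G \<Longrightarrow> (a \<odot>\<^bsub>M\<^esub> u, a \<odot>\<^bsub>N\<^esub> y) \<in> G"
    and G_z: "\<And>y. (\<zero>\<^bsub>M\<^esub>, y) \<in> G \<Longrightarrow> y = \<zero>\<^bsub>N\<^esub>"
    unfolding \<G>_def by blast+
  have Gcl: "u \<in> carrier M" "y \<in> carrier N" if "(u, y) \<in> G" for u y using G that by auto
  have G_unique: "y = y'" if "(u, y) \<in> G" "(u, y') \<in> G" for u y y'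
  proof -
    note cl = Gcl[OF that(1)] Gcl[OF that(2)]
    have "(u \<oplus>\<^bsub>M\<^esub> (\<ominus> \<one>) \<odot>\<^bsub>M\<^esub> u, y \<oplus>\<^bsub>N\<^esub> (\<ominus> \<one>) \<odot>\<^bsub>N\<^esub> y') \<in> G"
      by (intro G_add G_sm that) simp
    then have "y \<oplus>\<^bsub>N\<^esub> \<ominus>\<^bsub>N\<^esub> y' = \<zero>\<^bsub>N\<^esub>"
      using cl by (intro G_z) (simp add: smult_minus_one N.smult_minus_one M.r_neg)
    then show ?thesis using cl N.minus_equality[of y "\<ominus>\<^bsub>N\<^esub> y'"] by simp
  qed
  have total: "\<exists>y. (v, y) \<in> G" if v: "v \<in> carrier M" for v
  proof (rule ccontr)
    assume notin: "\<nexists>y. (v, y) \<in> G"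
    \<comment> \<open>Extend a maximal graph by zero along the line through a missing vector.\<close>
    define G' where "G' = {(u \<oplus>\<^bsub>M\<^esub> a \<odot>\<^bsub>M\<^esub> v, y) | u y a. (u, y) \<in> G \<and> a \<in> carrier R}"
    have G'I: "(u \<oplus>\<^bsub>M\<^esub> a \<odot>\<^bsub>M\<^esub> v, y) \<in> G'" if "(u, y) \<in> G" "a \<in> carrier R" for u y a
      using that by (auto simp: G'_def)
    have GG': "G \<subseteq> G'"
    proof
      fix z assume "z \<in> G"
      then obtain u y where z: "z = (u, y)" "(u, y) \<in> G" by (cases z) auto
      then show "z \<in> G'" using G'I[OF z(2) R.zero_closed] Gcl[OF z(2)] v by (simp add: smult_zero_left)
    qed
    have "G' \<in> \<G>"
      unfolding \<G>_def
    proof (intro CollectI conjI allI impI ballI)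
      show "G' \<subseteq> carrier M \<times> carrier N" using Gcl v by (auto simp: G'_def)
      show "(w, f w) \<in> G'" if "w \<in> V" for w using Gf[OF that] GG' by auto
    next
      fix u y u' y' assume "(u, y) \<in> G'" "(u', y') \<in> G'"
      then obtain p a p' a' where *: "u = p \<oplus>\<^bsub>M\<^esub> a \<odot>\<^bsub>M\<^esub> v" "u' = p' \<oplus>\<^bsub>M\<^esub> a' \<odot>\<^bsub>M\<^esub> v"
        "(p, y) \<in> G" "(p', y') \<in> G" "a \<in> carrier R" "a' \<in> carrier R" by (auto simp: G'_def)
      have "u \<oplus>\<^bsub>M\<^esub> u' = (p \<oplus>\<^bsub>M\<^esub> p') \<oplus>\<^bsub>M\<^esub> (a \<oplus> a') \<odot>\<^bsub>M\<^esub> v"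
        using * Gcl[OF *(3)] Gcl[OF *(4)] v by (simp add: smult_l_distr M.a_ac)
      then show "(u \<oplus>\<^bsub>M\<^esub> u', y \<oplus>\<^bsub>N\<^esub> y') \<in> G'" using * G'I[OF G_add[OF *(3,4)]] by simp
    next
      fix b u y assume "b \<in> carrier R" "(u, y) \<in> G'"
      then obtain p a where *: "u = p \<oplus>\<^bsub>M\<^esub> a \<odot>\<^bsub>M\<^esub> v" "(p, y) \<in> G" "a \<in> carrier R" "b \<in> carrier R"
        by (auto simp: G'_def)
      have "b \<odot>\<^bsub>M\<^esub> u = b \<odot>\<^bsub>M\<^esub> p \<oplus>\<^bsub>M\<^esub> (b \<otimes> a) \<odot>\<^bsub>M\<^esub> v"
        using * Gcl[OF *(2)] v by (simp add: smult_r_distr smult_assoc1)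
      then show "(b \<odot>\<^bsub>M\<^esub> u, b \<odot>\<^bsub>N\<^esub> y) \<in> G'" using * G'I[OF G_sm[OF *(4,2)]] by simp
    next
      fix y assume "(\<zero>\<^bsub>M\<^esub>, y) \<in> G'"
      then obtain p a where *: "\<zero>\<^bsub>M\<^esub> = p \<oplus>\<^bsub>M\<^esub> a \<odot>\<^bsub>M\<^esub> v" "(p, y) \<in> G" "a \<in> carrier R"
        by (auto simp: G'_def)
      have "a = \<zero>"
      proof (rule ccontr)
        assume "a \<noteq> \<zero>"
        with inv *(3) obtain b where b: "b \<in> carrier R" "b \<otimes> a = \<one>" by blast
        have "\<zero>\<^bsub>M\<^esub> = b \<odot>\<^bsub>M\<^esub> (p \<oplus>\<^bsub>M\<^esub> a \<odot>\<^bsub>M\<^esub> v)" using b(1) by (simp add: smult_zero_right flip: *(1))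
        also have "\<dots> = b \<odot>\<^bsub>M\<^esub> p \<oplus>\<^bsub>M\<^esub> v"
          using b *(3) Gcl[OF *(2)] v by (simp add: smult_r_distr flip: smult_assoc1)
        finally have "v = \<ominus>\<^bsub>M\<^esub> (b \<odot>\<^bsub>M\<^esub> p)"
          using b(1) Gcl[OF *(2)] v by (intro M.minus_equality[symmetric]) (auto simp: M.a_comm)
        also have "\<dots> = (\<ominus> \<one>) \<odot>\<^bsub>M\<^esub> (b \<odot>\<^bsub>M\<^esub> p)"
          using b(1) Gcl[OF *(2)] by (simp add: smult_minus_one)
        finally have "(v, (\<ominus> \<one>) \<odot>\<^bsub>N\<^esub> (b \<odot>\<^bsub>N\<^esub> y)) \<in> G" using G_sm b(1) *(2) by simp
        with notin show False by blast
      qed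
      with * have "p = \<zero>\<^bsub>M\<^esub>" using Gcl[OF *(2)] v by (simp add: smult_zero_left)
      with *(2) show "y = \<zero>\<^bsub>N\<^esub>" using G_z by simp
    qed
    from max[OF this GG'] have "G' = G" .
    moreover have "(v, f \<zero>\<^bsub>M\<^esub>) \<in> G'"
      using G'I[OF Gf[OF Vz] R.one_closed] v by simp
    ultimately show False using notin by blast
  qed
  define g where "g = (\<lambda>v\<in>carrier M. SOME y. (v, y) \<in> G)"
  have g: "(v, g v) \<in> G" if "v \<in> carrier M" for v
    using someI_ex[OF total[OF that]] that by (simp add: g_def)
  have "g \<in> carrier M \<rightarrow>\<^sub>E carrier N" using Gcl(2)[OF g] by (auto simp: g_def)
  moreover have "g (v \<oplus>\<^bsub>M\<^esub> w) = g v \<oplus>\<^bsub>N\<^esub> g w" if "v \<in> carrier M" "w \<in> carrier M" for v w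
    using that by (intro G_unique[OF g G_add[OF g g]]) auto
  moreover have "g (a \<odot>\<^bsub>M\<^esub> v) = a \<odot>\<^bsub>N\<^esub> g v" if "a \<in> carrier R" "v \<in> carrier M" for a v
    using that by (intro G_unique[OF g G_sm[OF _ g]]) auto
  moreover have "g v = f v" if "v \<in> V" for v
    using that VM by (intro G_unique[OF g Gf]) auto
  ultimately show ?thesis by (auto simp: lin_hom_def)
qed


section \<open>Modules of linear maps\<close>

definition hom_module :: "('r, 'x) ring_scheme \<Rightarrow> ('r, 'm, 'y) module_scheme \<Rightarrow> ('r, 'n, 'z) module_scheme \<Rightarrow>
    ('r, 'm \<Rightarrow> 'n) module" where
  "hom_module R M N =
    \<lparr>carrier = lin_hom R M N, monoid.mult = undefined, one = undefined,
     ring.zero = (\<lambda>x\<in>carrier M. \<zero>\<^bsub>N\<^esub>),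
     add = (\<lambda>f g. \<lambda>x\<in>carrier M. f x \<oplus>\<^bsub>N\<^esub> g x),
     smult = (\<lambda>a f. \<lambda>x\<in>carrier M. a \<odot>\<^bsub>N\<^esub> f x)\<rparr>"

lemma hom_module_simps:
  "carrier (hom_module R M N) = lin_hom R M N"
  "\<zero>\<^bsub>hom_module R M N\<^esub> = (\<lambda>x\<in>carrier M. \<zero>\<^bsub>N\<^esub>)"
  "f \<oplus>\<^bsub>hom_module R M N\<^esub> g = (\<lambda>x\<in>carrier M. f x \<oplus>\<^bsub>N\<^esub> g x)"
  "a \<odot>\<^bsub>hom_module R M N\<^esub> f = (\<lambda>x\<in>carrier M. a \<odot>\<^bsub>N\<^esub> f x)"
  by (simp_all add: hom_module_def)

lemma lin_homD:
  assumes "f \<in> lin_hom R M N"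
  shows "x \<in> carrier M \<Longrightarrow> f x \<in> carrier N"
    and "x \<in> carrier M \<Longrightarrow> y \<in> carrier M \<Longrightarrow> f (x \<oplus>\<^bsub>M\<^esub> y) = f x \<oplus>\<^bsub>N\<^esub> f y"
    and "a \<in> carrier R \<Longrightarrow> x \<in> carrier M \<Longrightarrow> f (a \<odot>\<^bsub>M\<^esub> x) = a \<odot>\<^bsub>N\<^esub> f x"
    and "x \<notin> carrier M \<Longrightarrow> f x = undefined"
proof -
  from assms have "f \<in> carrier M \<rightarrow>\<^sub>E carrier N" by (simp add: lin_hom_def)
  from PiE_mem[OF this] PiE_arb[OF this]
  show "x \<in> carrier M \<Longrightarrow> f x \<in> carrier N" "x \<notin> carrier M \<Longrightarrow> f x = undefined" by blast+
qed (use assms in \<open>simp_all add: lin_hom_def\<close>)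

lemma lin_hom_eqI:
  assumes "f \<in> lin_hom R M N" "g \<in> lin_hom R M N" "\<And>x. x \<in> carrier M \<Longrightarrow> f x = g x"
  shows "f = g"
proof
  fix x show "f x = g x"
    using assms(3) lin_homD(4)[OF assms(1), of x] lin_homD(4)[OF assms(2), of x] by metis
qed

lemma restrict_lin_homI:
  assumes "\<And>x. x \<in> carrier M \<Longrightarrow> f x \<in> carrier N"
    and "\<And>x y. x \<in> carrier M \<Longrightarrow> y \<in> carrier M \<Longrightarrow> f (x \<oplus>\<^bsub>M\<^esub> y) = f x \<oplus>\<^bsub>N\<^esub> f y"
    and "\<And>a x. a \<in> carrier R \<Longrightarrow> x \<in> carrier M \<Longrightarrow> f (a \<odot>\<^bsub>M\<^esub> x) = a \<odot>\<^bsub>N\<^esub> f x"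
    and "left_module R M"
  shows "(\<lambda>x\<in>carrier M. f x) \<in> lin_hom R M N"
proof -
  interpret M: left_module R M by (rule assms(4))
  show ?thesis using assms(1-3) by (simp add: lin_hom_def)
qed

lemma hom_module_left_module:
  assumes M: "left_module R M" and N: "left_module R N"
    and comm: "\<And>a b. a \<in> carrier R \<Longrightarrow> b \<in> carrier R \<Longrightarrow> a \<otimes>\<^bsub>R\<^esub> b = b \<otimes>\<^bsub>R\<^esub> a"
  shows "left_module R (hom_module R M N)"
proof -
  interpret M: left_module R M by (rule M)
  interpret N: left_module R N by (rule N)
  interpret H: comm_group "hom_group R M N" by (rule hom_group_comm_group[OF M N])
  have H: "carrier (hom_module R M N) = carrier (hom_group R M N)"
    "\<zero>\<^bsub>hom_module R M N\<^esub> = \<one>\<^bsub>hom_group R M N\<^esub>"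
    "f \<oplus>\<^bsub>hom_module R M N\<^esub> g = f \<otimes>\<^bsub>hom_group R M N\<^esub> g" for f g
    by (simp_all add: hom_module_def hom_group_def)
  have "abelian_group (hom_module R M N)"
    by (rule abelian_groupI, unfold H) (auto simp: H.m_assoc intro: H.m_comm H.l_inv)
  moreover have "left_module_axioms R (hom_module R M N)"
  proof
    fix a f assume a: "a \<in> carrier R" and "f \<in> carrier (hom_module R M N)"
    then have f: "f \<in> lin_hom R M N" by (simp add: hom_module_simps)
    note fD = lin_homD[OF f]
    show "a \<odot>\<^bsub>hom_module R M N\<^esub> f \<in> carrier (hom_module R M N)"
      unfolding hom_module_simps
    proof (rule restrict_lin_homI[OF _ _ _ M])
      fix b x assume "b \<in> carrier R" "x \<in> carrier M"
      then show "a \<odot>\<^bsub>N\<^esub> f (b \<odot>\<^bsub>M\<^esub> x) = b \<odot>\<^bsub>N\<^esub> (a \<odot>\<^bsub>N\<^esub> f x)"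
        using a fD comm[of a b] by (simp flip: N.smult_assoc1)
    qed (use a fD in \<open>simp_all add: N.smult_r_distr\<close>)
    fix b assume b: "b \<in> carrier R"
    show "(a \<oplus>\<^bsub>R\<^esub> b) \<odot>\<^bsub>hom_module R M N\<^esub> f =
        a \<odot>\<^bsub>hom_module R M N\<^esub> f \<oplus>\<^bsub>hom_module R M N\<^esub> b \<odot>\<^bsub>hom_module R M N\<^esub> f"
      unfolding hom_module_simps using a b fD by (auto simp: N.smult_l_distr)
    show "(a \<otimes>\<^bsub>R\<^esub> b) \<odot>\<^bsub>hom_module R M N\<^esub> f = a \<odot>\<^bsub>hom_module R M N\<^esub> (b \<odot>\<^bsub>hom_module R M N\<^esub> f)"
      unfolding hom_module_simps using a b fD by (auto simp: N.smult_assoc1)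
  next
    fix a f g assume a: "a \<in> carrier R" and "f \<in> carrier (hom_module R M N)" "g \<in> carrier (hom_module R M N)"
    then have f: "f \<in> lin_hom R M N" and g: "g \<in> lin_hom R M N" by (simp_all add: hom_module_simps)
    show "a \<odot>\<^bsub>hom_module R M N\<^esub> (f \<oplus>\<^bsub>hom_module R M N\<^esub> g) =
        a \<odot>\<^bsub>hom_module R M N\<^esub> f \<oplus>\<^bsub>hom_module R M N\<^esub> a \<odot>\<^bsub>hom_module R M N\<^esub> g"
      unfolding hom_module_simps using a lin_homD[OF f] lin_homD[OF g] by (auto simp: N.smult_r_distr)
  next
    fix f assume "f \<in> carrier (hom_module R M N)"
    then have f: "f \<in> lin_hom R M N" by (simp add: hom_module_simps)
    show "\<one>\<^bsub>R\<^esub> \<odot>\<^bsub>hom_module R M N\<^esub> f = f"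
      unfolding hom_module_simps using lin_homD(1,4)[OF f] by (auto simp: fun_eq_iff restrict_def)
  qed
  ultimately show ?thesis by (intro left_module.intro M.R.ring_axioms)
qed

text \<open>
  A linear map is determined by its values on a spanning list. Filter the linear maps by the number of final
  entries of the list on which they vanish; evaluation at the next entry embeds each quotient into \<open>N\<close>.
\<close>

lemma hom_module_acc:
  assumes M: "left_module R M" and N: "left_module R N"
    and comm: "\<And>a b. a \<in> carrier R \<Longrightarrow> b \<in> carrier R \<Longrightarrow> a \<otimes>\<^bsub>R\<^esub> b = b \<otimes>\<^bsub>R\<^esub> a"
    and ts: "set ts \<subseteq> carrier M" "carrier M \<subseteq> left_module.list_span R M ts"
    and acc: "acc_within R N (carrier N)"
  shows "acc_within R (hom_module R M N) (carrier (hom_module R M N))"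
proof -
  interpret M: left_module R M by (rule M)
  interpret N: left_module R N by (rule N)
  interpret H: left_module R "hom_module R M N" by (rule hom_module_left_module[OF M N comm])
  let ?H = "hom_module R M N"
  let ?S = "\<lambda>us. {f \<in> carrier ?H. \<forall>u\<in>set us. f u = \<zero>\<^bsub>N\<^esub>}"
  have sub: "submodule_in R ?H (?S us)" if "set us \<subseteq> carrier M" for us
  proof -
    have add: "f \<oplus>\<^bsub>?H\<^esub> g \<in> ?S us" if "f \<in> ?S us" "g \<in> ?S us" for f g
      using that H.M.add.m_closed[of f g] \<open>set us \<subseteq> carrier M\<close> by (auto simp: hom_module_simps(3))
    have "a \<odot>\<^bsub>?H\<^esub> f \<in> ?S us" if "f \<in> ?S us" "a \<in> carrier R" for f a
      using that H.smult_closed[of a f] \<open>set us \<subseteq> carrier M\<close>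
      by (auto simp: hom_module_simps(4) N.smult_zero_right)
    moreover have "\<zero>\<^bsub>?H\<^esub> \<in> ?S us"
      using H.M.zero_closed \<open>set us \<subseteq> carrier M\<close> by (auto simp: hom_module_simps(2))
    ultimately show ?thesis unfolding submodule_in_def using add by blast
  qed
  have "acc_within R ?H (?S (drop n ts))" for n
    using ts
  proof (induction n)
    case 0
    have "f = \<zero>\<^bsub>?H\<^esub>" if f: "f \<in> ?S ts" for f
    proof (rule lin_hom_eqI)
      show lf: "f \<in> lin_hom R M N" "\<zero>\<^bsub>?H\<^esub> \<in> lin_hom R M N"
        using f H.M.zero_closed unfolding hom_module_simps(1) by auto
      have "submodule_in R M {v \<in> carrier M. f v = \<zero>\<^bsub>N\<^esub>}"
        by (rule M.submodule_in_kernel[OF N]) (use lin_homD[OF lf(1)] in \<open>auto simp: submodule_in_def\<close>)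
      moreover have "set ts \<subseteq> {v \<in> carrier M. f v = \<zero>\<^bsub>N\<^esub>}" using f ts(1) by auto
      ultimately have "M.list_span ts \<subseteq> {v \<in> carrier M. f v = \<zero>\<^bsub>N\<^esub>}" by (rule M.list_span_least)
      then have "f x = \<zero>\<^bsub>N\<^esub>" if "x \<in> carrier M" for x using ts(2) that by blast
      then show "f x = \<zero>\<^bsub>?H\<^esub> x" if "x \<in> carrier M" for x using that by (simp add: hom_module_simps)
    qed
    then have "?S ts \<subseteq> {\<zero>\<^bsub>?H\<^esub>}" by blast
    then show ?case using acc_within_subset[OF acc_within_zero] by simp
  next
    case (Suc n)
    show ?case
    proof (cases "n < length ts")
      case True
      let ?t = "ts ! n"
      have t: "?t \<in> carrier M" using True ts(1) by auto
      have dr: "drop n ts = ?t # drop (Suc n) ts" using True by (simp add: Cons_nth_drop_Suc)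
      have us: "set (drop (Suc n) ts) \<subseteq> carrier M" by (rule order_trans[OF set_drop_subset ts(1)])
      have "{f \<in> ?S (drop (Suc n) ts). f ?t = \<zero>\<^bsub>N\<^esub>} = ?S (drop n ts)" unfolding dr by auto
      then have "acc_within R ?H {f \<in> ?S (drop (Suc n) ts). f ?t = \<zero>\<^bsub>N\<^esub>}" using Suc by simp
      then show ?thesis
        by (intro H.acc_within_extension[OF N sub[OF us] _ _ _ acc, where \<phi> = "\<lambda>f. f ?t"])
          (use t in \<open>auto simp: hom_module_simps dest: lin_homD(1)\<close>)
    next
      case False
      then show ?thesis using Suc by simp
    qed
  qed
  from this[of "length ts"] show ?thesis by simp
qed

lemma smult_minus:
  assumes "left_module R M" "a \<in> carrier R" "m \<in> carrier M"
  shows "a \<odot>\<^bsub>M\<^esub> (\<ominus>\<^bsub>M\<^esub> m) = \<ominus>\<^bsub>M\<^esub> (a \<odot>\<^bsub>M\<^esub> m)"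
proof -
  interpret M: left_module R M by fact
  have "a \<odot>\<^bsub>M\<^esub> (\<ominus>\<^bsub>M\<^esub> m) \<oplus>\<^bsub>M\<^esub> a \<odot>\<^bsub>M\<^esub> m = \<zero>\<^bsub>M\<^esub>"
    using assms by (simp add: M.M.l_neg M.smult_zero_right flip: M.smult_r_distr)
  then show ?thesis using assms by (intro M.M.minus_equality[symmetric]) auto
qed

lemma lin_hom_zero:
  assumes "left_module R M" "left_module R N" "f \<in> lin_hom R M N"
  shows "f \<zero>\<^bsub>M\<^esub> = \<zero>\<^bsub>N\<^esub>"
proof -
  interpret M: left_module R M by fact
  interpret N: left_module R N by fact
  have "f (\<zero>\<^bsub>R\<^esub> \<odot>\<^bsub>M\<^esub> \<zero>\<^bsub>M\<^esub>) = \<zero>\<^bsub>R\<^esub> \<odot>\<^bsub>N\<^esub> f \<zero>\<^bsub>M\<^esub>" using lin_homD(3)[OF assms(3)] by simp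
  then show ?thesis using lin_homD(1)[OF assms(3)] by (simp add: M.smult_zero_right N.smult_zero_left)
qed

lemma lin_hom_minus:
  assumes "left_module R M" "left_module R N" "f \<in> lin_hom R M N" "m \<in> carrier M"
  shows "f (\<ominus>\<^bsub>M\<^esub> m) = \<ominus>\<^bsub>N\<^esub> f m"
proof -
  interpret M: left_module R M by fact
  interpret N: left_module R N by fact
  have "f (\<ominus>\<^bsub>M\<^esub> m) \<oplus>\<^bsub>N\<^esub> f m = \<zero>\<^bsub>N\<^esub>"
    using lin_homD(2)[OF assms(3), of "\<ominus>\<^bsub>M\<^esub> m" m] assms(4) lin_hom_zero[OF assms(1-3)]
    by (simp add: M.M.l_neg)
  then show ?thesis using assms lin_homD(1)[OF assms(3)] by (intro N.M.minus_equality[symmetric]) auto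
qed


section \<open>The Koszul complex of linear maps\<close>

text \<open>
  What the argument uses of an exterior algebra on \<open>x\<^sub>0, \<dots>, x\<^sub>c\<^sub>-\<^sub>1\<close> over a field \<open>k\<close>. The existence of
  contractions \<open>\<partial>\<^sub>j\<close> with \<open>\<partial>\<^sub>j x\<^sub>i + x\<^sub>i \<partial>\<^sub>j = \<delta>\<^sub>i\<^sub>j\<close> replaces any knowledge of a basis of the algebra. The generators
  are indexed by all natural numbers, with \<open>x\<^sub>i = 0\<close> from \<open>c\<close> on in the application, so that the
  relations carry no side conditions. The rule \<open>generated\<close> expresses that \<open>k\<close> and the \<open>x\<^sub>i\<close> generate the ring.
\<close>

locale exterior_ring = ring A for A :: "('a, 'x) ring_scheme" (structure) +
  fixes k :: "'a set" and x :: "nat \<Rightarrow> 'a" and c :: nat and contraction :: "nat \<Rightarrow> 'a \<Rightarrow> 'a"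
  assumes k_subring: "subring k A"
    and k_central: "\<alpha> \<in> k \<Longrightarrow> b \<in> carrier A \<Longrightarrow> \<alpha> \<otimes> b = b \<otimes> \<alpha>"
    and k_inverse: "\<alpha> \<in> k \<Longrightarrow> \<alpha> \<noteq> \<zero> \<Longrightarrow> \<exists>\<beta>\<in>k. \<beta> \<otimes> \<alpha> = \<one>"
    and x_closed [simp, intro]: "x i \<in> carrier A"
    and x_square: "x i \<otimes> x i = \<zero>"
    and x_anti: "x i \<otimes> x j \<oplus> x j \<otimes> x i = \<zero>"
    and generated: "\<lbrakk>P \<one>; \<And>a b. a \<in> carrier A \<Longrightarrow> b \<in> carrier A \<Longrightarrow> P a \<Longrightarrow> P b \<Longrightarrow> P (a \<oplus> b);
      \<And>\<alpha> a. \<alpha> \<in> k \<Longrightarrow> a \<in> carrier A \<Longrightarrow> P a \<Longrightarrow> P (\<alpha> \<otimes> a);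
      \<And>i a. i < c \<Longrightarrow> a \<in> carrier A \<Longrightarrow> P a \<Longrightarrow> P (x i \<otimes> a); a \<in> carrier A\<rbrakk> \<Longrightarrow> P a"
    and contraction_closed [simp, intro]: "a \<in> carrier A \<Longrightarrow> contraction j a \<in> carrier A"
    and contraction_add: "a \<in> carrier A \<Longrightarrow> b \<in> carrier A \<Longrightarrow>
      contraction j (a \<oplus> b) = contraction j a \<oplus> contraction j b"
    and contraction_smult: "\<alpha> \<in> k \<Longrightarrow> a \<in> carrier A \<Longrightarrow> contraction j (\<alpha> \<otimes> a) = \<alpha> \<otimes> contraction j a"
    and contraction_x: "i < c \<Longrightarrow> j < c \<Longrightarrow> a \<in> carrier A \<Longrightarrow>
      contraction j (x i \<otimes> a) \<oplus> x i \<otimes> contraction j a = (if i = j then a else \<zero>)"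
begin

text \<open>
  Restricting the carrier of the ring turns every module over it into a module over the scalars with the
  same underlying record.
\<close>

abbreviation scalars :: "('a, 'x) ring_scheme" where
  "scalars \<equiv> A\<lparr>carrier := k\<rparr>"

lemma k_closed: "\<alpha> \<in> k \<Longrightarrow> \<alpha> \<in> carrier A"
  using subringE(1)[OF k_subring] by blast

lemma scalars_ring: "ring scalars"
  by (rule subring_is_ring[OF k_subring])

lemma scalars_comm: "a \<in> carrier scalars \<Longrightarrow> b \<in> carrier scalars \<Longrightarrow> a \<otimes>\<^bsub>scalars\<^esub> b = b \<otimes>\<^bsub>scalars\<^esub> a"
  using k_central k_closed by simp

lemma scalars_inverse: "a \<in> carrier scalars \<Longrightarrow> a \<noteq> \<zero>\<^bsub>scalars\<^esub> \<Longrightarrow> \<exists>b\<in>carrier scalars. b \<otimes>\<^bsub>scalars\<^esub> a = \<one>\<^bsub>scalars\<^esub>"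
  using k_inverse by simp

lemma scalars_left_module:
  assumes "left_module A M"
  shows "left_module scalars M"
proof -
  interpret M: left_module A M by (rule assms)
  show ?thesis
    by (intro left_module.intro left_module_axioms.intro scalars_ring M.M.abelian_group_axioms)
      (simp_all add: k_closed M.smult_l_distr M.smult_r_distr M.smult_assoc1)
qed

lemma lin_hom_scalars: "f \<in> lin_hom A M N \<Longrightarrow> f \<in> lin_hom scalars M N"
  by (auto simp: lin_hom_def k_closed)

lemma lin_hom_iff_commutes:
  assumes "left_module A M" "left_module A N"
  shows "f \<in> lin_hom A M N \<longleftrightarrow> f \<in> lin_hom scalars M N \<and>
    (\<forall>i<c. \<forall>m\<in>carrier M. f (x i \<odot>\<^bsub>M\<^esub> m) = x i \<odot>\<^bsub>N\<^esub> f m)"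
proof
  interpret M: left_module A M by fact
  interpret N: left_module A N by fact
  assume *: "f \<in> lin_hom scalars M N \<and> (\<forall>i<c. \<forall>m\<in>carrier M. f (x i \<odot>\<^bsub>M\<^esub> m) = x i \<odot>\<^bsub>N\<^esub> f m)"
  then have f: "f \<in> lin_hom scalars M N" by simp
  note fD = lin_homD[OF f, simplified]
  have "\<forall>m\<in>carrier M. f (a \<odot>\<^bsub>M\<^esub> m) = a \<odot>\<^bsub>N\<^esub> f m" if "a \<in> carrier A" for a
    using _ _ _ _ that
  proof (rule generated)
    show "\<forall>m\<in>carrier M. f ((a \<oplus> b) \<odot>\<^bsub>M\<^esub> m) = (a \<oplus> b) \<odot>\<^bsub>N\<^esub> f m"
      if "a \<in> carrier A" "b \<in> carrier A" "\<forall>m\<in>carrier M. f (a \<odot>\<^bsub>M\<^esub> m) = a \<odot>\<^bsub>N\<^esub> f m"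
        "\<forall>m\<in>carrier M. f (b \<odot>\<^bsub>M\<^esub> m) = b \<odot>\<^bsub>N\<^esub> f m" for a b
      using that fD by (simp add: M.smult_l_distr N.smult_l_distr)
    show "\<forall>m\<in>carrier M. f ((\<alpha> \<otimes> a) \<odot>\<^bsub>M\<^esub> m) = (\<alpha> \<otimes> a) \<odot>\<^bsub>N\<^esub> f m"
      if "\<alpha> \<in> k" "a \<in> carrier A" "\<forall>m\<in>carrier M. f (a \<odot>\<^bsub>M\<^esub> m) = a \<odot>\<^bsub>N\<^esub> f m" for \<alpha> a
      using that fD k_closed by (simp add: M.smult_assoc1 N.smult_assoc1)
    show "\<forall>m\<in>carrier M. f ((x i \<otimes> a) \<odot>\<^bsub>M\<^esub> m) = (x i \<otimes> a) \<odot>\<^bsub>N\<^esub> f m"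
      if "i < c" "a \<in> carrier A" "\<forall>m\<in>carrier M. f (a \<odot>\<^bsub>M\<^esub> m) = a \<odot>\<^bsub>N\<^esub> f m" for i a
      using that fD * by (simp add: M.smult_assoc1 N.smult_assoc1)
  qed (use fD in simp)
  with f show "f \<in> lin_hom A M N" by (simp add: lin_hom_def)
qed (simp add: lin_hom_scalars lin_homD(3))

definition sign :: "('a, 'n, 'z) module_scheme \<Rightarrow> bool \<Rightarrow> 'n \<Rightarrow> 'n" where
  "sign N p y = (if p then y else \<ominus>\<^bsub>N\<^esub> y)"

definition hom_action :: "('a, 'm, 'y) module_scheme \<Rightarrow> ('a, 'n, 'z) module_scheme \<Rightarrow>
    bool \<Rightarrow> nat \<Rightarrow> ('m \<Rightarrow> 'n) \<Rightarrow> 'm \<Rightarrow> 'n" where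
  "hom_action M N p i f = (\<lambda>m\<in>carrier M. x i \<odot>\<^bsub>N\<^esub> f m \<oplus>\<^bsub>N\<^esub> sign N p (f (x i \<odot>\<^bsub>M\<^esub> m)))"

text \<open>
  Composing two operators of opposite signs, the mixed terms \<open>x\<^sub>i f x\<^sub>j\<close> cancel in the symmetric sum over \<open>i\<close>
  and \<open>j\<close>, and the outer terms cancel because the generators anticommute.
\<close>

lemma hom_koszul_module:
  assumes M: "left_module A M" and N: "left_module A N"
  shows "koszul_module scalars (hom_module scalars M N) (hom_action M N)"
proof -
  interpret M: left_module A M by (rule M)
  interpret N: left_module A N by (rule N)
  note Mk = scalars_left_module[OF M] and Nk = scalars_left_module[OF N]
  let ?H = "hom_module scalars M N" and ?a = "hom_action M N"
  interpret H: left_module scalars ?H by (rule hom_module_left_module[OF Mk Nk scalars_comm])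
  have closed: "?a p i f \<in> lin_hom scalars M N" if f: "f \<in> lin_hom scalars M N" for p i f
    unfolding hom_action_def
  proof (rule restrict_lin_homI[OF _ _ _ Mk])
    note fD = lin_homD[OF f, simplified]
    fix m assume m: "m \<in> carrier M"
    show "x i \<odot>\<^bsub>N\<^esub> f m \<oplus>\<^bsub>N\<^esub> sign N p (f (x i \<odot>\<^bsub>M\<^esub> m)) \<in> carrier N"
      using fD m by (simp add: sign_def)
    show "x i \<odot>\<^bsub>N\<^esub> f (m \<oplus>\<^bsub>M\<^esub> m') \<oplus>\<^bsub>N\<^esub> sign N p (f (x i \<odot>\<^bsub>M\<^esub> (m \<oplus>\<^bsub>M\<^esub> m'))) =
      x i \<odot>\<^bsub>N\<^esub> f m \<oplus>\<^bsub>N\<^esub> sign N p (f (x i \<odot>\<^bsub>M\<^esub> m)) \<oplus>\<^bsub>N\<^esub> (x i \<odot>\<^bsub>N\<^esub> f m' \<oplus>\<^bsub>N\<^esub> sign N p (f (x i \<odot>\<^bsub>M\<^esub> m')))"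
      if m': "m' \<in> carrier M" for m'
      using fD m m' by (simp add: sign_def M.smult_r_distr N.smult_r_distr N.M.minus_add N.M.a_ac)
    show "x i \<odot>\<^bsub>N\<^esub> f (\<alpha> \<odot>\<^bsub>M\<^esub> m) \<oplus>\<^bsub>N\<^esub> sign N p (f (x i \<odot>\<^bsub>M\<^esub> (\<alpha> \<odot>\<^bsub>M\<^esub> m))) =
        \<alpha> \<odot>\<^bsub>N\<^esub> (x i \<odot>\<^bsub>N\<^esub> f m \<oplus>\<^bsub>N\<^esub> sign N p (f (x i \<odot>\<^bsub>M\<^esub> m)))" if "\<alpha> \<in> carrier scalars" for \<alpha>
    proof -
      have \<alpha>: "\<alpha> \<in> k" "\<alpha> \<in> carrier A" using that k_closed by auto
      have swap: "x i \<odot>\<^bsub>M\<^esub> (\<alpha> \<odot>\<^bsub>M\<^esub> m) = \<alpha> \<odot>\<^bsub>M\<^esub> (x i \<odot>\<^bsub>M\<^esub> m)"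
        "x i \<odot>\<^bsub>N\<^esub> (\<alpha> \<odot>\<^bsub>N\<^esub> f m) = \<alpha> \<odot>\<^bsub>N\<^esub> (x i \<odot>\<^bsub>N\<^esub> f m)"
        using \<alpha> m fD(1) k_central[OF \<alpha>(1), of "x i"] by (simp_all flip: M.smult_assoc1 N.smult_assoc1)
      show ?thesis
        using \<alpha> m fD by (simp add: swap sign_def N.smult_r_distr smult_minus[OF N])
    qed
  qed
  have val: "?a p i f m = x i \<odot>\<^bsub>N\<^esub> f m \<oplus>\<^bsub>N\<^esub> sign N p (f (x i \<odot>\<^bsub>M\<^esub> m))" if "m \<in> carrier M" for p i f m
    using that by (simp add: hom_action_def)
  show ?thesis
  proof (unfold_locales, unfold hom_module_simps(1))
    fix f p i assume f: "f \<in> lin_hom scalars M N"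
    note fD = lin_homD[OF f, simplified]
    show "?a p i f \<in> lin_hom scalars M N" by (rule closed[OF f])
    show "?a (\<not> p) i (?a p i f) = \<zero>\<^bsub>?H\<^esub>"
    proof (rule lin_hom_eqI)
      show "?a (\<not> p) i (?a p i f) \<in> lin_hom scalars M N" "\<zero>\<^bsub>?H\<^esub> \<in> lin_hom scalars M N"
        using closed f H.M.zero_closed by (simp_all add: hom_module_simps(1))
      fix m assume m: "m \<in> carrier M"
      have 1: "x i \<odot>\<^bsub>N\<^esub> (x i \<odot>\<^bsub>N\<^esub> f m) = \<zero>\<^bsub>N\<^esub>" "f (x i \<odot>\<^bsub>M\<^esub> (x i \<odot>\<^bsub>M\<^esub> m)) = \<zero>\<^bsub>N\<^esub>"
        using fD m x_square[of i] lin_hom_zero[OF Mk Nk f]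
        by (simp_all add: N.smult_zero_left M.smult_zero_left flip: N.smult_assoc1 M.smult_assoc1)
      have "x i \<odot>\<^bsub>N\<^esub> f (x i \<odot>\<^bsub>M\<^esub> m) \<in> carrier N" using fD m by simp
      then show "?a (\<not> p) i (?a p i f) m = \<zero>\<^bsub>?H\<^esub> m"
        using m fD 1 by (simp add: val hom_module_simps(2) sign_def N.smult_r_distr smult_minus[OF N]
            N.M.minus_zero_eq N.M.r_neg N.M.l_neg)
    qed
    show "?a (\<not> p) i (?a p j f) \<oplus>\<^bsub>?H\<^esub> ?a (\<not> p) j (?a p i f) = \<zero>\<^bsub>?H\<^esub>" for j
    proof (rule lin_hom_eqI)
      show "?a (\<not> p) i (?a p j f) \<oplus>\<^bsub>?H\<^esub> ?a (\<not> p) j (?a p i f) \<in> lin_hom scalars M N"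
        "\<zero>\<^bsub>?H\<^esub> \<in> lin_hom scalars M N"
        using closed f H.M.zero_closed H.M.add.m_closed[unfolded hom_module_simps(1)]
        by (simp_all add: hom_module_simps(1))
      fix m assume m: "m \<in> carrier M"
      \<comment> \<open>The four terms \<open>x\<^sub>i x\<^sub>j f\<close>, \<open>f x\<^sub>j x\<^sub>i\<close>, \<open>x\<^sub>i f x\<^sub>j\<close> and \<open>x\<^sub>j f x\<^sub>i\<close> at \<open>m\<close>.\<close>
      define s where "s = x i \<odot>\<^bsub>N\<^esub> (x j \<odot>\<^bsub>N\<^esub> f m)"
      define t where "t = f (x j \<odot>\<^bsub>M\<^esub> (x i \<odot>\<^bsub>M\<^esub> m))"
      define u where "u = x i \<odot>\<^bsub>N\<^esub> f (x j \<odot>\<^bsub>M\<^esub> m)"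
      define v where "v = x j \<odot>\<^bsub>N\<^esub> f (x i \<odot>\<^bsub>M\<^esub> m)"
      have cl: "s \<in> carrier N" "t \<in> carrier N" "u \<in> carrier N" "v \<in> carrier N"
        using m fD by (simp_all add: s_def t_def u_def v_def)
      have xx: "x j \<otimes> x i = \<ominus> (x i \<otimes> x j)"
        by (rule minus_equality[symmetric]) (use x_anti[of j i] in auto)
      have s': "x j \<odot>\<^bsub>N\<^esub> (x i \<odot>\<^bsub>N\<^esub> f m) = \<ominus>\<^bsub>N\<^esub> s"
        by (rule N.M.minus_equality[symmetric])
          (use m fD in \<open>simp_all add: s_def x_anti N.smult_zero_left flip: N.smult_assoc1 N.smult_l_distr\<close>)
      have "f (x i \<odot>\<^bsub>M\<^esub> (x j \<odot>\<^bsub>M\<^esub> m)) \<oplus>\<^bsub>N\<^esub> t = f ((x i \<otimes> x j \<oplus> x j \<otimes> x i) \<odot>\<^bsub>M\<^esub> m)"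
        using m fD by (simp add: t_def M.smult_l_distr M.smult_assoc1)
      then have t': "f (x i \<odot>\<^bsub>M\<^esub> (x j \<odot>\<^bsub>M\<^esub> m)) = \<ominus>\<^bsub>N\<^esub> t"
        using m fD cl lin_hom_zero[OF Mk Nk f]
        by (intro N.M.minus_equality[symmetric]) (simp_all add: x_anti M.smult_zero_left)
      have 1: "?a (\<not> p) i (?a p j f) m = s \<oplus>\<^bsub>N\<^esub> sign N p u \<oplus>\<^bsub>N\<^esub> sign N (\<not> p) (v \<oplus>\<^bsub>N\<^esub> sign N p t)"
        using m fD by (simp add: val s_def t_def u_def v_def sign_def N.smult_r_distr smult_minus[OF N])
      have 2: "?a (\<not> p) j (?a p i f) m = \<ominus>\<^bsub>N\<^esub> s \<oplus>\<^bsub>N\<^esub> sign N p v \<oplus>\<^bsub>N\<^esub> sign N (\<not> p) (u \<oplus>\<^bsub>N\<^esub> sign N p (\<ominus>\<^bsub>N\<^esub> t))"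
        using m fD by (simp add: val s' t' sign_def N.smult_r_distr smult_minus[OF N], simp add: u_def v_def)
      have "s \<oplus>\<^bsub>N\<^esub> sign N p u \<oplus>\<^bsub>N\<^esub> sign N (\<not> p) (v \<oplus>\<^bsub>N\<^esub> sign N p t) \<oplus>\<^bsub>N\<^esub>
          (\<ominus>\<^bsub>N\<^esub> s \<oplus>\<^bsub>N\<^esub> sign N p v \<oplus>\<^bsub>N\<^esub> sign N (\<not> p) (u \<oplus>\<^bsub>N\<^esub> sign N p (\<ominus>\<^bsub>N\<^esub> t))) = \<zero>\<^bsub>N\<^esub>"
      proof -
        have "s \<oplus>\<^bsub>N\<^esub> sign N p u \<oplus>\<^bsub>N\<^esub> sign N (\<not> p) (v \<oplus>\<^bsub>N\<^esub> sign N p t) \<oplus>\<^bsub>N\<^esub>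
            (\<ominus>\<^bsub>N\<^esub> s \<oplus>\<^bsub>N\<^esub> sign N p v \<oplus>\<^bsub>N\<^esub> sign N (\<not> p) (u \<oplus>\<^bsub>N\<^esub> sign N p (\<ominus>\<^bsub>N\<^esub> t))) =
            (s \<oplus>\<^bsub>N\<^esub> \<ominus>\<^bsub>N\<^esub> s) \<oplus>\<^bsub>N\<^esub> (t \<oplus>\<^bsub>N\<^esub> \<ominus>\<^bsub>N\<^esub> t) \<oplus>\<^bsub>N\<^esub> (u \<oplus>\<^bsub>N\<^esub> \<ominus>\<^bsub>N\<^esub> u) \<oplus>\<^bsub>N\<^esub> (v \<oplus>\<^bsub>N\<^esub> \<ominus>\<^bsub>N\<^esub> v)"
          using cl by (cases p) (simp_all add: sign_def N.M.minus_add N.M.a_ac)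
        then show ?thesis using cl by (simp add: N.M.r_neg)
      qed
      then show "(?a (\<not> p) i (?a p j f) \<oplus>\<^bsub>?H\<^esub> ?a (\<not> p) j (?a p i f)) m = \<zero>\<^bsub>?H\<^esub> m"
        using m by (simp add: hom_module_simps(2,3) 1 2)
    qed
    show "?a p i (\<alpha> \<odot>\<^bsub>?H\<^esub> f) = \<alpha> \<odot>\<^bsub>?H\<^esub> ?a p i f" if \<alpha>: "\<alpha> \<in> carrier scalars" for \<alpha>
    proof (rule lin_hom_eqI)
      show "?a p i (\<alpha> \<odot>\<^bsub>?H\<^esub> f) \<in> lin_hom scalars M N" "\<alpha> \<odot>\<^bsub>?H\<^esub> ?a p i f \<in> lin_hom scalars M N"
        using closed f \<alpha> H.smult_closed[unfolded hom_module_simps(1)] by simp_all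
      have \<alpha>: "\<alpha> \<in> k" "\<alpha> \<in> carrier A" using that k_closed by auto
      fix m assume m: "m \<in> carrier M"
      have "x i \<odot>\<^bsub>N\<^esub> (\<alpha> \<odot>\<^bsub>N\<^esub> f m) = \<alpha> \<odot>\<^bsub>N\<^esub> (x i \<odot>\<^bsub>N\<^esub> f m)"
        using \<alpha> m fD(1) k_central[OF \<alpha>(1), of "x i"] by (simp flip: N.smult_assoc1)
      then show "?a p i (\<alpha> \<odot>\<^bsub>?H\<^esub> f) m = (\<alpha> \<odot>\<^bsub>?H\<^esub> ?a p i f) m"
        using m fD \<alpha> by (simp add: val hom_module_simps(4) sign_def N.smult_r_distr smult_minus[OF N])
    qed
    show "?a p i (f \<oplus>\<^bsub>?H\<^esub> g) = ?a p i f \<oplus>\<^bsub>?H\<^esub> ?a p i g" if g: "g \<in> lin_hom scalars M N" for g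
    proof (rule lin_hom_eqI)
      show "?a p i (f \<oplus>\<^bsub>?H\<^esub> g) \<in> lin_hom scalars M N" "?a p i f \<oplus>\<^bsub>?H\<^esub> ?a p i g \<in> lin_hom scalars M N"
        using closed f g H.M.add.m_closed[unfolded hom_module_simps(1)] by simp_all
      note gD = lin_homD[OF g, simplified]
      fix m assume m: "m \<in> carrier M"
      then show "?a p i (f \<oplus>\<^bsub>?H\<^esub> g) m = (?a p i f \<oplus>\<^bsub>?H\<^esub> ?a p i g) m"
        using fD gD by (simp add: val hom_module_simps(3) sign_def N.smult_r_distr N.M.minus_add N.M.a_ac)
    qed
  qed
qed

end


section \<open>Dimension shifting\<close>

lemma lin_hom_factor:
  assumes F: "left_module R F" and M: "left_module R M" and N: "left_module R N"
    and h: "h \<in> lin_hom R F M" "h ` carrier F = carrier M"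
    and v: "v \<in> lin_hom R F N" "\<And>y. y \<in> a_kernel F M h \<Longrightarrow> v y = \<zero>\<^bsub>N\<^esub>"
  obtains u where "u \<in> lin_hom R M N" "\<And>y. y \<in> carrier F \<Longrightarrow> u (h y) = v y"
proof -
  interpret F: left_module R F by (rule F)
  interpret M: left_module R M by (rule M)
  interpret N: left_module R N by (rule N)
  define u where "u = (\<lambda>m\<in>carrier M. v (inv_into (carrier F) h m))"
  note hD = lin_homD[OF h(1)] and vD = lin_homD[OF v(1)]
  have wd: "v y = v y'" if "y \<in> carrier F" "y' \<in> carrier F" "h y = h y'" for y y'
  proof -
    have "y \<oplus>\<^bsub>F\<^esub> \<ominus>\<^bsub>F\<^esub> y' \<in> a_kernel F M h"
      using that hD by (simp add: a_kernel_def' lin_hom_minus[OF F M h(1)] M.M.r_neg)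
    from v(2)[OF this] have "v y \<oplus>\<^bsub>N\<^esub> \<ominus>\<^bsub>N\<^esub> v y' = \<zero>\<^bsub>N\<^esub>"
      using that vD by (simp add: lin_hom_minus[OF F N v(1)])
    then show ?thesis using that vD N.M.minus_equality[of "v y" "\<ominus>\<^bsub>N\<^esub> v y'"] by simp
  qed
  have uh: "u (h y) = v y" if "y \<in> carrier F" for y
  proof -
    have hy: "h y \<in> h ` carrier F" using that by blast
    show ?thesis
      using that hD(1) wd[OF inv_into_into[OF hy] that f_inv_into_f[OF hy]] by (simp add: u_def)
  qed
  have lift: "\<exists>y\<in>carrier F. m = h y" if "m \<in> carrier M" for m using h(2) that by blast
  have "u \<in> lin_hom R M N"
  proof -
    have "u m \<in> carrier N" if "m \<in> carrier M" for m using lift[OF that] uh vD(1) by auto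
    moreover have "u (m \<oplus>\<^bsub>M\<^esub> m') = u m \<oplus>\<^bsub>N\<^esub> u m'" if mm: "m \<in> carrier M" "m' \<in> carrier M" for m m'
    proof -
      obtain y y' where y: "y \<in> carrier F" "m = h y" "y' \<in> carrier F" "m' = h y'"
        using lift[OF mm(1)] lift[OF mm(2)] by meson
      have "u (h (y \<oplus>\<^bsub>F\<^esub> y')) = v y \<oplus>\<^bsub>N\<^esub> v y'" using y vD(2) by (subst uh) auto
      then show ?thesis using y hD(2) uh by simp
    qed
    moreover have "u (a \<odot>\<^bsub>M\<^esub> m) = a \<odot>\<^bsub>N\<^esub> u m" if am: "a \<in> carrier R" "m \<in> carrier M" for a m
    proof -
      obtain y where y: "y \<in> carrier F" "m = h y" using lift[OF am(2)] by meson
      have "u (h (a \<odot>\<^bsub>F\<^esub> y)) = a \<odot>\<^bsub>N\<^esub> v y" using y am vD(3) by (subst uh) auto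
      then show ?thesis using y am hD(3) uh by simp
    qed
    moreover have "u \<in> extensional (carrier M)" by (simp add: u_def)
    ultimately show ?thesis by (auto simp: lin_hom_def PiE_def)
  qed
  then show thesis using uh by (rule that)
qed

lemma lin_hom_comp:
  assumes "left_module R F" "h \<in> lin_hom R F M" "u \<in> lin_hom R M N"
  shows "(\<lambda>y\<in>carrier F. u (h y)) \<in> lin_hom R F N"
  by (rule restrict_lin_homI) (use assms lin_homD[OF assms(2)] lin_homD[OF assms(3)] in simp_all)

lemma a_kernel_submodule:
  assumes F: "left_module R F" and M: "left_module R M" and h: "h \<in> lin_hom R F M"
  shows "submodule_in R F (a_kernel F M h)"
proof -
  interpret F: left_module R F by (rule F)
  have "submodule_in R F {v \<in> carrier F. h v = \<zero>\<^bsub>M\<^esub>}"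
    by (rule F.submodule_in_kernel[OF M]) (use lin_homD[OF h] in \<open>auto simp: submodule_in_def\<close>)
  then show ?thesis by (simp add: a_kernel_def')
qed

lemma lin_hom_restrict_submodule:
  assumes "submodule_in R F V" "v \<in> lin_hom R F N"
  shows "restrict v V \<in> lin_hom R (F\<lparr>carrier := V\<rparr>) N"
proof -
  have "V \<subseteq> carrier F" using assms(1) by (simp add: submodule_in_def)
  then show ?thesis
    using assms(1) lin_homD[OF assms(2)] by (simp add: lin_hom_def submodule_in_def subset_iff)
qed

context exterior_ring
begin

abbreviation hom_exact :: "('a, 'm, 'y) module_scheme \<Rightarrow> ('a, 'n, 'z) module_scheme \<Rightarrow> nat \<Rightarrow> bool \<Rightarrow> nat \<Rightarrow> bool" where
  "hom_exact M N \<equiv> koszul.exact_at (hom_module scalars M N) (hom_action M N)"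

lemma hom_koszul:
  assumes "left_module A M" "left_module A N"
  shows "koszul (hom_module scalars M N) (hom_action M N)"
  using hom_koszul_module[OF assms] by (rule koszul_module.axioms)

lemma hom_action_eq_zero_iff:
  assumes M: "left_module A M" and N: "left_module A N" and f: "f \<in> lin_hom scalars M N"
  shows "hom_action M N p i f = \<zero>\<^bsub>hom_module scalars M N\<^esub> \<longleftrightarrow>
    (\<forall>m\<in>carrier M. x i \<odot>\<^bsub>N\<^esub> f m \<oplus>\<^bsub>N\<^esub> sign N p (f (x i \<odot>\<^bsub>M\<^esub> m)) = \<zero>\<^bsub>N\<^esub>)"
  by (auto simp: hom_action_def hom_module_simps fun_eq_iff restrict_def)

text \<open>
  Linear maps over the scalars are considered, which form a field, so every linear map on the syzygy extends
  to the whole module. This is where exactness at the right end comes from.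
\<close>

lemma hom_exact_sequence:
  assumes M: "left_module A M" and F: "left_module A F" and N: "left_module A N"
    and h: "h \<in> lin_hom A F M" "h ` carrier F = carrier M"
    and Z: "Z = F\<lparr>carrier := a_kernel F M h\<rparr>"
  shows "koszul_exact_sequence (hom_module scalars M N) (hom_action M N)
    (hom_module scalars F N) (hom_action F N) (hom_module scalars Z N) (hom_action Z N)
    (\<lambda>f. \<lambda>y\<in>carrier F. f (h y)) (\<lambda>f. restrict f (carrier Z))"
proof -
  interpret F: left_module A F by (rule F)
  interpret M: left_module A M by (rule M)
  interpret N: left_module A N by (rule N)
  have ZA: "left_module A Z" unfolding Z by (rule F.lin_hom_kernel_left_module[OF M h(1)])
  interpret Z: left_module A Z by (rule ZA)
  note Mk = scalars_left_module[OF M] and Fk = scalars_left_module[OF F]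
    and Nk = scalars_left_module[OF N] and Zk = scalars_left_module[OF ZA]
  interpret Fk: left_module scalars F by (rule Fk)
  have hk: "h \<in> lin_hom scalars F M" by (rule lin_hom_scalars[OF h(1)])
  have V: "submodule_in scalars F (a_kernel F M h)" by (rule a_kernel_submodule[OF Fk Mk hk])
  have ZF: "carrier Z \<subseteq> carrier F" "carrier Z = a_kernel F M h" by (auto simp: Z a_kernel_def')
  have Z_ops: "a \<odot>\<^bsub>Z\<^esub> y = a \<odot>\<^bsub>F\<^esub> y" "y \<oplus>\<^bsub>Z\<^esub> z = y \<oplus>\<^bsub>F\<^esub> z" for a y z by (simp_all add: Z)
  let ?P = "\<lambda>f. \<lambda>y\<in>carrier F. f (h y)" and ?R = "\<lambda>f. restrict f (carrier Z)"
  have P: "?P u \<in> lin_hom scalars F N" if "u \<in> lin_hom scalars M N" for u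
    by (rule lin_hom_comp[OF Fk hk that])
  have R: "?R v \<in> lin_hom scalars Z N" if "v \<in> lin_hom scalars F N" for v
    using lin_hom_restrict_submodule[OF V that] by (simp add: Z)
  show ?thesis
  proof (intro koszul_exact_sequence.intro koszul_exact_sequence_axioms.intro hom_koszul M N F ZA)
    show "?P \<in> hom (add_monoid (hom_module scalars M N)) (add_monoid (hom_module scalars F N))"
      using P lin_homD(1)[OF h(1)] by (auto simp: hom_def hom_module_simps fun_eq_iff)
    show "?R \<in> hom (add_monoid (hom_module scalars F N)) (add_monoid (hom_module scalars Z N))"
      using R ZF(1) by (auto simp: hom_def hom_module_simps fun_eq_iff)
    show "?P (hom_action M N p i u) = hom_action F N p i (?P u)" for p i u
      using lin_homD(1,3)[OF h(1)] by (auto simp: hom_action_def fun_eq_iff)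
    show "?R (hom_action F N p i v) = hom_action Z N p i (?R v)" for p i v
    proof
      fix y
      have "x i \<odot>\<^bsub>F\<^esub> y \<in> carrier Z" if "y \<in> carrier Z"
        using Z.smult_closed[of "x i" y] that by (simp add: Z_ops)
      then show "?R (hom_action F N p i v) y = hom_action Z N p i (?R v) y"
        using ZF(1) by (auto simp: hom_action_def Z_ops)
    qed
    show "inj_on ?P (carrier (hom_module scalars M N))"
    proof (rule inj_onI, unfold hom_module_simps(1))
      fix u u' assume u: "u \<in> lin_hom scalars M N" "u' \<in> lin_hom scalars M N" and eq: "?P u = ?P u'"
      show "u = u'"
      proof (rule lin_hom_eqI[OF u])
        fix m assume "m \<in> carrier M"
        then obtain y where y: "y \<in> carrier F" "m = h y" using h(2) by auto
        then show "u m = u' m" using fun_cong[OF eq, of y] by simp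
      qed
    qed
    show "?R v = \<zero>\<^bsub>hom_module scalars Z N\<^esub> \<longleftrightarrow> v \<in> ?P ` carrier (hom_module scalars M N)"
      if "v \<in> carrier (hom_module scalars F N)" for v
    proof
      have v: "v \<in> lin_hom scalars F N" using that by (simp add: hom_module_simps)
      assume eq: "?R v = \<zero>\<^bsub>hom_module scalars Z N\<^esub>"
      have "v y = \<zero>\<^bsub>N\<^esub>" if "y \<in> a_kernel F M h" for y
        using fun_cong[OF eq, of y] that by (simp add: hom_module_simps ZF(2))
      then obtain u where u: "u \<in> lin_hom scalars M N" "\<And>y. y \<in> carrier F \<Longrightarrow> u (h y) = v y"
        by (rule lin_hom_factor[OF Fk Mk Nk hk h(2) v]) (assumption, rule that)
      have "v = ?P u"
        by (rule lin_hom_eqI[OF v P[OF u(1)]]) (simp add: u(2))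
      then show "v \<in> ?P ` carrier (hom_module scalars M N)"
        using u(1) by (simp add: hom_module_simps)
    next
      assume "v \<in> ?P ` carrier (hom_module scalars M N)"
      then obtain u where u: "u \<in> lin_hom scalars M N" "v = ?P u" by (auto simp: hom_module_simps)
      then show "?R v = \<zero>\<^bsub>hom_module scalars Z N\<^esub>"
        using lin_hom_zero[OF Mk Nk u(1)] by (auto simp: hom_module_simps fun_eq_iff ZF(2) a_kernel_def')
    qed
    show "?R ` carrier (hom_module scalars F N) = carrier (hom_module scalars Z N)"
    proof (intro equalityI subsetI)
      fix w assume "w \<in> carrier (hom_module scalars Z N)"
      then have w: "w \<in> lin_hom scalars Z N" by (simp add: hom_module_simps)
      have "\<exists>g\<in>lin_hom scalars F N. \<forall>v\<in>a_kernel F M h. g v = w v"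
        using scalars_inverse w unfolding Z by (intro Fk.extend_linear_map[OF Nk _ V])
      then obtain g where g: "g \<in> lin_hom scalars F N" "\<forall>v\<in>carrier Z. g v = w v" unfolding ZF(2) by blast
      have "w = ?R g" by (rule lin_hom_eqI[OF w R[OF g(1)]]) (simp add: g(2))
      then show "w \<in> ?R ` carrier (hom_module scalars F N)" using g(1) by (simp add: hom_module_simps)
    qed (use R in \<open>auto simp: hom_module_simps\<close>)
  qed
qed

lemma contraction_zero [simp]: "contraction j \<zero> = \<zero>"
  using contraction_add[of \<zero> \<zero> j] by (metis add.r_cancel_one contraction_closed l_zero zero_closed)

text \<open>
  Composition with the contraction \<open>\<partial>\<^sub>j\<close> in each coordinate is a homotopy for the operators with index \<open>j\<close>: if \<open>u\<close> is killed by
  the operators of sign \<open>p\<close> with indices up to \<open>j\<close>, then \<open>\<plusminus> u \<partial>\<^sub>j\<close> is killed by those of the opposite sign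
  with indices below \<open>j\<close>, and the one with index \<open>j\<close> sends it back to \<open>u\<close>.
\<close>

lemma free_module_hom_exact:
  fixes B :: "'b set"
  assumes N: "left_module A N" and "j \<le> c" "n > 0"
  shows "hom_exact (free_module A B) N j p n"
  using assms(2,3)
proof (induction j arbitrary: p n)
  case 0
  interpret N: left_module A N by (rule N)
  interpret Ko: koszul "hom_module scalars (free_module A B) N" "hom_action (free_module A B) N"
    by (rule hom_koszul[OF free_module_left_module N])
  from 0 have "monomials 0 n = {}" by (auto simp: monomials_def)
  then show ?case by (auto simp: Ko.exact_at_def Ko.coboundary_def)
next
  case (Suc j)
  let ?F = "free_module A B"
  have F: "left_module A ?F" by (rule free_module_left_module)
  interpret F: left_module A ?F by (rule F)
  interpret N: left_module A N by (rule N)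
  note Fk = scalars_left_module[OF F] and Nk = scalars_left_module[OF N]
  interpret Ko: koszul "hom_module scalars ?F N" "hom_action ?F N" by (rule hom_koszul[OF F N])
  define \<delta> where "\<delta> f = (\<lambda>b. contraction j (f b))" for f :: "'b \<Rightarrow> 'a"
  have \<delta>_cl: "\<delta> f \<in> carrier ?F" if "f \<in> carrier ?F" for f
  proof -
    have "{b. \<delta> f b \<noteq> \<zero>} \<subseteq> {b. f b \<noteq> \<zero>}" by (auto simp: \<delta>_def)
    with that show ?thesis by (auto simp: free_module_simps \<delta>_def intro: finite_subset)
  qed
  have \<delta>_add: "\<delta> (f \<oplus>\<^bsub>?F\<^esub> g) = \<delta> f \<oplus>\<^bsub>?F\<^esub> \<delta> g" if "f \<in> carrier ?F" "g \<in> carrier ?F" for f g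
    using that by (simp add: free_module_simps \<delta>_def contraction_add)
  have \<delta>_sm: "\<delta> (\<alpha> \<odot>\<^bsub>?F\<^esub> f) = \<alpha> \<odot>\<^bsub>?F\<^esub> \<delta> f" if "f \<in> carrier ?F" "\<alpha> \<in> k" for f \<alpha>
    using that by (simp add: free_module_simps \<delta>_def contraction_smult)
  have \<delta>_x: "\<delta> (x i \<odot>\<^bsub>?F\<^esub> f) \<oplus>\<^bsub>?F\<^esub> x i \<odot>\<^bsub>?F\<^esub> \<delta> f = (if i = j then f else \<zero>\<^bsub>?F\<^esub>)"
    if "f \<in> carrier ?F" "i \<le> j" for f i
    using that Suc.prems(1) by (auto simp: free_module_simps \<delta>_def contraction_x)
  show ?case
  proof (rule Ko.exact_at_more_variables[OF _ _ \<open>n > 0\<close>])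
    show "hom_exact ?F N j p n" if "n > 0" for p n using Suc that by simp
    fix p u assume "u \<in> carrier (hom_module scalars ?F N)"
      and zero: "\<And>i. i \<le> j \<Longrightarrow> hom_action ?F N p i u = \<zero>\<^bsub>hom_module scalars ?F N\<^esub>"
    then have u: "u \<in> lin_hom scalars ?F N" by (simp add: hom_module_simps)
    note uD = lin_homD[OF u, simplified]
    define v where "v = (\<lambda>f\<in>carrier ?F. sign N (\<not> p) (u (\<delta> f)))"
    have v: "v \<in> lin_hom scalars ?F N"
      unfolding v_def
      by (rule restrict_lin_homI[OF _ _ _ Fk])
        (use uD \<delta>_cl in \<open>simp_all add: sign_def \<delta>_add \<delta>_sm N.M.minus_add smult_minus[OF N] k_closed\<close>)
    have hv: "hom_action ?F N (\<not> p) i v f = (if i = j then u f else \<zero>\<^bsub>N\<^esub>)"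
      if i: "i \<le> j" and f: "f \<in> carrier ?F" for i f
    proof -
      define s where "s = x i \<odot>\<^bsub>N\<^esub> u (\<delta> f)"
      define t where "t = u (x i \<odot>\<^bsub>?F\<^esub> \<delta> f)"
      define w where "w = u (if i = j then f else \<zero>\<^bsub>?F\<^esub>)"
      define r where "r = u (\<delta> (x i \<odot>\<^bsub>?F\<^esub> f))"
      have cl: "s \<in> carrier N" "t \<in> carrier N" "r \<in> carrier N" "w \<in> carrier N"
        using uD(1) \<delta>_cl f by (simp_all add: s_def t_def r_def w_def)
      have w: "w = r \<oplus>\<^bsub>N\<^esub> t"
        unfolding w_def \<delta>_x[OF f i, symmetric] r_def t_def using f \<delta>_cl by (intro uD) auto
      have "s \<oplus>\<^bsub>N\<^esub> sign N p t = \<zero>\<^bsub>N\<^esub>"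
        using zero[OF i] \<delta>_cl[OF f] unfolding hom_action_eq_zero_iff[OF F N u] s_def t_def by blast
      then have "s = sign N (\<not> p) t"
        using cl N.M.minus_equality[of s "sign N p t"] by (auto simp: sign_def split: if_splits)
      moreover have "hom_action ?F N (\<not> p) i v f = x i \<odot>\<^bsub>N\<^esub> sign N (\<not> p) (u (\<delta> f)) \<oplus>\<^bsub>N\<^esub> sign N (\<not> p) (sign N (\<not> p) r)"
        using f by (simp add: hom_action_def v_def r_def)
      ultimately have "hom_action ?F N (\<not> p) i v f = t \<oplus>\<^bsub>N\<^esub> r"
        using cl uD(1) \<delta>_cl[OF f] by (auto simp: sign_def smult_minus[OF N] simp flip: s_def)
      also have "\<dots> = w" using w cl by (simp add: N.M.a_comm)
      finally show ?thesis using lin_hom_zero[OF Fk Nk u] by (simp add: w_def)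
    qed
    show "\<exists>v\<in>carrier (hom_module scalars ?F N).
        (\<forall>i<j. hom_action ?F N (\<not> p) i v = \<zero>\<^bsub>hom_module scalars ?F N\<^esub>) \<and> hom_action ?F N (\<not> p) j v = u"
    proof (intro bexI[of _ v] conjI allI impI)
      fix i assume "i < j"
      then show "hom_action ?F N (\<not> p) i v = \<zero>\<^bsub>hom_module scalars ?F N\<^esub>"
        using hv[of i] by (auto simp: hom_module_simps hom_action_def fun_eq_iff restrict_def)
    next
      show "hom_action ?F N (\<not> p) j v = u"
        using hv[of j] uD(4) by (auto simp: hom_action_def fun_eq_iff restrict_def)
    qed (use v in \<open>simp add: hom_module_simps\<close>)
  qed
qed

text \<open>
  The second part is the start of the dimension shift: with sign \<open>False\<close> the invariants among the
  scalar-linear maps are the maps that commute with the generators, that is, the module homomorphisms.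
\<close>

lemma hom_exact_syzygy:
  fixes B :: "'b set"
  assumes M: "left_module A M" and N: "left_module A N"
    and h: "h \<in> lin_hom A (free_module A B) M" "h ` carrier (free_module A B) = carrier M"
    and Z: "Z = (free_module A B)\<lparr>carrier := a_kernel (free_module A B) M h\<rparr>"
  shows "n > 0 \<Longrightarrow> hom_exact Z N c p n \<longleftrightarrow> hom_exact M N c (\<not> p) (Suc n)"
    and "hom_exact M N c True 1 \<longleftrightarrow>
      (\<forall>f\<in>lin_hom A Z N. \<exists>g\<in>lin_hom A (free_module A B) N. \<forall>z\<in>carrier Z. g z = f z)"
proof -
  let ?F = "free_module A B"
  have F: "left_module A ?F" by (rule free_module_left_module)
  interpret F: left_module A ?F by (rule F)
  interpret N: left_module A N by (rule N)
  have ZA: "left_module A Z" unfolding Z by (rule F.lin_hom_kernel_left_module[OF M h(1)])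
  interpret Z: left_module A Z by (rule ZA)
  interpret koszul_exact_sequence "hom_module scalars M N" "hom_action M N"
    "hom_module scalars ?F N" "hom_action ?F N" "hom_module scalars Z N" "hom_action Z N"
    "\<lambda>f. \<lambda>y\<in>carrier ?F. f (h y)" "\<lambda>f. restrict f (carrier Z)"
    by (rule hom_exact_sequence[OF M F N h Z])
  note ex = free_module_hom_exact[OF N order_refl, of _ B]
  show "hom_exact Z N c p n \<longleftrightarrow> hom_exact M N c (\<not> p) (Suc n)" if "n > 0"
    using exact_at_shift_down[OF ex[OF that]] exact_at_shift_up[OF ex[OF zero_less_Suc]] by blast
  have inv: "w \<in> carrier (hom_module scalars M' N) \<and>
      (\<forall>i<c. hom_action M' N False i w = \<zero>\<^bsub>hom_module scalars M' N\<^esub>) \<longleftrightarrow> w \<in> lin_hom A M' N"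
    if M': "left_module A M'" for w and M' :: "('a, 'b \<Rightarrow> 'a) module"
  proof -
    interpret M': left_module A M' by (rule M')
    have "x i \<odot>\<^bsub>N\<^esub> w m \<oplus>\<^bsub>N\<^esub> sign N False (w (x i \<odot>\<^bsub>M'\<^esub> m)) = \<zero>\<^bsub>N\<^esub> \<longleftrightarrow> w (x i \<odot>\<^bsub>M'\<^esub> m) = x i \<odot>\<^bsub>N\<^esub> w m"
      if "w \<in> lin_hom scalars M' N" "m \<in> carrier M'" for i m
    proof -
      have "x i \<odot>\<^bsub>N\<^esub> w m \<in> carrier N" "w (x i \<odot>\<^bsub>M'\<^esub> m) \<in> carrier N"
        using lin_homD(1)[OF that(1)] that(2) by simp_all
      then show ?thesis
        using N.M.minus_equality[of "x i \<odot>\<^bsub>N\<^esub> w m" "\<ominus>\<^bsub>N\<^esub> (w (x i \<odot>\<^bsub>M'\<^esub> m))"]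
        by (auto simp: sign_def N.M.r_neg)
    qed
    then show ?thesis
      unfolding lin_hom_iff_commutes[OF M' N] hom_module_simps(1)
      using hom_action_eq_zero_iff[OF M' N, of w False] by blast
  qed
  have "hom_exact M N c True 1 \<longleftrightarrow> (\<forall>w. w \<in> carrier (hom_module scalars Z N) \<and>
      (\<forall>i<c. hom_action Z N False i w = \<zero>\<^bsub>hom_module scalars Z N\<^esub>) \<longrightarrow>
      (\<exists>v. (v \<in> carrier (hom_module scalars ?F N) \<and>
        (\<forall>i<c. hom_action ?F N False i v = \<zero>\<^bsub>hom_module scalars ?F N\<^esub>)) \<and> restrict v (carrier Z) = w))"
    using exact_at_one_iff_lift_invariants[of c False] ex[of 1 True]
    by (simp add: Ball_def Bex_def conj_assoc imp_conjL)
  also have "\<dots> \<longleftrightarrow> (\<forall>f\<in>lin_hom A Z N. \<exists>g\<in>lin_hom A ?F N. restrict g (carrier Z) = f)"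
    unfolding inv[OF ZA] inv[OF F] Ball_def Bex_def ..
  also have "\<dots> \<longleftrightarrow> (\<forall>f\<in>lin_hom A Z N. \<exists>g\<in>lin_hom A ?F N. \<forall>z\<in>carrier Z. g z = f z)"
  proof -
    have "restrict g (carrier Z) = f \<longleftrightarrow> (\<forall>z\<in>carrier Z. g z = f z)" if "f \<in> lin_hom A Z N" for f g
      using lin_homD(4)[OF that] by (auto simp: fun_eq_iff restrict_def)
    then show ?thesis by blast
  qed
  finally show "hom_exact M N c True 1 \<longleftrightarrow>
      (\<forall>f\<in>lin_hom A Z N. \<exists>g\<in>lin_hom A ?F N. \<forall>z\<in>carrier Z. g z = f z)" .
qed

end


section \<open>Cohomology and syzygies\<close>

definition syzygy ::
    "('r, 'x) ring_scheme \<Rightarrow> ('r, 'm, 'y) module_scheme \<Rightarrow> (nat \<Rightarrow> 'b set) \<Rightarrow>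
      (nat \<Rightarrow> ('b \<Rightarrow> 'r) \<Rightarrow> ('b \<Rightarrow> 'r)) \<Rightarrow> (('b \<Rightarrow> 'r) \<Rightarrow> 'm) \<Rightarrow> nat \<Rightarrow> ('r, 'b \<Rightarrow> 'r) module" where
  "syzygy R M B d \<epsilon> n = (free_module R (B n))\<lparr>carrier :=
    (case n of 0 \<Rightarrow> a_kernel (free_module R (B 0)) M \<epsilon>
     | Suc m \<Rightarrow> a_kernel (free_module R (B n)) (free_module R (B m)) (d m))\<rparr>"

lemma trivial_group_Mod_iff:
  assumes C: "comm_group C" and Z: "subgroup Z C" and B: "subgroup B C" "B \<subseteq> Z"
  shows "trivial_group (C\<lparr>carrier := Z\<rparr> Mod B) \<longleftrightarrow> Z \<subseteq> B"
proof -
  let ?G = "C\<lparr>carrier := Z\<rparr>"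
  interpret C: comm_group C by (rule C)
  interpret G: comm_group ?G
  proof (rule group.group_comm_groupI)
    show "Group.group ?G" by (rule subgroup.subgroup_is_group[OF Z C.is_group])
    show "a \<otimes>\<^bsub>?G\<^esub> b = b \<otimes>\<^bsub>?G\<^esub> a" if "a \<in> carrier ?G" "b \<in> carrier ?G" for a b
      using that subgroup.subset[OF Z] by (auto intro: C.m_comm)
  qed
  have B': "subgroup B ?G" by (rule C.subgroup_incl[OF B(1) Z B(2)])
  have "comm_group (?G Mod B)" by (rule G.abelian_FactGroup[OF B'])
  then have "Group.group (?G Mod B)" by (rule comm_group.axioms)
  then have "trivial_group (?G Mod B) \<longleftrightarrow> rcosets\<^bsub>?G\<^esub> B = {B}"
    by (simp add: trivial_group_def FactGroup_def)
  also have "\<dots> \<longleftrightarrow> Z \<subseteq> B"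
  proof
    assume *: "rcosets\<^bsub>?G\<^esub> B = {B}"
    show "Z \<subseteq> B"
    proof
      fix z assume z: "z \<in> Z"
      then have "B #>\<^bsub>?G\<^esub> z \<in> rcosets\<^bsub>?G\<^esub> B" by (auto simp: RCOSETS_def)
      with * have "B #>\<^bsub>?G\<^esub> z = B" by simp
      with G.rcos_self[of z, OF _ B'] z show "z \<in> B" by simp
    qed
  next
    assume "Z \<subseteq> B"
    then have "B #>\<^bsub>?G\<^esub> z = B" if "z \<in> Z" for z
      using that by (intro G.coset_join2[OF _ B']) auto
    moreover have "Z \<noteq> {}" using subgroup.one_closed[OF Z] by blast
    ultimately show "rcosets\<^bsub>?G\<^esub> B = {B}" by (auto simp: RCOSETS_def)
  qed
  finally show ?thesis .
qed

context
  fixes R :: "('r, 'x) ring_scheme" and M :: "('r, 'm, 'y) module_scheme" and N :: "('r, 'n, 'z) module_scheme"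
    and B :: "nat \<Rightarrow> 'b set" and d \<epsilon>
  assumes M: "left_module R M" and N: "left_module R N" and res: "free_resolution R M B d \<epsilon>"
begin

interpretation M: left_module R M by (rule M)
interpretation N: left_module R N by (rule N)

private abbreviation "F n \<equiv> free_module R (B n)"
private abbreviation "Z n \<equiv> syzygy R M B d \<epsilon> n"

lemma resolution_facts:
  shows "\<epsilon> \<in> lin_hom R (F 0) M" "\<epsilon> ` carrier (F 0) = carrier M"
    and "d n \<in> lin_hom R (F (Suc n)) (F n)" "d n ` carrier (F (Suc n)) = carrier (Z n)"
  using res unfolding free_resolution_def Let_def syzygy_def by (auto split: nat.split)

lemma syzygy_Suc: "Z (Suc n) = (F (Suc n))\<lparr>carrier := a_kernel (F (Suc n)) (Z n) (d n)\<rparr>"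
  by (simp add: syzygy_def a_kernel_def')

lemma syzygy_left_module: "left_module R (Z n)"
proof (cases n)
  case 0
  interpret F: left_module R "F 0" by (rule M.R.free_module_left_module)
  show ?thesis using F.lin_hom_kernel_left_module[OF M resolution_facts(1)] 0 by (simp add: syzygy_def)
next
  case (Suc m)
  interpret F: left_module R "F (Suc m)" by (rule M.R.free_module_left_module)
  show ?thesis
    using F.lin_hom_kernel_left_module[OF M.R.free_module_left_module resolution_facts(3)] Suc
    by (simp add: syzygy_def)
qed

lemma resolution_onto_syzygy: "d n \<in> lin_hom R (F (Suc n)) (Z n)"
proof -
  have "d n y \<in> carrier (Z n)" if "y \<in> carrier (F (Suc n))" for y
    using resolution_facts(4)[of n] that by blast
  then show ?thesis
    using resolution_facts(3)[of n] by (simp add: lin_hom_def PiE_iff syzygy_def)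
qed

text \<open>
  A cocycle vanishes on the next syzygy, hence factors through a homomorphism defined on \<open>syzygy n\<close>; it is a
  coboundary precisely if this homomorphism extends to the free module of degree \<open>n\<close>.
\<close>

lemma cohomology_trivial_iff:
  "trivial_group (cohomology R B d N (Suc n)) \<longleftrightarrow>
    (\<forall>f\<in>lin_hom R (Z n) N. \<exists>g\<in>lin_hom R (F n) N. \<forall>z\<in>carrier (Z n). g z = f z)"
proof -
  let ?C = "\<lambda>n. cochains R B N n"
  have F: "left_module R (F n)" for n by (rule M.R.free_module_left_module)
  have C: "comm_group (?C n)" for n unfolding cochains_def by (rule hom_group_comm_group[OF F N])
  then have Cg: "Group.group (?C n)" for n by (rule comm_group.axioms)
  note dD = lin_homD[OF resolution_facts(3)]
  have cb: "coboundary R B d n f = (\<lambda>y\<in>carrier (F (Suc n)). f (d n y))" for n f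
    by (simp add: coboundary_def compose_def)
  have cb_hom: "group_hom (?C n) (?C (Suc n)) (coboundary R B d n)" for n
  proof (intro group_hom.intro group_hom_axioms.intro homI Cg)
    fix f g assume f: "f \<in> carrier (?C n)" "g \<in> carrier (?C n)"
    show "coboundary R B d n (f \<otimes>\<^bsub>?C n\<^esub> g) = coboundary R B d n f \<otimes>\<^bsub>?C (Suc n)\<^esub> coboundary R B d n g"
      using dD(1) by (auto simp: cb cochains_def hom_group_def)
    show "coboundary R B d n f \<in> carrier (?C (Suc n))"
      using lin_hom_comp[OF F resolution_facts(3)] f(1) by (simp add: cb cochains_def hom_group_def)
  qed
  have B': "coboundaries R B d N (Suc n) = coboundary R B d n ` lin_hom R (F n) N"
    by (simp add: coboundaries_def cochains_def hom_group_def)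
  have "f y = \<zero>\<^bsub>N\<^esub>" if f: "f \<in> cocycles R B d N (Suc n)" and y: "y \<in> carrier (Z (Suc n))" for f y
  proof -
    obtain y' where y': "y' \<in> carrier (F (Suc (Suc n)))" "y = d (Suc n) y'"
      using y resolution_facts(4)[of "Suc n"] by blast
    have "coboundary R B d (Suc n) f y' = \<zero>\<^bsub>N\<^esub>"
      using f y'(1) by (simp add: cocycles_def kernel_def cochains_def hom_group_def)
    with y' show ?thesis by (simp add: cb)
  qed
  moreover have "f \<in> cocycles R B d N (Suc n)" if "f \<in> lin_hom R (F (Suc n)) N" "\<And>y. y \<in> carrier (Z (Suc n)) \<Longrightarrow> f y = \<zero>\<^bsub>N\<^esub>" for f
    using that resolution_facts(4)[of "Suc n"]
    by (auto simp: cocycles_def kernel_def cb cochains_def hom_group_def fun_eq_iff)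
  moreover have "cocycles R B d N (Suc n) \<subseteq> lin_hom R (F (Suc n)) N"
    by (auto simp: cocycles_def kernel_def cochains_def hom_group_def)
  ultimately have Z': "f \<in> cocycles R B d N (Suc n) \<longleftrightarrow>
      f \<in> lin_hom R (F (Suc n)) N \<and> (\<forall>y\<in>carrier (Z (Suc n)). f y = \<zero>\<^bsub>N\<^esub>)" for f by blast
  have kerZ: "y \<in> carrier (Z (Suc n)) \<longleftrightarrow> y \<in> a_kernel (F (Suc n)) (Z n) (d n)" for y
    by (simp add: syzygy_Suc)
  have pull: "(\<lambda>y\<in>carrier (F (Suc n)). f (d n y)) \<in> cocycles R B d N (Suc n)" if f: "f \<in> lin_hom R (Z n) N" for f
  proof -
    have "(\<lambda>y\<in>carrier (F (Suc n)). f (d n y)) \<in> lin_hom R (F (Suc n)) N"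
      by (rule lin_hom_comp[OF F resolution_onto_syzygy f])
    then show ?thesis
      unfolding Z' using lin_hom_zero[OF syzygy_left_module N f] by (auto simp: kerZ a_kernel_def')
  qed
  have "coboundaries R B d N (Suc n) \<subseteq> cocycles R B d N (Suc n)"
  proof
    fix h assume "h \<in> coboundaries R B d N (Suc n)"
    then obtain g where g: "g \<in> lin_hom R (F n) N" "h = coboundary R B d n g" unfolding B' by blast
    have "d n y = \<zero>\<^bsub>F n\<^esub>" if "y \<in> carrier (Z (Suc n))" for y
      using that by (simp add: syzygy_def a_kernel_def')
    then show "h \<in> cocycles R B d N (Suc n)"
      unfolding Z' g(2) cb using lin_hom_comp[OF F resolution_facts(3) g(1)] lin_hom_zero[OF F N g(1)]
      by (auto simp: kerZ a_kernel_def')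
  qed
  then have "trivial_group (cohomology R B d N (Suc n)) \<longleftrightarrow>
      cocycles R B d N (Suc n) \<subseteq> coboundaries R B d N (Suc n)"
    unfolding cohomology_def
    by (intro trivial_group_Mod_iff C)
      (simp_all add: cocycles_def coboundaries_def group_hom.subgroup_kernel[OF cb_hom] group_hom.img_is_subgroup[OF cb_hom])
  also have "\<dots> \<longleftrightarrow> (\<forall>f\<in>lin_hom R (Z n) N. \<exists>g\<in>lin_hom R (F n) N. \<forall>z\<in>carrier (Z n). g z = f z)"
  proof safe
    fix f assume *: "cocycles R B d N (Suc n) \<subseteq> coboundaries R B d N (Suc n)" and f: "f \<in> lin_hom R (Z n) N"
    from pull[OF f] * obtain g where g: "g \<in> lin_hom R (F n) N"
      "(\<lambda>y\<in>carrier (F (Suc n)). f (d n y)) = coboundary R B d n g" unfolding B' by blast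
    have "g z = f z" if z: "z \<in> carrier (Z n)" for z
    proof -
      obtain y where y: "y \<in> carrier (F (Suc n))" "z = d n y" using z resolution_facts(4)[of n] by blast
      with fun_cong[OF g(2), of y] show ?thesis by (simp add: cb)
    qed
    with g(1) show "\<exists>g\<in>lin_hom R (F n) N. \<forall>z\<in>carrier (Z n). g z = f z" by blast
  next
    fix f assume *: "\<forall>f\<in>lin_hom R (Z n) N. \<exists>g\<in>lin_hom R (F n) N. \<forall>z\<in>carrier (Z n). g z = f z"
      and "f \<in> cocycles R B d N (Suc n)"
    then have f: "f \<in> lin_hom R (F (Suc n)) N" "\<And>y. y \<in> a_kernel (F (Suc n)) (Z n) (d n) \<Longrightarrow> f y = \<zero>\<^bsub>N\<^esub>"
      unfolding Z' by (auto simp: kerZ)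
    obtain u where u: "u \<in> lin_hom R (Z n) N" "\<And>y. y \<in> carrier (F (Suc n)) \<Longrightarrow> u (d n y) = f y"
      by (rule lin_hom_factor[OF F syzygy_left_module N resolution_onto_syzygy resolution_facts(4) f]) (assumption, rule that)
    with * obtain g where g: "g \<in> lin_hom R (F n) N" "\<And>z. z \<in> carrier (Z n) \<Longrightarrow> g z = u z" by blast
    have "f = coboundary R B d n g"
      unfolding cb
    proof
      fix y
      have "d n y \<in> carrier (Z n)" if "y \<in> carrier (F (Suc n))" using resolution_facts(4)[of n] that by blast
      then show "f y = (\<lambda>y\<in>carrier (F (Suc n)). g (d n y)) y"
        using g(2) u(2) lin_homD(4)[OF f(1), of y] by auto
    qed
    then show "f \<in> coboundaries R B d N (Suc n)" unfolding B' using g(1) by blast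
  qed
  finally show ?thesis .
qed

end


section \<open>The vanishing dichotomy over exterior rings\<close>

context exterior_ring
begin

text \<open>
  Both sides shift dimension along the resolution, down to degree one of a syzygy. Each step changes the
  sign, so cohomology of degree \<open>n\<close> corresponds to the sign given by the parity of \<open>n\<close>.
\<close>

lemma cohomology_trivial_iff_hom_exact:
  fixes M :: "('a, 'm, 'y) module_scheme" and B :: "nat \<Rightarrow> 'b set"
  assumes M: "left_module A M" and N: "left_module A N" and res: "free_resolution A M B d \<epsilon>"
  shows "trivial_group (cohomology A B d N (Suc n)) \<longleftrightarrow> hom_exact M N c (odd (Suc n)) (Suc n)"
proof -
  let ?Z = "syzygy A M B d \<epsilon>"
  note rf = resolution_facts[OF M N res]
  have Z0: "?Z 0 = (free_module A (B 0))\<lparr>carrier := a_kernel (free_module A (B 0)) M \<epsilon>\<rparr>"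
    by (simp add: syzygy_def)
  have Z: "left_module A (?Z n)" for n by (rule syzygy_left_module[OF M N res])
  note first = hom_exact_syzygy[OF M N rf(1,2) Z0]
    and step = hom_exact_syzygy[OF Z N resolution_onto_syzygy[OF M N res] rf(4) syzygy_Suc[OF M N res]]
  have shift: "hom_exact (?Z m) N c (odd n) n \<longleftrightarrow> hom_exact M N c (odd (n + Suc m)) (n + Suc m)" if "n > 0" for m n
    using that
  proof (induction m arbitrary: n)
    case 0
    then show ?case using first(1)[of n "odd n"] by simp
  next
    case (Suc m)
    then show ?case using step(1)[of n m "odd n"] Suc.IH[of "Suc n"] by simp
  qed
  show ?thesis
  proof (cases n)
    case 0
    then show ?thesis
      using first(2) cohomology_trivial_iff[OF M N res, of 0] by simp
  next
    case (Suc m)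
    then show ?thesis
      using step(2)[of m] shift[of 1 m] cohomology_trivial_iff[OF M N res, of n] by simp
  qed
qed

primrec word :: "nat list \<Rightarrow> 'a" where
  "word [] = \<one>"
| "word (i # w) = x i \<otimes> word w"

lemma word_closed [simp]: "word w \<in> carrier A"
  by (induction w) auto

lemma x_word_eq_zero: "i \<in> set w \<Longrightarrow> x i \<otimes> word w = \<zero>"
proof (induction w)
  case (Cons j w)
  show ?case
  proof (cases "i = j")
    case True
    then show ?thesis using x_square[of j] by (simp flip: m_assoc)
  next
    case False
    have "x i \<otimes> x j = \<ominus> (x j \<otimes> x i)"
      by (rule minus_equality[symmetric]) (use x_anti[of i j] in auto)
    then have "x i \<otimes> (x j \<otimes> word w) = \<ominus> (x j \<otimes> (x i \<otimes> word w))"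
      by (simp add: l_minus flip: m_assoc)
    with False Cons show ?thesis by simp
  qed
qed simp

text \<open>
  Multiplying the given generators by the finitely many words without repeated letters yields a spanning
  list: a generator \<open>x\<^sub>i\<close> prolongs a word by a new letter or kills it.
\<close>

lemma finitely_generated_over_scalars:
  assumes M: "left_module A M" and fg: "finitely_generated_module A M"
  obtains ts where "set ts \<subseteq> carrier M" "carrier M \<subseteq> left_module.list_span scalars M ts"
proof -
  interpret M: left_module A M by (rule M)
  interpret Mk: left_module scalars M by (rule scalars_left_module[OF M])
  obtain S where S: "finite S" "S \<subseteq> carrier M"
    "\<And>m. m \<in> carrier M \<Longrightarrow> \<exists>a\<in>S \<rightarrow> carrier A. m = (\<Oplus>\<^bsub>M\<^esub>s\<in>S. a s \<odot>\<^bsub>M\<^esub> s)"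
    using fg unfolding finitely_generated_module_def by blast
  let ?W = "{w. set w \<subseteq> {..<c} \<and> distinct w}"
  have "finite ((\<lambda>(w, s). word w \<odot>\<^bsub>M\<^esub> s) ` (?W \<times> S))"
    using S(1) by (intro finite_imageI finite_cartesian_product finite_subset_distinct) auto
  then obtain ts where ts: "set ts = (\<lambda>(w, s). word w \<odot>\<^bsub>M\<^esub> s) ` (?W \<times> S)"
    using finite_list by blast
  have ts_M: "set ts \<subseteq> carrier M" using ts S(2) by auto
  let ?L = "Mk.list_span ts"
  have L: "submodule_in scalars M ?L" by (rule Mk.list_span_submodule[OF ts_M])
  have L': "?L \<subseteq> carrier M" "\<zero>\<^bsub>M\<^esub> \<in> ?L" "\<And>v w. v \<in> ?L \<Longrightarrow> w \<in> ?L \<Longrightarrow> v \<oplus>\<^bsub>M\<^esub> w \<in> ?L"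
    "\<And>\<alpha> v. \<alpha> \<in> k \<Longrightarrow> v \<in> ?L \<Longrightarrow> \<alpha> \<odot>\<^bsub>M\<^esub> v \<in> ?L"
    using L by (auto simp: submodule_in_def)
  have x_L: "x i \<odot>\<^bsub>M\<^esub> v \<in> ?L" if i: "i < c" and v: "v \<in> ?L" for i v
  proof -
    have "?L \<subseteq> {v \<in> carrier M. x i \<odot>\<^bsub>M\<^esub> v \<in> ?L}"
    proof (rule Mk.list_span_least)
      have "x i \<odot>\<^bsub>M\<^esub> (\<alpha> \<odot>\<^bsub>M\<^esub> v) = \<alpha> \<odot>\<^bsub>M\<^esub> (x i \<odot>\<^bsub>M\<^esub> v)" if "\<alpha> \<in> k" "v \<in> carrier M" for \<alpha> v
        using that k_closed k_central[OF that(1), of "x i"] by (simp flip: M.smult_assoc1)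
      then show "submodule_in scalars M {v \<in> carrier M. x i \<odot>\<^bsub>M\<^esub> v \<in> ?L}"
        using L' k_closed by (auto simp: submodule_in_def M.smult_zero_right M.smult_r_distr)
      show "set ts \<subseteq> {v \<in> carrier M. x i \<odot>\<^bsub>M\<^esub> v \<in> ?L}"
      proof (intro subsetI CollectI conjI)
        fix t assume t: "t \<in> set ts"
        then show "t \<in> carrier M" using ts_M by blast
        from t obtain w s where w: "t = word w \<odot>\<^bsub>M\<^esub> s" "set w \<subseteq> {..<c}" "distinct w" "s \<in> S"
          unfolding ts by auto
        have xt: "x i \<odot>\<^bsub>M\<^esub> t = word (i # w) \<odot>\<^bsub>M\<^esub> s" using w S(2) by (auto simp: M.smult_assoc1)
        show "x i \<odot>\<^bsub>M\<^esub> t \<in> ?L"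
        proof (cases "i \<in> set w")
          case True
          then show ?thesis using xt x_word_eq_zero[OF True] w(4) S(2) L'(2) by (auto simp: M.smult_zero_left)
        next
          case False
          then have "x i \<odot>\<^bsub>M\<^esub> t \<in> set ts" unfolding ts xt using w i by (intro image_eqI[of _ _ "(i # w, s)"]) auto
          then show ?thesis using Mk.list_span_superset[OF ts_M] by blast
        qed
      qed
    qed
    with v show ?thesis by blast
  qed
  have a_L: "a \<odot>\<^bsub>M\<^esub> s \<in> ?L" if s: "s \<in> S" and a: "a \<in> carrier A" for a s
  proof -
    have sM: "s \<in> carrier M" using s S(2) by blast
    show ?thesis using _ _ _ _ a
    proof (rule generated)
      have "\<one> \<odot>\<^bsub>M\<^esub> s \<in> set ts" unfolding ts using s by (intro image_eqI[of _ _ "([], s)"]) auto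
      then show "\<one> \<odot>\<^bsub>M\<^esub> s \<in> ?L" using Mk.list_span_superset[OF ts_M] by blast
    qed (use sM L' x_L k_closed in \<open>simp_all add: M.smult_l_distr M.smult_assoc1\<close>)
  qed
  have "carrier M \<subseteq> ?L"
  proof
    fix m assume "m \<in> carrier M"
    then obtain a where a: "a \<in> S \<rightarrow> carrier A" "m = (\<Oplus>\<^bsub>M\<^esub>s\<in>S. a s \<odot>\<^bsub>M\<^esub> s)" using S(3) by blast
    have "(\<Oplus>\<^bsub>M\<^esub>s\<in>T. a s \<odot>\<^bsub>M\<^esub> s) \<in> ?L" if "finite T" "T \<subseteq> S" for T
      using that
    proof (induction T)
      case (insert t T)
      have cl: "(\<lambda>s. a s \<odot>\<^bsub>M\<^esub> s) \<in> T \<rightarrow> carrier M" "a t \<odot>\<^bsub>M\<^esub> t \<in> carrier M"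
        using insert.prems a(1) S(2) by auto
      have "a t \<odot>\<^bsub>M\<^esub> t \<in> ?L" using insert.prems a(1) by (intro a_L) auto
      then show ?case using insert cl L'(3) by simp
    qed (use L' in simp)
    from this[OF S(1) order_refl] show "m \<in> ?L" unfolding a(2) .
  qed
  with ts_M show thesis by (rule that)
qed

text \<open>
  If neither parity is eventually nonvanishing, there is a vanishing group of each parity in
  arbitrarily high degree. By \<open>exactness_persists\<close> the Koszul cohomology of each sign
  then vanishes in all high degrees, including the degrees whose parity does not match the sign. So
  \<open>exact_at_if_eventually_exact\<close> applies, and everything vanishes in positive degrees.
\<close>

theorem ext_vanishing_dichotomy:
  fixes M :: "('a, 'm, 'y) module_scheme" and N :: "('a, 'n, 'z) module_scheme" and B :: "nat \<Rightarrow> 'b set"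
  assumes M: "left_module A M" "finitely_generated_module A M"
    and N: "left_module A N" "finitely_generated_module A N"
    and res: "free_resolution A M B d \<epsilon>"
  defines "E \<equiv> cohomology A B d N"
  shows "(\<forall>n>0. trivial_group (E n)) \<or>
    (\<exists>m0. (\<forall>n\<ge>m0. even n \<longrightarrow> \<not> trivial_group (E n)) \<or> (\<forall>n\<ge>m0. odd n \<longrightarrow> \<not> trivial_group (E n)))"
proof (rule disjCI)
  assume *: "\<not> (\<exists>m0. (\<forall>n\<ge>m0. even n \<longrightarrow> \<not> trivial_group (E n)) \<or>
    (\<forall>n\<ge>m0. odd n \<longrightarrow> \<not> trivial_group (E n)))"
  note Mk = scalars_left_module[OF M(1)] and Nk = scalars_left_module[OF N(1)]
  interpret Nk: left_module scalars N by (rule Nk)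
  interpret Ko: koszul_module scalars "hom_module scalars M N" "hom_action M N"
    by (rule hom_koszul_module[OF M(1) N(1)])
  have E: "trivial_group (E n) \<longleftrightarrow> hom_exact M N c (odd n) n" if "n > 0" for n
    using cohomology_trivial_iff_hom_exact[OF M(1) N(1) res, of "n - 1"] that by (simp add: E_def)
  obtain ts where ts: "set ts \<subseteq> carrier M" "carrier M \<subseteq> left_module.list_span scalars M ts"
    by (rule finitely_generated_over_scalars[OF M]) (rule that)
  obtain us where us: "set us \<subseteq> carrier N" "carrier N \<subseteq> Nk.list_span us"
    by (rule finitely_generated_over_scalars[OF N]) (rule that)
  have "acc_within scalars N (Nk.list_span us)"
    using us(1) scalars_inverse by (intro Nk.acc_within_list_span) auto
  then have "acc_within scalars N (carrier N)" by (rule acc_within_subset[OF _ us(2)])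
  then have acc: "acc_within scalars (hom_module scalars M N) (carrier (hom_module scalars M N))"
    using scalars_comm by (intro hom_module_acc[OF Mk Nk _ ts])
  have "\<exists>n0. \<forall>n\<ge>n0. hom_exact M N c p n" for p
  proof -
    obtain n0 where n0: "\<forall>n\<ge>n0. hom_exact M N c p n \<longrightarrow> hom_exact M N c p (Suc n)"
      using Ko.exactness_persists[OF acc] by blast
    obtain n1 where n1: "n1 \<ge> Suc n0" "odd n1 = p" "trivial_group (E n1)"
      using * by (cases p) meson+
    have "hom_exact M N c p n" if "n \<ge> n1" for n
      using that
    proof (induction rule: dec_induct)
      case base
      show ?case using E[of n1] n1 by simp
    next
      case (step n)
      then show ?case using n0 n1(1) by simp
    qed
    then show ?thesis by blast
  qed
  then obtain n0 where n0: "\<And>p n. n \<ge> n0 p \<Longrightarrow> hom_exact M N c p n" by metis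
  have "hom_exact M N c p n" if "n > 0" for p n
    by (rule Ko.exact_at_if_eventually_exact[OF _ that, of "max (n0 True) (n0 False)"])
      (rename_tac q m, case_tac q, auto intro: n0)
  then show "\<forall>n>0. trivial_group (E n)" using E by blast
qed

end


section \<open>Contraction on the free algebra\<close>

context ring
begin

text \<open>
  The derivation that sends a word to the sum over the occurrences of \<open>j\<close> in it, removed with one sign for
  each letter in front. On coefficients this becomes a sum over the ways to insert \<open>j\<close> into \<open>w\<close>.
\<close>

primrec word_contraction :: "nat \<Rightarrow> (nat list \<Rightarrow> 'a) \<Rightarrow> nat list \<Rightarrow> 'a" where
  "word_contraction j f [] = f [j]"
| "word_contraction j f (y # w) = f (j # y # w) \<oplus> \<ominus> word_contraction j (\<lambda>v. f (y # v)) w"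

text \<open>
  The automorphism \<open>x\<^sub>i \<mapsto> - x\<^sub>i\<close>.
\<close>

definition twist :: "(nat list \<Rightarrow> 'a) \<Rightarrow> nat list \<Rightarrow> 'a" where
  "twist f w = (if even (length w) then f w else \<ominus> f w)"

lemma range_tail: "range f \<subseteq> carrier R \<Longrightarrow> range (\<lambda>v. f (y # v)) \<subseteq> carrier R"
  by auto

lemma word_contraction_closed: "range f \<subseteq> carrier R \<Longrightarrow> word_contraction j f w \<in> carrier R"
  by (induction w arbitrary: f) (simp_all add: range_tail range_subsetD)

lemma word_contraction_add:
  assumes "range f \<subseteq> carrier R" "range g \<subseteq> carrier R"
  shows "word_contraction j (\<lambda>v. f v \<oplus> g v) w = word_contraction j f w \<oplus> word_contraction j g w"
  using assms
proof (induction w arbitrary: f g)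
  case (Cons y w)
  have "f (j # y # w) \<in> carrier R" "g (j # y # w) \<in> carrier R" using Cons.prems by auto
  then show ?case
    using Cons.IH[OF range_tail range_tail, OF Cons.prems]
      word_contraction_closed[OF range_tail] Cons.prems
    by (simp add: minus_add a_ac)
qed simp

lemma word_contraction_smult:
  assumes "range f \<subseteq> carrier R" "a \<in> carrier R"
  shows "word_contraction j (\<lambda>v. a \<otimes> f v) w = a \<otimes> word_contraction j f w"
  using assms
proof (induction w arbitrary: f)
  case (Cons y w)
  have "f (j # y # w) \<in> carrier R" using Cons.prems by auto
  then show ?case
    using Cons.IH[OF range_tail, OF Cons.prems] word_contraction_closed[OF range_tail[OF Cons.prems(1)]] Cons.prems(2)
    by (simp add: r_distr r_minus)
qed simp

lemma word_contraction_nonzeroE: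
  assumes "word_contraction j f w \<noteq> \<zero>"
  shows "\<exists>u v. w = u @ v \<and> f (u @ j # v) \<noteq> \<zero>"
  using assms
proof (induction w arbitrary: f)
  case Nil
  then show ?case by (intro exI[of _ "[]"]) simp
next
  case (Cons y w)
  show ?case
  proof (cases "f (j # y # w) = \<zero>")
    case True
    then have "word_contraction j (\<lambda>v. f (y # v)) w \<noteq> \<zero>" using Cons.prems by auto
    from Cons.IH[OF this] obtain u v where "w = u @ v" "f (y # u @ j # v) \<noteq> \<zero>" by blast
    then show ?thesis by (intro exI[of _ "y # u"] exI[of _ v]) simp
  next
    case False
    then show ?thesis by (intro exI[of _ "[]"] exI[of _ "y # w"]) simp
  qed
qed

lemma twist_Cons: "range f \<subseteq> carrier R \<Longrightarrow> twist f (y # w) = \<ominus> twist (\<lambda>v. f (y # v)) w"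
  by (simp add: twist_def range_subsetD)

lemma twist_closed: "range f \<subseteq> carrier R \<Longrightarrow> range (twist f) \<subseteq> carrier R"
  by (auto simp: twist_def range_subsetD)

lemma conv_minus_left:
  assumes "range f \<subseteq> carrier R" "range g \<subseteq> carrier R"
  shows "conv (\<lambda>v. \<ominus> f v) g w = \<ominus> conv f g w"
  using assms by (simp add: conv_def image_subset_iff l_minus Pi_def finsum_minus)

lemma conv_zero_left: "range g \<subseteq> carrier R \<Longrightarrow> conv (\<lambda>v. \<zero>) g w = \<zero>"
  by (simp add: conv_def image_subset_iff)

lemma twist_conv:
  assumes "range f \<subseteq> carrier R" "range g \<subseteq> carrier R"
  shows "twist (conv f g) w = conv (twist f) (twist g) w"
  using assms(1)
proof (induction w arbitrary: f)
  case Nil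
  then show ?case
    using assms(2) by (simp add: conv_Nil twist_closed twist_def[of _ "[]"])
next
  case (Cons y w)
  let ?f = "\<lambda>v. f (y # v)" and ?g = "\<lambda>v. g (y # v)"
  have f: "range ?f \<subseteq> carrier R" and g: "range ?g \<subseteq> carrier R" and tf: "range (twist f) \<subseteq> carrier R"
    and tg: "range (twist g) \<subseteq> carrier R" and tf': "range (twist ?f) \<subseteq> carrier R"
    using Cons.prems assms(2) by (auto intro!: twist_closed)
  have cl: "f [] \<in> carrier R" "g (y # w) \<in> carrier R" "conv ?f g w \<in> carrier R"
    using Cons.prems assms(2) conv_closed[OF f assms(2)] by auto
  have 1: "twist f [] = f []" "(\<lambda>v. twist f (y # v)) = (\<lambda>v. \<ominus> twist ?f v)"
    using Cons.prems by (simp_all add: twist_def[of f "[]"] twist_Cons)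
  have "conv (twist f) (twist g) (y # w) = f [] \<otimes> twist g (y # w) \<oplus> \<ominus> conv (twist ?f) (twist g) w"
    unfolding conv_Cons[OF tf tg] 1 by (simp add: conv_minus_left tf' tg)
  also have "\<dots> = f [] \<otimes> twist g (y # w) \<oplus> \<ominus> twist (conv ?f g) w"
    using Cons.IH[OF f] by simp
  also have "\<dots> = twist (conv f g) (y # w)"
    using cl by (simp add: twist_def conv_Cons Cons.prems assms(2) r_minus minus_add)
  finally show ?case ..
qed

lemma word_contraction_conv:
  assumes "range f \<subseteq> carrier R" "range g \<subseteq> carrier R"
  shows "word_contraction j (conv f g) w =
    conv (word_contraction j f) g w \<oplus> conv (twist f) (word_contraction j g) w"
  using assms(1)
proof (induction w arbitrary: f)
  case Nil
  have 1: "range (\<lambda>v. f (j # v)) \<subseteq> carrier R" "range (word_contraction j f) \<subseteq> carrier R"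
    "range (word_contraction j g) \<subseteq> carrier R" "range (twist f) \<subseteq> carrier R"
    using Nil assms(2) word_contraction_closed twist_closed by auto
  have "f [] \<in> carrier R" "f [j] \<in> carrier R" "g [] \<in> carrier R" "g [j] \<in> carrier R"
    using Nil assms(2) by auto
  then show ?case
    using 1 by (simp add: conv_Cons conv_Nil Nil assms(2) twist_def a_comm)
next
  case (Cons y w)
  let ?f = "\<lambda>v. f (y # v)" and ?g = "\<lambda>v. g (y # v)" and ?d = "word_contraction j"
  let ?fj = "\<lambda>v. f (j # v)" and ?fjy = "\<lambda>v. f (j # y # v)"
  have r: "range ?f \<subseteq> carrier R" "range ?g \<subseteq> carrier R" "range ?fj \<subseteq> carrier R" "range ?fjy \<subseteq> carrier R"
    using Cons.prems assms(2) by auto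
  have rd: "range (?d h) \<subseteq> carrier R" if "range h \<subseteq> carrier R" for h using word_contraction_closed[OF that] by auto
  have rc: "range (conv h g) \<subseteq> carrier R" if "range h \<subseteq> carrier R" for h using conv_closed[OF that assms(2)] by auto
  have rs: "range (\<lambda>v. f [] \<otimes> ?g v) \<subseteq> carrier R"
    using range_subsetD[OF Cons.prems] range_subsetD[OF assms(2)] by auto
  have rt: "range (twist ?f) \<subseteq> carrier R" "range (twist f) \<subseteq> carrier R" using twist_closed r(1) Cons.prems by auto
  have cl: "f [] \<in> carrier R" "f [j] \<in> carrier R" "g (y # w) \<in> carrier R" "g (j # y # w) \<in> carrier R"
    "?d ?g w \<in> carrier R" "conv (?d ?f) g w \<in> carrier R" "conv (twist ?f) (?d g) w \<in> carrier R"
    "conv ?fjy g w \<in> carrier R"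
    using range_subsetD[OF Cons.prems] range_subsetD[OF assms(2)] word_contraction_closed[OF r(2)]
      conv_closed[OF rd[OF r(1)] assms(2)] conv_closed[OF rt(1) rd[OF assms(2)]] conv_closed[OF r(4) assms(2)]
    by auto
  have "(\<lambda>v. conv f g (y # v)) = (\<lambda>v. f [] \<otimes> ?g v \<oplus> conv ?f g v)"
    by (simp add: conv_Cons Cons.prems assms(2))
  then have "?d (\<lambda>v. conv f g (y # v)) w = f [] \<otimes> ?d ?g w \<oplus> (conv (?d ?f) g w \<oplus> conv (twist ?f) (?d g) w)"
    using Cons.IH[OF r(1)] cl(1) by (simp add: word_contraction_add rs rc r word_contraction_smult)
  then have lhs: "?d (conv f g) (y # w) = (f [] \<otimes> g (j # y # w) \<oplus> (f [j] \<otimes> g (y # w) \<oplus> conv ?fjy g w)) \<oplus>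
      \<ominus> (f [] \<otimes> ?d ?g w \<oplus> (conv (?d ?f) g w \<oplus> conv (twist ?f) (?d g) w))"
    by (simp add: conv_Cons Cons.prems assms(2) r)
  have "range (\<lambda>v. \<ominus> ?d ?f v) \<subseteq> carrier R" using rd[OF r(1)] by auto
  then have 1: "conv (?d f) g (y # w) = f [j] \<otimes> g (y # w) \<oplus> (conv ?fjy g w \<oplus> \<ominus> conv (?d ?f) g w)"
    by (simp add: conv_Cons rd Cons.prems assms(2) conv_add_left r conv_minus_left)
  have "(\<lambda>v. twist f (y # v)) = (\<lambda>v. \<ominus> twist ?f v)" using Cons.prems by (simp add: twist_Cons)
  then have 2: "conv (twist f) (?d g) (y # w) =
      f [] \<otimes> (g (j # y # w) \<oplus> \<ominus> ?d ?g w) \<oplus> \<ominus> conv (twist ?f) (?d g) w"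
    by (simp add: conv_Cons rt rd assms(2) conv_minus_left twist_def[of f "[]"])
  show ?case unfolding lhs 1 2 using cl by (simp add: r_distr r_minus minus_add a_ac)
qed

lemma range_free_gen: "range (free_gen R i) \<subseteq> carrier R"
  by (auto simp: free_gen_def)

lemma conv_free_gen:
  assumes "range g \<subseteq> carrier R"
  shows "conv (free_gen R i) g w = (case w of [] \<Rightarrow> \<zero> | y # v \<Rightarrow> if y = i then g v else \<zero>)"
proof (cases w)
  case Nil
  then show ?thesis using assms by (simp add: conv_Nil range_free_gen, simp add: free_gen_def range_subsetD)
next
  case (Cons y v)
  have "(\<lambda>v. free_gen R i (y # v)) = (if y = i then (\<lambda>v. if v = [] then \<one> else \<zero>) else (\<lambda>v. \<zero>))"
    by (auto simp: free_gen_def)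
  moreover have "free_gen R i [] = \<zero>" by (simp add: free_gen_def)
  ultimately show ?thesis
    using Cons assms range_subsetD[OF assms]
    by (simp add: conv_Cons range_free_gen conv_one_left conv_zero_left)
qed

lemma word_contraction_free_gen_conv:
  assumes "range g \<subseteq> carrier R"
  shows "word_contraction j (conv (free_gen R i) g) w \<oplus> conv (free_gen R i) (word_contraction j g) w =
    (if i = j then g w else \<zero>)"
proof -
  have d: "range (word_contraction j g) \<subseteq> carrier R" using word_contraction_closed[OF assms] by auto
  have cl: "g v \<in> carrier R" "word_contraction j g v \<in> carrier R" for v using assms d by auto
  have z: "word_contraction j (\<lambda>v. \<zero>) v = \<zero>" for v by (induction v) simp_all
  show ?thesis
  proof (cases w)
    case Nil
    then show ?thesis using cl by (simp add: conv_free_gen assms d)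
  next
    case (Cons y v)
    then show ?thesis using cl by (simp add: conv_free_gen assms d z a_assoc l_neg)
  qed
qed

end

context ring
begin

definition scalar_word :: "'a \<Rightarrow> nat list \<Rightarrow> 'a" where
  "scalar_word a w = (if w = [] then a else \<zero>)"

lemma range_scalar_word: "a \<in> carrier R \<Longrightarrow> range (scalar_word a) \<subseteq> carrier R"
  by (auto simp: scalar_word_def)

lemma scalar_word_in_free_algebra: "a \<in> carrier R \<Longrightarrow> scalar_word a \<in> carrier (free_algebra R c)"
  by (auto simp: scalar_word_def free_algebra_simps intro: finite_subset[of _ "{[]}"])

lemma conv_scalar_word_left:
  assumes "a \<in> carrier R" "range f \<subseteq> carrier R"
  shows "conv (scalar_word a) f w = a \<otimes> f w"
proof -
  have "scalar_word a = (\<lambda>w. a \<otimes> (if w = [] then \<one> else \<zero>))"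
    using assms(1) by (auto simp: scalar_word_def)
  then show ?thesis
    using assms conv_smult[OF assms(1), of "\<lambda>w. if w = [] then \<one> else \<zero>" f w]
    by (auto simp: conv_one_left)
qed

lemma conv_scalar_word_right:
  assumes "a \<in> carrier R" "range f \<subseteq> carrier R"
  shows "conv f (scalar_word a) w = f w \<otimes> a"
  using assms(2)
proof (induction w arbitrary: f)
  case Nil
  then show ?case using assms(1) by (simp add: conv_Nil range_scalar_word, simp add: scalar_word_def)
next
  case (Cons y w)
  have "f [] \<in> carrier R" "f (y # w) \<in> carrier R" using Cons.prems by auto
  then show ?case
    using assms(1) Cons.IH[OF range_tail[OF Cons.prems]] Cons.prems
    by (simp add: conv_Cons range_scalar_word, simp add: scalar_word_def)
qed

lemma free_gen_in_free_algebra: "i \<in> {1..c} \<Longrightarrow> free_gen R i \<in> carrier (free_algebra R c)"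
  by (auto simp: free_gen_def free_algebra_simps intro: finite_subset[of _ "{[i]}"])

lemma word_contraction_in_free_algebra:
  assumes "f \<in> carrier (free_algebra R c)"
  shows "word_contraction j f \<in> carrier (free_algebra R c)"
proof -
  have f: "range f \<subseteq> carrier R" "finite {w. f w \<noteq> \<zero>}" "\<And>w. f w \<noteq> \<zero> \<Longrightarrow> set w \<subseteq> {1..c}"
    using assms by (auto simp: free_algebra_simps)
  have "{w. word_contraction j f w \<noteq> \<zero>} \<subseteq>
      (\<Union>u\<in>{w. f w \<noteq> \<zero>}. (\<lambda>i. take i u @ drop (Suc i) u) ` {..length u})"
  proof
    fix w assume "w \<in> {w. word_contraction j f w \<noteq> \<zero>}"
    then obtain u v where w: "w = u @ v" "f (u @ j # v) \<noteq> \<zero>" using word_contraction_nonzeroE by blast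
    then show "w \<in> (\<Union>u\<in>{w. f w \<noteq> \<zero>}. (\<lambda>i. take i u @ drop (Suc i) u) ` {..length u})"
      by (intro UN_I[of "u @ j # v"] image_eqI[of _ _ "length u"]) auto
  qed
  then have "finite {w. word_contraction j f w \<noteq> \<zero>}" by (rule finite_subset) (use f(2) in auto)
  moreover have "word_contraction j f w = \<zero>" if "\<not> set w \<subseteq> {1..c}" for w
  proof (rule ccontr)
    assume "word_contraction j f w \<noteq> \<zero>"
    then obtain u v where w: "w = u @ v" "f (u @ j # v) \<noteq> \<zero>" using word_contraction_nonzeroE by blast
    then show False using f(3)[OF w(2)] that by auto
  qed
  ultimately show ?thesis using word_contraction_closed[OF f(1)] by (simp add: free_algebra_simps)
qed

lemma twist_in_free_algebra:
  assumes "f \<in> carrier (free_algebra R c)"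
  shows "twist f \<in> carrier (free_algebra R c)"
proof -
  have "{w. twist f w \<noteq> \<zero>} \<subseteq> {w. f w \<noteq> \<zero>}" by (auto simp: twist_def)
  with assms show ?thesis by (auto simp: free_algebra_simps twist_def intro: finite_subset)
qed

lemma exterior_relations_subset: "exterior_relations R c \<subseteq> carrier (free_algebra R c)"
proof -
  interpret F: ring "free_algebra R c" by (rule free_algebra_ring)
  show ?thesis using free_gen_in_free_algebra by (auto simp: exterior_relations_def Let_def)
qed

lemma exterior_relations_contraction:
  assumes "r \<in> exterior_relations R c"
  shows "word_contraction j r = (\<lambda>w. \<zero>)" "twist r = r"
proof -
  let ?x = "free_gen R"
  have r: "range (conv (?x a) (?x b)) \<subseteq> carrier R" for a b using conv_closed[OF range_free_gen range_free_gen] by auto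
  have val: "conv (?x a) (?x b) w = (if w = [a, b] then \<one> else \<zero>)" for a b w
    by (simp add: conv_free_gen range_free_gen) (auto simp: free_gen_def split: list.split)
  have con: "word_contraction j (conv (?x a) (?x b)) w =
      (if w = [b] \<and> j = a then \<one> else \<zero>) \<oplus> \<ominus> (if w = [a] \<and> j = b then \<one> else \<zero>)" for a b w
  proof -
    have z: "word_contraction j (\<lambda>v. \<zero>) v = \<zero>" for v by (induction v) simp_all
    have e: "word_contraction j (\<lambda>v. if Q \<and> v = [] then \<one> else \<zero>) u = \<zero>" for Q u
      by (cases u) (simp_all add: z)
    have s: "word_contraction j (\<lambda>v. if v = [b] then \<one> else \<zero>) v = (if v = [] \<and> j = b then \<one> else \<zero>)" for v
      using e[of "hd v = b" "tl v"] by (cases v) (auto simp: z)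
    have s': "word_contraction j (\<lambda>v. if Q \<and> v = [b] then \<one> else \<zero>) v = (if Q \<and> v = [] \<and> j = b then \<one> else \<zero>)" for Q v
      by (cases Q) (simp_all add: s z)
    show ?thesis
      unfolding val[abs_def] by (cases w) (auto simp: s')
  qed
  have tw: "twist (conv (?x a) (?x b)) w = conv (?x a) (?x b) w" for a b w by (simp add: twist_def val)
  have tw2: "twist (\<lambda>w. conv (?x a) (?x b) w \<oplus> conv (?x b) (?x a) w) w =
      conv (?x a) (?x b) w \<oplus> conv (?x b) (?x a) w" for a b w
    by (simp add: twist_def val)
  from assms consider a where "r = conv (?x a) (?x a)"
    | a b where "a \<noteq> b" "r = (\<lambda>w. conv (?x a) (?x b) w \<oplus> conv (?x b) (?x a) w)"
    by (auto simp: exterior_relations_def Let_def mult_free_algebra free_algebra_simps(5))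
  then have "word_contraction j r = (\<lambda>w. \<zero>) \<and> twist r = r"
  proof cases
    case 1
    show ?thesis unfolding 1 by (intro conjI ext) (auto simp: con tw r_neg)
  next
    case 2
    have "word_contraction j r w = \<zero>" for w
      unfolding 2(2) word_contraction_add[OF r r] con using 2(1) by (auto simp: r_neg l_neg)
    moreover have "twist r w = r w" for w unfolding 2(2) by (rule tw2)
    ultimately show ?thesis by auto
  qed
  then show "word_contraction j r = (\<lambda>w. \<zero>)" "twist r = r" by blast+
qed

lemma exterior_ideal: "ideal (Idl\<^bsub>free_algebra R c\<^esub> (exterior_relations R c)) (free_algebra R c)"
  by (rule ring.genideal_ideal[OF free_algebra_ring exterior_relations_subset])

text \<open>
  By the product rule the elements of the ideal whose contraction and twist stay in the ideal form an
  ideal again, and it contains the relations: these are even and have contraction zero.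
\<close>

lemma exterior_ideal_stable:
  assumes "f \<in> Idl\<^bsub>free_algebra R c\<^esub> (exterior_relations R c)"
  shows "word_contraction j f \<in> Idl\<^bsub>free_algebra R c\<^esub> (exterior_relations R c)"
proof -
  let ?F = "free_algebra R c" and ?I = "Idl\<^bsub>free_algebra R c\<^esub> (exterior_relations R c)"
  interpret F: ring ?F by (rule free_algebra_ring)
  interpret I: ideal ?I ?F by (rule exterior_ideal)
  have IF: "f \<in> carrier ?F" if "f \<in> ?I" for f using that I.a_subset by blast
  have zI: "(\<lambda>w. \<zero>) \<in> ?I" using I.zero_closed by (simp add: free_algebra_simps)
  let ?d = "word_contraction j"
  define T where "T = {f \<in> ?I. ?d f \<in> ?I \<and> twist f \<in> ?I}"
  have d_mult: "?d (f \<otimes>\<^bsub>?F\<^esub> g) = ?d f \<otimes>\<^bsub>?F\<^esub> g \<oplus>\<^bsub>?F\<^esub> twist f \<otimes>\<^bsub>?F\<^esub> ?d g"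
    if "f \<in> carrier ?F" "g \<in> carrier ?F" for f g
    unfolding mult_free_algebra free_algebra_simps(5)
    using that word_contraction_conv[OF free_algebra_range free_algebra_range] by (simp add: fun_eq_iff)
  have t_mult: "twist (f \<otimes>\<^bsub>?F\<^esub> g) = twist f \<otimes>\<^bsub>?F\<^esub> twist g" if "f \<in> carrier ?F" "g \<in> carrier ?F" for f g
    unfolding mult_free_algebra using that twist_conv[OF free_algebra_range free_algebra_range] by (simp add: fun_eq_iff)
  have d_add: "?d (f \<oplus>\<^bsub>?F\<^esub> g) = ?d f \<oplus>\<^bsub>?F\<^esub> ?d g" if "f \<in> carrier ?F" "g \<in> carrier ?F" for f g
    unfolding free_algebra_simps(5)
    using that word_contraction_add[OF free_algebra_range free_algebra_range] by (simp add: fun_eq_iff)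
  have t_add: "twist (f \<oplus>\<^bsub>?F\<^esub> g) = twist f \<oplus>\<^bsub>?F\<^esub> twist g" if "f \<in> carrier ?F" "g \<in> carrier ?F" for f g
    unfolding free_algebra_simps(5)
    using range_subsetD[OF free_algebra_range[OF that(1)]] range_subsetD[OF free_algebra_range[OF that(2)]]
    by (simp add: twist_def minus_add fun_eq_iff)
  have cl: "?d f \<in> carrier ?F" "twist f \<in> carrier ?F" if "f \<in> carrier ?F" for f
    using that by (simp_all add: word_contraction_in_free_algebra twist_in_free_algebra)
  have left: "g \<otimes>\<^bsub>?F\<^esub> f \<in> T" if "f \<in> T" "g \<in> carrier ?F" for f g
  proof -
    have f: "f \<in> ?I" "?d f \<in> ?I" "twist f \<in> ?I" using that(1) by (simp_all add: T_def)
    show ?thesis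
      unfolding T_def mem_Collect_eq d_mult[OF that(2) IF[OF f(1)]] t_mult[OF that(2) IF[OF f(1)]]
      by (intro conjI I.a_closed I.I_l_closed f cl that(2))
  qed
  have right: "f \<otimes>\<^bsub>?F\<^esub> g \<in> T" if "f \<in> T" "g \<in> carrier ?F" for f g
  proof -
    have f: "f \<in> ?I" "?d f \<in> ?I" "twist f \<in> ?I" using that(1) by (simp_all add: T_def)
    show ?thesis
      unfolding T_def mem_Collect_eq d_mult[OF IF[OF f(1)] that(2)] t_mult[OF IF[OF f(1)] that(2)]
      by (intro conjI I.a_closed I.I_r_closed f cl that(2))
  qed
  have "ideal T ?F"
  proof (rule idealI[OF free_algebra_ring _ left right])
    show "subgroup T (add_monoid ?F)"
    proof (rule F.add.subgroupI)
      show "T \<subseteq> carrier ?F" using IF by (auto simp: T_def)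
      have "(\<lambda>w. \<zero>) \<in> T"
      proof -
        have "word_contraction j (\<lambda>w. \<zero>) v = \<zero>" for v by (induction v) simp_all
        then have "?d (\<lambda>w. \<zero>) = (\<lambda>w. \<zero>)" by auto
        moreover have "twist (\<lambda>w. \<zero>) = (\<lambda>w. \<zero>)" by (auto simp: twist_def)
        ultimately show ?thesis using zI by (simp add: T_def)
      qed
      then show "T \<noteq> {}" by blast
      show "f \<oplus>\<^bsub>?F\<^esub> g \<in> T" if "f \<in> T" "g \<in> T" for f g
        using that IF by (auto simp: T_def d_add t_add intro!: I.a_closed)
      show "\<ominus>\<^bsub>?F\<^esub> f \<in> T" if "f \<in> T" for f
        using left[OF that, of "\<ominus>\<^bsub>?F\<^esub> \<one>\<^bsub>?F\<^esub>"] that IF by (simp add: T_def F.l_minus)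
    qed
  qed
  moreover have "exterior_relations R c \<subseteq> T"
    using F.genideal_self[OF exterior_relations_subset] zI
    by (auto simp: T_def exterior_relations_contraction)
  ultimately have "?I \<subseteq> T" by (rule F.genideal_minimal)
  then show ?thesis using assms by (auto simp: T_def)
qed

lemma free_algebra_induct:
  assumes f: "f \<in> carrier (free_algebra R c)"
    and one: "P \<one>\<^bsub>free_algebra R c\<^esub>"
    and add: "\<And>f g. f \<in> carrier (free_algebra R c) \<Longrightarrow> g \<in> carrier (free_algebra R c) \<Longrightarrow>
      P f \<Longrightarrow> P g \<Longrightarrow> P (f \<oplus>\<^bsub>free_algebra R c\<^esub> g)"
    and scalar: "\<And>a f. a \<in> carrier R \<Longrightarrow> f \<in> carrier (free_algebra R c) \<Longrightarrow> P f \<Longrightarrow>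
      P (scalar_word a \<otimes>\<^bsub>free_algebra R c\<^esub> f)"
    and gen: "\<And>i f. i \<in> {1..c} \<Longrightarrow> f \<in> carrier (free_algebra R c) \<Longrightarrow> P f \<Longrightarrow>
      P (free_gen R i \<otimes>\<^bsub>free_algebra R c\<^esub> f)"
  shows "P f"
proof -
  let ?F = "free_algebra R c"
  interpret F: ring ?F by (rule free_algebra_ring)
  define mono where "mono w = (\<lambda>v. if v = w then \<one> else \<zero>)" for w :: "nat list"
  have mono: "mono w \<in> carrier ?F \<and> P (mono w)" if "set w \<subseteq> {1..c}" for w
    using that
  proof (induction w)
    case Nil
    have "mono [] = \<one>\<^bsub>?F\<^esub>" by (auto simp: mono_def free_algebra_simps)
    then show ?case using one by simp
  next
    case (Cons y w)
    then have w: "mono w \<in> carrier ?F" "P (mono w)" and y: "y \<in> {1..c}" by auto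
    have "mono (y # w) = free_gen R y \<otimes>\<^bsub>?F\<^esub> mono w"
      unfolding mult_free_algebra conv_free_gen[OF free_algebra_range[OF w(1)], abs_def]
      by (rule ext) (simp add: mono_def split: list.split)
    then show ?case using gen[OF y w] F.m_closed[OF free_gen_in_free_algebra[OF y] w(1)] by simp
  qed
  have "P f" if "finite S" "f \<in> carrier ?F" "{w. f w \<noteq> \<zero>} \<subseteq> S" for S f
    using that
  proof (induction S arbitrary: f)
    case empty
    then have "f = (\<lambda>w. \<zero>)" by auto
    also have "\<dots> = scalar_word \<zero> \<otimes>\<^bsub>?F\<^esub> \<one>\<^bsub>?F\<^esub>"
      unfolding mult_free_algebra
      by (rule ext) (simp add: conv_scalar_word_left free_algebra_range[OF F.one_closed] range_subsetD[OF free_algebra_range[OF F.one_closed]])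
    finally show ?case using scalar[OF zero_closed F.one_closed one] by simp
  next
    case (insert w S)
    define g where "g = f(w := \<zero>)"
    have fw: "f v \<in> carrier R" for v using insert.prems by (auto simp: free_algebra_simps)
    have sub: "{v. g v \<noteq> \<zero>} \<subseteq> {v. f v \<noteq> \<zero>}" by (auto simp: g_def)
    with insert.prems(1) have g: "g \<in> carrier ?F"
      by (auto simp: free_algebra_simps g_def intro: finite_subset)
    have "{v. g v \<noteq> \<zero>} \<subseteq> S" using insert.prems(2) by (auto simp: g_def)
    then have Pg: "P g" using insert.IH[OF g] by simp
    show ?case
    proof (cases "set w \<subseteq> {1..c}")
      case True
      note m = mono[OF True]
      have "f = scalar_word (f w) \<otimes>\<^bsub>?F\<^esub> mono w \<oplus>\<^bsub>?F\<^esub> g"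
        unfolding mult_free_algebra free_algebra_simps(5)
          conv_scalar_word_left[OF fw free_algebra_range[OF conjunct1[OF m]], abs_def]
        by (rule ext) (use fw in \<open>simp add: mono_def g_def\<close>)
      moreover have "P (scalar_word (f w) \<otimes>\<^bsub>?F\<^esub> mono w \<oplus>\<^bsub>?F\<^esub> g)"
        using m g Pg fw scalar_word_in_free_algebra[OF fw] by (intro add scalar F.m_closed) auto
      ultimately show ?thesis by simp
    next
      case False
      then have "f w = \<zero>" using insert.prems(1) by (auto simp: free_algebra_simps)
      then have "g = f" by (auto simp: g_def)
      then show ?thesis using Pg by simp
    qed
  qed
  from this[OF _ f order_refl] show ?thesis using f by (simp add: free_algebra_simps)
qed

end


section \<open>The exterior algebra\<close>

definition exterior_class :: "('k, 'x) ring_scheme \<Rightarrow> nat \<Rightarrow> (nat list \<Rightarrow> 'k) \<Rightarrow> (nat list \<Rightarrow> 'k) set" where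
  "exterior_class K c f = Idl\<^bsub>free_algebra K c\<^esub> (exterior_relations K c) +>\<^bsub>free_algebra K c\<^esub> f"

text \<open>
  The generators of the free algebra are numbered from one, those of an exterior ring from zero.
\<close>

definition exterior_gen :: "('k, 'x) ring_scheme \<Rightarrow> nat \<Rightarrow> nat \<Rightarrow> (nat list \<Rightarrow> 'k) set" where
  "exterior_gen K c i = (if i < c then exterior_class K c (free_gen K (Suc i)) else \<zero>\<^bsub>exterior_algebra K c\<^esub>)"

text \<open>
  The choice of a representative does not matter, because the contraction on the free algebra preserves the ideal of relations.
\<close>

definition exterior_contraction ::
    "('k, 'x) ring_scheme \<Rightarrow> nat \<Rightarrow> nat \<Rightarrow> (nat list \<Rightarrow> 'k) set \<Rightarrow> (nat list \<Rightarrow> 'k) set" where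
  "exterior_contraction K c j X = exterior_class K c (ring.word_contraction K (Suc j) (SOME f. f \<in> X))"

theorem exterior_algebra_exterior_ring:
  assumes "field K"
  shows "exterior_ring (exterior_algebra K c)
    ((\<lambda>a. exterior_class K c (ring.scalar_word K a)) ` carrier K)
    (exterior_gen K c) c (exterior_contraction K c)"
proof -
  interpret K: field K by fact
  let ?F = "free_algebra K c" and ?A = "exterior_algebra K c"
  let ?I = "Idl\<^bsub>?F\<^esub> (exterior_relations K c)"
  interpret F: ring ?F by (rule K.free_algebra_ring)
  interpret A: ring ?A by (rule K.exterior_algebra_ring)
  interpret I: ideal ?I ?F by (rule K.exterior_ideal)
  let ?\<pi> = "exterior_class K c" and ?\<kappa> = "\<lambda>a. exterior_class K c (K.scalar_word a)"
  interpret \<pi>: ring_hom_ring ?F ?A ?\<pi>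
    using I.rcos_ring_hom_ring unfolding exterior_algebra_def exterior_class_def[abs_def] .
  have \<pi>_surj: "\<exists>f\<in>carrier ?F. X = ?\<pi> f" if "X \<in> carrier ?A" for X
    using that by (auto simp: exterior_algebra_def FactRing_def A_RCOSETS_def' exterior_class_def)
  have \<pi>_zero: "?\<pi> f = \<zero>\<^bsub>?A\<^esub>" if "f \<in> ?I" for f
    using I.a_rcos_const[OF that] by (simp add: exterior_class_def exterior_algebra_def FactRing_def)
  let ?x = "free_gen K"
  have x: "?x (Suc i) \<in> carrier ?F" if "i < c" for i using that by (intro K.free_gen_in_free_algebra) auto
  have gen: "exterior_gen K c i = ?\<pi> (?x (Suc i))" if "i < c" for i using that by (simp add: exterior_gen_def)
  have rel: "?\<pi> r = \<zero>\<^bsub>?A\<^esub>" if "r \<in> exterior_relations K c" for r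
    using F.genideal_self[OF K.exterior_relations_subset] that by (intro \<pi>_zero) blast
  let ?d = "K.word_contraction"
  have d_cl: "?d j f \<in> carrier ?F" if "f \<in> carrier ?F" for j f by (rule K.word_contraction_in_free_algebra[OF that])
  have d_add: "?d j (f \<oplus>\<^bsub>?F\<^esub> g) = ?d j f \<oplus>\<^bsub>?F\<^esub> ?d j g" if "f \<in> carrier ?F" "g \<in> carrier ?F" for j f g
    unfolding free_algebra_simps(5)
    using that K.word_contraction_add[OF K.free_algebra_range K.free_algebra_range] by (simp add: fun_eq_iff)
  have con: "exterior_contraction K c j (?\<pi> f) = ?\<pi> (?d (Suc j) f)" if f: "f \<in> carrier ?F" for j f
  proof -
    have f_mem: "f \<in> ?\<pi> f" unfolding exterior_class_def by (rule I.a_rcos_self[OF f])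
    define g where "g = (SOME g. g \<in> ?\<pi> f)"
    have g: "g \<in> ?\<pi> f" unfolding g_def by (rule someI[of _ f]) (rule f_mem)
    then obtain r where r: "r \<in> ?I" "g = r \<oplus>\<^bsub>?F\<^esub> f" by (auto simp: exterior_class_def a_r_coset_def')
    have rF: "r \<in> carrier ?F" using r(1) I.a_subset by blast
    have "?d (Suc j) g = ?d (Suc j) r \<oplus>\<^bsub>?F\<^esub> ?d (Suc j) f" unfolding r(2) by (rule d_add[OF rF f])
    then have "?\<pi> (?d (Suc j) g) = ?\<pi> (?d (Suc j) r) \<oplus>\<^bsub>?A\<^esub> ?\<pi> (?d (Suc j) f)"
      using d_cl[OF rF] d_cl[OF f] by simp
    also have "?\<pi> (?d (Suc j) r) = \<zero>\<^bsub>?A\<^esub>" by (rule \<pi>_zero[OF K.exterior_ideal_stable[OF r(1)]])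
    finally show ?thesis using d_cl[OF f] by (simp add: exterior_contraction_def flip: g_def)
  qed
  have sc: "K.scalar_word a \<in> carrier ?F" if "a \<in> carrier K" for a by (rule K.scalar_word_in_free_algebra[OF that])
  have sc_mult: "K.scalar_word a \<otimes>\<^bsub>?F\<^esub> f = (\<lambda>w. a \<otimes>\<^bsub>K\<^esub> f w)" if "a \<in> carrier K" "f \<in> carrier ?F" for a f
    unfolding K.mult_free_algebra using K.conv_scalar_word_left[OF that(1) K.free_algebra_range[OF that(2)]] by blast
  have sc_add: "?\<kappa> (a \<oplus>\<^bsub>K\<^esub> b) = ?\<kappa> a \<oplus>\<^bsub>?A\<^esub> ?\<kappa> b" if "a \<in> carrier K" "b \<in> carrier K" for a b
  proof -
    have "K.scalar_word (a \<oplus>\<^bsub>K\<^esub> b) = K.scalar_word a \<oplus>\<^bsub>?F\<^esub> K.scalar_word b"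
      by (auto simp: K.scalar_word_def free_algebra_simps)
    then show ?thesis using sc that by simp
  qed
  have sc_times: "?\<kappa> (a \<otimes>\<^bsub>K\<^esub> b) = ?\<kappa> a \<otimes>\<^bsub>?A\<^esub> ?\<kappa> b" if "a \<in> carrier K" "b \<in> carrier K" for a b
  proof -
    have "K.scalar_word (a \<otimes>\<^bsub>K\<^esub> b) = K.scalar_word a \<otimes>\<^bsub>?F\<^esub> K.scalar_word b"
      unfolding sc_mult[OF that(1) sc[OF that(2)]] using that(1) by (auto simp: K.scalar_word_def)
    then show ?thesis using sc that by simp
  qed
  have sc_one: "?\<kappa> \<one>\<^bsub>K\<^esub> = \<one>\<^bsub>?A\<^esub>"
  proof -
    have "K.scalar_word \<one>\<^bsub>K\<^esub> = \<one>\<^bsub>?F\<^esub>" by (auto simp: K.scalar_word_def free_algebra_simps)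
    then show ?thesis by simp
  qed
  have sc_zero: "?\<kappa> \<zero>\<^bsub>K\<^esub> = \<zero>\<^bsub>?A\<^esub>"
  proof -
    have "K.scalar_word \<zero>\<^bsub>K\<^esub> = \<zero>\<^bsub>?F\<^esub>" by (auto simp: K.scalar_word_def free_algebra_simps)
    then show ?thesis by simp
  qed
  interpret \<kappa>: ring_hom_ring K ?A ?\<kappa>
    by (intro ring_hom_ringI K.ring_axioms A.ring_axioms) (simp_all add: sc sc_times sc_add sc_one)
  show ?thesis
  proof (intro exterior_ring.intro exterior_ring_axioms.intro A.ring_axioms)
    show "subring (?\<kappa> ` carrier K) ?A" by (rule \<kappa>.img_is_subring[OF K.carrier_is_subring])
    show "\<alpha> \<otimes>\<^bsub>?A\<^esub> b = b \<otimes>\<^bsub>?A\<^esub> \<alpha>" if \<alpha>: "\<alpha> \<in> ?\<kappa> ` carrier K" and b: "b \<in> carrier ?A" for \<alpha> b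
    proof -
      obtain a where a: "a \<in> carrier K" "\<alpha> = ?\<kappa> a" using \<alpha> by blast
      obtain f where f: "f \<in> carrier ?F" "b = ?\<pi> f" using \<pi>_surj[OF b] by blast
      have fK: "f w \<in> carrier K" for w using f(1) by (auto simp: free_algebra_simps)
      have "K.scalar_word a \<otimes>\<^bsub>?F\<^esub> f = f \<otimes>\<^bsub>?F\<^esub> K.scalar_word a"
        unfolding sc_mult[OF a(1) f(1)] unfolding K.mult_free_algebra
        using K.conv_scalar_word_right[OF a(1) K.free_algebra_range[OF f(1)]] a(1) fK
        by (simp add: fun_eq_iff K.m_comm)
      then have "?\<pi> (K.scalar_word a \<otimes>\<^bsub>?F\<^esub> f) = ?\<pi> (f \<otimes>\<^bsub>?F\<^esub> K.scalar_word a)" by simp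
      then show ?thesis unfolding a(2) f(2) using sc[OF a(1)] f(1) by simp
    qed
    show "\<exists>\<beta>\<in>?\<kappa> ` carrier K. \<beta> \<otimes>\<^bsub>?A\<^esub> \<alpha> = \<one>\<^bsub>?A\<^esub>" if \<alpha>: "\<alpha> \<in> ?\<kappa> ` carrier K" "\<alpha> \<noteq> \<zero>\<^bsub>?A\<^esub>" for \<alpha>
    proof -
      obtain a where a: "a \<in> carrier K" "\<alpha> = ?\<kappa> a" using \<alpha> by blast
      with \<alpha>(2) sc_zero have "a \<noteq> \<zero>\<^bsub>K\<^esub>" by auto
      with a(1) have "a \<in> Units K" by (simp add: K.field_Units)
      then have i: "inv\<^bsub>K\<^esub> a \<in> carrier K" "inv\<^bsub>K\<^esub> a \<otimes>\<^bsub>K\<^esub> a = \<one>\<^bsub>K\<^esub>" by simp_all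
      then have "?\<kappa> (inv\<^bsub>K\<^esub> a) \<otimes>\<^bsub>?A\<^esub> \<alpha> = \<one>\<^bsub>?A\<^esub>"
        using sc_times[OF i(1) a(1)] sc_one by (simp add: a(2))
      with i(1) show ?thesis by blast
    qed
    show "exterior_gen K c i \<in> carrier ?A" for i using x[of i] by (auto simp: exterior_gen_def)
    have square: "exterior_gen K c i \<otimes>\<^bsub>?A\<^esub> exterior_gen K c i = \<zero>\<^bsub>?A\<^esub>" for i
    proof (cases "i < c")
      case True
      then have "?x (Suc i) \<otimes>\<^bsub>?F\<^esub> ?x (Suc i) \<in> exterior_relations K c"
        by (auto simp: exterior_relations_def Let_def)
      from rel[OF this] show ?thesis using True x by (simp add: gen)
    qed (simp add: exterior_gen_def)
    then show "exterior_gen K c i \<otimes>\<^bsub>?A\<^esub> exterior_gen K c i = \<zero>\<^bsub>?A\<^esub>" for i .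
    show "exterior_gen K c i \<otimes>\<^bsub>?A\<^esub> exterior_gen K c j \<oplus>\<^bsub>?A\<^esub>
        exterior_gen K c j \<otimes>\<^bsub>?A\<^esub> exterior_gen K c i = \<zero>\<^bsub>?A\<^esub>" for i j
    proof -
      consider "i = j" | "\<not> i < c" | "\<not> j < c" | "i < c" "j < c" "i \<noteq> j" by blast
      then show ?thesis
      proof cases
        case 1
        then show ?thesis by (simp add: square)
      next
        case 2
        then show ?thesis using x[of j] by (auto simp: exterior_gen_def)
      next
        case 3
        then show ?thesis using x[of i] by (auto simp: exterior_gen_def)
      next
        case 4
        then have "?x (Suc i) \<otimes>\<^bsub>?F\<^esub> ?x (Suc j) \<oplus>\<^bsub>?F\<^esub> ?x (Suc j) \<otimes>\<^bsub>?F\<^esub> ?x (Suc i) \<in> exterior_relations K c"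
          unfolding exterior_relations_def Let_def
          by (intro UnI2 CollectI exI[of _ "Suc i"] exI[of _ "Suc j"]) auto
        from rel[OF this] show ?thesis using 4 x by (simp add: gen)
      qed
    qed
    show "P a" if one: "P \<one>\<^bsub>?A\<^esub>"
      and add: "\<And>a b. a \<in> carrier ?A \<Longrightarrow> b \<in> carrier ?A \<Longrightarrow> P a \<Longrightarrow> P b \<Longrightarrow> P (a \<oplus>\<^bsub>?A\<^esub> b)"
      and scalar: "\<And>\<alpha> a. \<alpha> \<in> ?\<kappa> ` carrier K \<Longrightarrow> a \<in> carrier ?A \<Longrightarrow> P a \<Longrightarrow> P (\<alpha> \<otimes>\<^bsub>?A\<^esub> a)"
      and var: "\<And>i a. i < c \<Longrightarrow> a \<in> carrier ?A \<Longrightarrow> P a \<Longrightarrow> P (exterior_gen K c i \<otimes>\<^bsub>?A\<^esub> a)"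
      and a: "a \<in> carrier ?A" for P a
    proof -
      obtain f where f: "f \<in> carrier ?F" "a = ?\<pi> f" using \<pi>_surj[OF a] by blast
      have "P (?\<pi> f)"
      proof (rule K.free_algebra_induct[OF f(1), of "\<lambda>f. P (?\<pi> f)"])
        show "P (?\<pi> (K.scalar_word b \<otimes>\<^bsub>?F\<^esub> g))" if "b \<in> carrier K" "g \<in> carrier ?F" "P (?\<pi> g)" for b g
          using that scalar[of "?\<kappa> b" "?\<pi> g"] sc by simp
        show "P (?\<pi> (?x i \<otimes>\<^bsub>?F\<^esub> g))" if "i \<in> {1..c}" "g \<in> carrier ?F" "P (?\<pi> g)" for i g
        proof -
          have "i = Suc (i - 1)" "i - 1 < c" using that(1) by auto
          then obtain i' where "i = Suc i'" "i' < c" by blast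
          then show ?thesis using that(2,3) var[of i' "?\<pi> g"] x by (simp add: gen)
        qed
      qed (use one add in simp_all)
      then show ?thesis using f(2) by simp
    qed
    show "exterior_contraction K c j a \<in> carrier ?A" if "a \<in> carrier ?A" for a j
      using \<pi>_surj[OF that] d_cl by (auto simp: con)
    show "exterior_contraction K c j (a \<oplus>\<^bsub>?A\<^esub> b) = exterior_contraction K c j a \<oplus>\<^bsub>?A\<^esub> exterior_contraction K c j b"
      if a: "a \<in> carrier ?A" and b: "b \<in> carrier ?A" for a b j
    proof -
      obtain f g where fg: "f \<in> carrier ?F" "a = ?\<pi> f" "g \<in> carrier ?F" "b = ?\<pi> g"
        using \<pi>_surj[OF a] \<pi>_surj[OF b] by blast
      have "exterior_contraction K c j (?\<pi> (f \<oplus>\<^bsub>?F\<^esub> g)) = ?\<pi> (?d (Suc j) f \<oplus>\<^bsub>?F\<^esub> ?d (Suc j) g)"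
        using fg by (subst con) (simp_all add: d_add)
      then show ?thesis using fg d_cl by (simp add: con)
    qed
    show "exterior_contraction K c j (\<alpha> \<otimes>\<^bsub>?A\<^esub> a) = \<alpha> \<otimes>\<^bsub>?A\<^esub> exterior_contraction K c j a"
      if \<alpha>: "\<alpha> \<in> ?\<kappa> ` carrier K" and a: "a \<in> carrier ?A" for \<alpha> a j
    proof -
      obtain b f where bf: "b \<in> carrier K" "\<alpha> = ?\<kappa> b" "f \<in> carrier ?F" "a = ?\<pi> f"
        using \<alpha> \<pi>_surj[OF a] by blast
      have "?d (Suc j) (K.scalar_word b \<otimes>\<^bsub>?F\<^esub> f) = K.scalar_word b \<otimes>\<^bsub>?F\<^esub> ?d (Suc j) f"
        unfolding sc_mult[OF bf(1,3)] sc_mult[OF bf(1) d_cl[OF bf(3)]]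
        using K.word_contraction_smult[OF K.free_algebra_range[OF bf(3)] bf(1)] by blast
      then have "exterior_contraction K c j (?\<pi> (K.scalar_word b \<otimes>\<^bsub>?F\<^esub> f)) = ?\<pi> (K.scalar_word b \<otimes>\<^bsub>?F\<^esub> ?d (Suc j) f)"
        using bf sc by (subst con) simp_all
      then show ?thesis using bf d_cl sc by (simp add: con)
    qed
    show "exterior_contraction K c j (exterior_gen K c i \<otimes>\<^bsub>?A\<^esub> a) \<oplus>\<^bsub>?A\<^esub>
        exterior_gen K c i \<otimes>\<^bsub>?A\<^esub> exterior_contraction K c j a = (if i = j then a else \<zero>\<^bsub>?A\<^esub>)"
      if i: "i < c" and j: "j < c" and a: "a \<in> carrier ?A" for i j a
    proof -
      obtain f where f: "f \<in> carrier ?F" "a = ?\<pi> f" using \<pi>_surj[OF a] by blast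
      have xf: "?x (Suc i) \<otimes>\<^bsub>?F\<^esub> f \<in> carrier ?F" "?x (Suc i) \<otimes>\<^bsub>?F\<^esub> ?d (Suc j) f \<in> carrier ?F"
        using x[OF i] f(1) d_cl by simp_all
      have "?d (Suc j) (?x (Suc i) \<otimes>\<^bsub>?F\<^esub> f) \<oplus>\<^bsub>?F\<^esub> ?x (Suc i) \<otimes>\<^bsub>?F\<^esub> ?d (Suc j) f =
          (if i = j then f else \<zero>\<^bsub>?F\<^esub>)"
        unfolding K.mult_free_algebra free_algebra_simps(4,5)
        using K.word_contraction_free_gen_conv[OF K.free_algebra_range[OF f(1)], of "Suc j" "Suc i"]
        by (simp add: fun_eq_iff)
      then have "?\<pi> (?d (Suc j) (?x (Suc i) \<otimes>\<^bsub>?F\<^esub> f) \<oplus>\<^bsub>?F\<^esub> ?x (Suc i) \<otimes>\<^bsub>?F\<^esub> ?d (Suc j) f) =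
          ?\<pi> (if i = j then f else \<zero>\<^bsub>?F\<^esub>)" by simp
      then have "?\<pi> (?d (Suc j) (?x (Suc i) \<otimes>\<^bsub>?F\<^esub> f)) \<oplus>\<^bsub>?A\<^esub> ?\<pi> (?x (Suc i)) \<otimes>\<^bsub>?A\<^esub> ?\<pi> (?d (Suc j) f) =
          (if i = j then ?\<pi> f else \<zero>\<^bsub>?A\<^esub>)"
        using xf d_cl f(1) x[OF i] by (simp split: if_splits)
      moreover have "exterior_contraction K c j (?\<pi> (?x (Suc i) \<otimes>\<^bsub>?F\<^esub> f)) = ?\<pi> (?d (Suc j) (?x (Suc i) \<otimes>\<^bsub>?F\<^esub> f))"
        by (rule con[OF xf(1)])
      ultimately show ?thesis using f i x by (simp add: gen con)
    qed
  qed
qed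

theorem corollary3p5:
  fixes K :: "('k, 'x) ring_scheme" and c :: nat
    and M :: "((nat list \<Rightarrow> 'k) set, 'm, 'y) module_scheme"
    and N :: "((nat list \<Rightarrow> 'k) set, 'n, 'z) module_scheme"
  defines "A \<equiv> exterior_algebra K c"
  assumes "field K" and "c \<ge> 1"
    and "left_module A M" and "finitely_generated_module A M"
    and "left_module A N" and "finitely_generated_module A N"
  shows "(\<forall>n>0. trivial_group (Ext A M N n)) \<or>
    (\<exists>m0. (\<forall>n\<ge>m0. even n \<longrightarrow> \<not> trivial_group (Ext A M N n)) \<or>
          (\<forall>n\<ge>m0. odd n \<longrightarrow> \<not> trivial_group (Ext A M N n)))"
proof -
  let ?P = "\<lambda>P :: (nat \<Rightarrow> ((nat list \<Rightarrow> 'k) set, 'm) basis_name set) \<times> _.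
    case P of (B, d, \<epsilon>) \<Rightarrow> free_resolution A M B d \<epsilon>"
  obtain B d \<epsilon> where eq: "(SOME P. ?P P) = (B, d, \<epsilon>)" by (rule prod_cases3)
  have "?P (SOME P. ?P P)"
  proof (rule someI_ex)
    obtain B :: "nat \<Rightarrow> ((nat list \<Rightarrow> 'k) set, 'm) basis_name set" and d \<epsilon> where "free_resolution A M B d \<epsilon>"
      using free_resolution_exists[OF \<open>left_module A M\<close>] by blast
    then have "?P (B, d, \<epsilon>)" by simp
    then show "\<exists>P. ?P P" ..
  qed
  then have res: "free_resolution A M B d \<epsilon>" unfolding eq by simp
  have Ext: "Ext A M N n = cohomology A B d N n" for n
    unfolding Ext_def eq by simp
  interpret E: exterior_ring A "(\<lambda>a. exterior_class K c (ring.scalar_word K a)) ` carrier K"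
    "exterior_gen K c" c "exterior_contraction K c"
    unfolding A_def by (rule exterior_algebra_exterior_ring[OF \<open>field K\<close>])
  show ?thesis
    unfolding Ext
    by (rule E.ext_vanishing_dichotomy[OF \<open>left_module A M\<close> \<open>finitely_generated_module A M\<close>
          \<open>left_module A N\<close> \<open>finitely_generated_module A N\<close> res])
qed

end
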